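(* Let $d\ge2$ and let $\{\omega(\mathbf u):\mathbf u\in\mathbb Z_+^d\}$ be i.i.d. real random variables such that (i) there exists $\xi>0$ with $\mathbb E\big(e^{\xi|\omega(\mathbf 0)|}\big)<\infty$, and (ii) $\mathbb P\{\omega(\mathbf 0)>r\}>0$ for all $r<\infty$. Then for every $\mathbf u\in\mathbb R_+^d\setminus\{\mathbf 0\}$ and $r\in\mathbb R$ the limit $$J_{\mathbf u}(r)=-\lim_{n\to\infty}n^{-1}\log\mathbb P\{\log Z_{\lfloor n\mathbf u\rfloor}\ge nr\}$$ exists and takes values in $\mathbb R_+=[0,\infty)$. As a function of $(\mathbf u,r)$, $J$ is convex and continuous on $(\mathbb R_+^d\setminus\{\mathbf 0\})\times\mathbb R$. Moreover, $J_{\mathbf u}(r)=0$ if and only if $r\le p(\mathbf u)$.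
   Context: $\mathbb Z_+$ and $\mathbb R_+$ denote nonnegative integers and nonnegative reals. For $\mathbf y\in\mathbb R_+^d$, $\lfloor\mathbf y\rfloor=(\lfloor y_1\rfloor,\dots,\lfloor y_d\rfloor)$, and $|\mathbf u|_1=|u_1|+\dots+|u_d|$. For $\mathbf u\in\mathbb Z_+^d$, $$Z_{\mathbf u}=\sum_{x_\cdot\in\Pi_{\mathbf u}}e^{\sum_{j=1}^{|\mathbf u|_1}\omega(x_j)},$$ where $\Pi_{\mathbf u}$ is the set of directed lattice paths $x_0=\mathbf 0,x_1,\dots,x_{|\mathbf u|_1}=\mathbf u$ in $\mathbb Z_+^d$ whose steps $x_{k+1}-x_k$ are standard basis vectors $\mathbf e_1,\dots,\mathbf e_d$ (the weight at the starting point $\mathbf 0$ is not included). Under assumption (i), $p(\mathbf y)=\lim_{n\to\infty}n^{-1}\log Z_{\lfloor n\mathbf y\rfloor}$ exists almost surely (simultaneously for all $\mathbf y\in\mathbb R_+^d$) and in $L^1(\mathbb P)$, and is a finite deterministic, concave and continuous function of $\mathbf y\in\mathbb R_+^d$. *)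

theory Defs
  imports "HOL-Probability.Probability"
begin

type_synonym 'd site = "nat ^ 'd"

definition l1 :: "('d::finite) site \<Rightarrow> nat" where
  "l1 u = (\<Sum>i\<in>UNIV. u $ i)"

text \<open>Only used for vectors with nonnegative coordinates, where truncation by \<open>nat\<close> is harmless.\<close>

definition floor_site :: "real ^ 'd \<Rightarrow> ('d::finite) site" where
  "floor_site y = (\<chi> i. nat \<lfloor>y $ i\<rfloor>)"

text \<open>The path \<open>x\<^sub>0, \<dots>, x\<^sub>N\<close> with \<open>N = |u|\<^sub>1\<close> is the list of its \<open>N + 1\<close> sites.\<close>

definition paths :: "('d::finite) site \<Rightarrow> 'd site list set" where
  "paths u = {x. length x = Suc (l1 u) \<and> x ! 0 = 0 \<and> x ! l1 u = u \<and>
                 (\<forall>k<l1 u. \<exists>i. x ! Suc k = x ! k + axis i 1)}"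

definition Z :: "(('d::finite) site \<Rightarrow> real) \<Rightarrow> 'd site \<Rightarrow> real" where
  "Z w u = (\<Sum>x\<in>paths u. exp (\<Sum>j=1..l1 u. w (x ! j)))"

text \<open>The almost sure limit is unique on a probability space and is deterministic under the
  exponential moment hypothesis.\<close>

definition free_energy ::
  "'a measure \<Rightarrow> (('d::finite) site \<Rightarrow> 'a \<Rightarrow> real) \<Rightarrow> real ^ 'd \<Rightarrow> real" where
  "free_energy M \<omega> y =
     (THE c. AE s in M.
        (\<lambda>n. ln (Z (\<lambda>v. \<omega> v s) (floor_site (real n *\<^sub>R y))) / real n) \<longlonglongrightarrow> c)"

definition upper_tail ::
  "'a measure \<Rightarrow> (('d::finite) site \<Rightarrow> 'a \<Rightarrow> real) \<Rightarrow> real ^ 'd \<Rightarrow> real \<Rightarrow> nat \<Rightarrow> real" where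
  "upper_tail M \<omega> u r n =
     measure M {s \<in> space M. ln (Z (\<lambda>v. \<omega> v s) (floor_site (real n *\<^sub>R u))) \<ge> real n * r}"

definition rate_J ::
  "'a measure \<Rightarrow> (('d::finite) site \<Rightarrow> 'a \<Rightarrow> real) \<Rightarrow> real ^ 'd \<Rightarrow> real \<Rightarrow> real" where
  "rate_J M \<omega> u r = - lim (\<lambda>n. ln (upper_tail M \<omega> u r n) / real n)"

definition orthant :: "(real ^ 'd::finite) set" where
  "orthant = {u. \<forall>i. 0 \<le> u $ i}"

text \<open>Path sets are finite and nonempty, so \<open>Z\<close> is a genuine, strictly positive sum.\<close>

lemma finite_bounded_sites: "finite {v :: ('d::finite) site. \<forall>i. v $ i \<le> N}"
proof -
  have "{v :: 'd site. \<forall>i. v $ i \<le> N} \<subseteq> vec_lambda ` (PiE UNIV (\<lambda>_. {..N}))"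
  proof
    fix v :: "'d site"
    assume "v \<in> {v. \<forall>i. v $ i \<le> N}"
    then have "vec_nth v \<in> PiE UNIV (\<lambda>_. {..N})" by auto
    then have "vec_lambda (vec_nth v) \<in> vec_lambda ` (PiE UNIV (\<lambda>_. {..N}))" by (rule imageI)
    then show "v \<in> vec_lambda ` (PiE UNIV (\<lambda>_. {..N}))" by simp
  qed
  then show ?thesis by (rule finite_subset) (intro finite_imageI finite_PiE, auto)
qed

lemma finite_paths: "finite (paths u)"
proof -
  let ?V = "{v :: 'a site. \<forall>i. v $ i \<le> l1 u}"
  have "paths u \<subseteq> {x. set x \<subseteq> ?V \<and> length x = Suc (l1 u)}"
  proof
    fix x assume x: "x \<in> paths u"
    have le: "\<forall>i. (x ! k) $ i \<le> k" if "k \<le> l1 u" for k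
      using that
    proof (induction k)
      case 0
      then show ?case using x by (simp add: paths_def)
    next
      case (Suc k)
      then have "k < l1 u" by simp
      moreover have "\<forall>k<l1 u. \<exists>i. x ! Suc k = x ! k + axis i 1"
        using x unfolding paths_def by blast
      ultimately obtain j where "x ! Suc k = x ! k + axis j 1" by blast
      with Suc show ?case by (auto simp: axis_def le_SucI)
    qed
    have len: "length x = Suc (l1 u)" using x by (simp add: paths_def)
    have "\<forall>v\<in>set x. v \<in> ?V"
    proof
      fix v
      assume "v \<in> set x"
      then obtain k where "v = x ! k" "k \<le> l1 u"
        using len by (auto simp: in_set_conv_nth less_Suc_eq_le)
      then show "v \<in> ?V" using le[of k] order_trans by blast
    qed
    then show "x \<in> {x. set x \<subseteq> ?V \<and> length x = Suc (l1 u)}"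
      using len by blast
  qed
  then show ?thesis
    by (rule finite_subset) (rule finite_lists_length_eq[OF finite_bounded_sites])
qed

lemma paths_nonempty: "paths u \<noteq> {}"
proof (induction "l1 u" arbitrary: u)
  case 0
  then have "u = 0" by (auto simp: l1_def vec_eq_iff)
  then have "[0] \<in> paths u" using 0 by (auto simp: paths_def)
  then show ?case by blast
next
  case (Suc n)
  then obtain i where i: "u $ i \<noteq> 0"
    unfolding l1_def by (metis Zero_not_Suc sum.neutral)
  define v where "v = (\<chi> j. if j = i then u $ j - 1 else u $ j)"
  have u: "u = v + axis i 1"
    using i by (auto simp: v_def vec_eq_iff axis_def)
  then have "l1 u = l1 v + 1"
    by (simp add: l1_def sum.distrib axis_def)
  with Suc obtain x where x: "x \<in> paths v" and l: "l1 u = Suc (l1 v)" by fastforce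
  have "\<exists>j. u = v + axis j 1" using u by blast
  then have "x @ [u] \<in> paths u"
    using x by (auto simp: paths_def nth_append l less_Suc_eq simp del: One_nat_def)
  then show ?case by blast
qed

lemma Z_pos: "Z w u > 0"
  unfolding Z_def by (rule sum_pos) (auto simp: finite_paths paths_nonempty)

end

theory Submission
  imports Defs
begin

text \<open>
  Splitting a path at an intermediate site makes \<open>(v, r) \<mapsto> ln P(ln Z v \<ge> r)\<close> superadditive, so
  the limit \<open>-J\<close> exists along rays by Fekete's lemma and is superadditive and homogeneous, hence
  concave. Superadditivity also gives the semicontinuity of \<open>J\<close> from above, and continuity within a
  face of the orthant. To compare a boundary point \<open>u\<close> with nearby points outside its face, the few
  steps in the directions missing from \<open>u\<close> are turned into a direction of the face; this costs only
  an entropy factor that is small on the exponential scale.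

  For the zero set, let \<open>g u\<close> be the limit of \<open>E (ln Z) / n\<close>. Below \<open>g u\<close> the lower tail decays
  exponentially by submultiplicativity of the negative moments of \<open>Z\<close>. Above \<open>g u\<close> one shows that
  \<open>E (Z ^ t) \<le> exp (t (E (ln Z) + small))\<close> for a small \<open>t\<close>: within a block this is Jensen's inequality
  reversed at the price of slightly increasing the weights, proved one site at a time, and blocks are
  glued by the subadditivity of \<open>x \<mapsto> x ^ t\<close>. So \<open>g u\<close> is the almost sure limit, and \<open>J = 0\<close> exactly
  up to \<open>g u\<close>.
\<close>

section \<open>Lattice paths and partition functions\<close>

text \<open>The weight at the starting site is not counted, so the two legs of a path through
  \<open>u\<close> use disjoint sets of weights; all sub- and supermultiplicative estimates rest on
  this independence. Hypothesis (ii) makes every level reachable at a finite price per step, so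
  logarithmic tails are finite and any bounded mismatch left by rounding costs a constant, which
  disappears after division by \<open>n\<close>. The reversed Jensen inequality instead raises a
  weight \<open>x\<close> by \<open>t * C * exp (s * \<bar>x\<bar>)\<close>. The largest such
  increase in a block is controlled by a moment of high order, which is why \<open>s\<close> is a
  small fraction of \<open>\<xi>\<close>. Gluing costs an entropy per block that is logarithmic in
  the block length but does not shrink with \<open>t\<close>; this forces long blocks, while the
  increase of the weights forces small \<open>t\<close>.\<close>

definition unit_site :: "'d::finite \<Rightarrow> 'd site" where
  "unit_site c = axis c 1"

lemma unit_site_nth [simp]: "unit_site c $ i = (if i = c then 1 else 0)"
  by (simp add: unit_site_def axis_def)

text \<open>The coordinatewise order as a set. Subtraction of sites is truncated, so
  \<open>w - u\<close> is a genuine difference exactly when \<open>u\<close> lies in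
  \<open>below w\<close>; most statements about differences carry this condition.\<close>

definition below :: "('d::finite) site \<Rightarrow> 'd site set" where
  "below u = {v. \<forall>i. v $ i \<le> u $ i}"

lemma finite_below [simp]: "finite (below u)"
proof (rule finite_subset[OF _ finite_bounded_sites[of "l1 u"]])
  show "below u \<subseteq> {v. \<forall>i. v $ i \<le> l1 u}"
    by (auto simp: below_def l1_def intro: order_trans[OF _ member_le_sum])
qed

lemma l1_zero [simp]: "l1 0 = 0"
  by (simp add: l1_def)

lemma l1_add [simp]: "l1 (u + v) = l1 u + l1 v"
  by (simp add: l1_def sum.distrib)

lemma l1_unit [simp]: "l1 (unit_site c) = 1"
  by (simp add: l1_def)

lemma l1_eq_0_iff [simp]: "l1 u = 0 \<longleftrightarrow> u = 0"
  by (auto simp: l1_def vec_eq_iff)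

lemma component_le_l1: "u $ i \<le> l1 u"
  unfolding l1_def by (rule member_le_sum) auto

lemma below_add_iff: "u \<in> below w \<longleftrightarrow> (\<exists>v. w = u + v)"
proof
  assume "u \<in> below w"
  then have "w = u + (w - u)" by (simp add: below_def vec_eq_iff)
  then show "\<exists>v. w = u + v" by blast
qed (auto simp: below_def)

lemma add_diff_below: "u \<in> below w \<Longrightarrow> u + (w - u) = (w :: ('d::finite) site)"
  by (simp add: below_def vec_eq_iff)

lemma l1_diff: "u \<in> below w \<Longrightarrow> l1 (w - u) = l1 w - l1 u"
  by (metis add_diff_below diff_add_inverse l1_add)

lemma l1_mono: "u \<in> below w \<Longrightarrow> l1 u \<le> l1 w"
  by (metis add_diff_below le_add1 l1_add)

lemma diff_unit_add: "u $ c \<noteq> 0 \<Longrightarrow> u - unit_site c + unit_site c = u"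
  by (auto simp: vec_eq_iff)

lemma l1_diff_unit: "u $ c \<noteq> 0 \<Longrightarrow> l1 u = Suc (l1 (u - unit_site c))"
  by (metis Suc_eq_plus1 diff_unit_add l1_add l1_unit)

lemma below_diff_unit_iff:
  assumes "v $ c \<noteq> 0"
  shows "y \<in> below (v - unit_site c) \<longleftrightarrow> y \<in> below v \<and> y $ c \<noteq> v $ c"
proof -
  have "y $ i \<le> (v - unit_site c) $ i \<longleftrightarrow> y $ i \<le> v $ i \<and> (i = c \<longrightarrow> y $ i \<noteq> v $ i)" for i
    using assms by auto
  then show ?thesis unfolding below_def by blast
qed

lemma diff_below_nth: "y \<in> below v \<Longrightarrow> (v - y) $ c \<noteq> 0 \<longleftrightarrow> y $ c \<noteq> v $ c"
  by (simp add: below_def) (metis le_antisym less_imp_neq not_less)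

text \<open>A bound polynomial in \<open>k\<close> and independent of \<open>u\<close>: it keeps the
  entropy of gluing blocks logarithmic in their length.\<close>

lemma card_level: "card {y \<in> below u. l1 y \<le> k} \<le> (k + 1) ^ CARD('d)"
  for u :: "('d::finite) site"
proof -
  have "{y \<in> below u. l1 y \<le> k} \<subseteq> vec_lambda ` (PiE UNIV (\<lambda>_. {..k}))"
  proof
    fix y assume y: "y \<in> {y \<in> below u. l1 y \<le> k}"
    then have "vec_nth y \<in> PiE UNIV (\<lambda>_. {..k})"
      using component_le_l1[of y] order_trans by auto
    then have "vec_lambda (vec_nth y) \<in> vec_lambda ` (PiE UNIV (\<lambda>_. {..k}))" by (rule imageI)
    then show "y \<in> vec_lambda ` (PiE UNIV (\<lambda>_. {..k}))" by simp
  qed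
  then have "card {y \<in> below u. l1 y \<le> k}
      \<le> card (vec_lambda ` (PiE UNIV (\<lambda>_::'d. {..k})))"
    by (intro card_mono finite_imageI finite_PiE) auto
  also have "\<dots> \<le> card (PiE UNIV (\<lambda>_::'d. {..k}))"
    by (intro card_image_le finite_PiE) auto
  also have "\<dots> = (k + 1) ^ CARD('d)"
    by (simp add: card_PiE)
  finally show ?thesis .
qed

lemma card_below: "card (below u) \<le> (l1 u + 1) ^ CARD('d)"
  for u :: "('d::finite) site"
proof -
  have "below u = {y \<in> below u. l1 y \<le> l1 u}" using l1_mono by auto
  then show ?thesis using card_level[of u "l1 u"] by simp
qed

section \<open>Recursion, decompositions and deterministic bounds for \<open>Z\<close>\<close>

lemma paths_0: "paths (0 :: ('d::finite) site) = {[0]}"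
proof -
  have "x \<in> paths (0 :: 'd site) \<longleftrightarrow> x = [0]" for x
    by (cases x) (auto simp: paths_def)
  then show ?thesis by blast
qed

lemma Z_0 [simp]: "Z w 0 = 1"
  by (simp add: Z_def paths_0)

lemma paths_rec:
  fixes u :: "('d::finite) site"
  assumes "u \<noteq> 0"
  shows "paths u = (\<Union>c\<in>{c. u $ c \<noteq> 0}. (\<lambda>x. x @ [u]) ` paths (u - unit_site c))"
proof (intro equalityI subsetI)
  fix x assume x: "x \<in> paths u"
  from assms have "l1 u \<noteq> 0" by simp
  then obtain n where n: "l1 u = Suc n" using not0_implies_Suc by blast
  have step: "\<exists>i. x ! Suc n = x ! n + axis i 1"
    using x n by (auto simp: paths_def)
  then obtain c where c: "u = x ! n + unit_site c"
    using x n by (auto simp: paths_def unit_site_def)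
  then have uc: "u $ c \<noteq> 0" by simp
  have d: "u - unit_site c = x ! n" using c by (simp add: vec_eq_iff)
  have len: "length x = Suc (Suc n)" using x n by (simp add: paths_def)
  then have ne: "x \<noteq> []" by auto
  have "last x = u" using x n len by (simp add: last_conv_nth[OF ne] paths_def)
  then have xb: "x = butlast x @ [u]" using append_butlast_last_id[OF ne] by simp
  have ln: "l1 (u - unit_site c) = n" using l1_diff_unit[OF uc] n by simp
  have "butlast x \<in> paths (u - unit_site c)"
    using x len n unfolding paths_def ln by (auto simp: nth_butlast d)
  then show "x \<in> (\<Union>c\<in>{c. u $ c \<noteq> 0}. (\<lambda>x. x @ [u]) ` paths (u - unit_site c))"
    using uc xb by blast
next
  fix x assume "x \<in> (\<Union>c\<in>{c. u $ c \<noteq> 0}. (\<lambda>x. x @ [u]) ` paths (u - unit_site c))"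
  then obtain c y where c: "u $ c \<noteq> 0" and y: "y \<in> paths (u - unit_site c)" and xy: "x = y @ [u]"
    by blast
  have l: "l1 u = Suc (l1 (u - unit_site c))" using c by (rule l1_diff_unit)
  have j: "\<exists>j. u = (u - unit_site c) + axis j 1"
    using diff_unit_add[OF c] unfolding unit_site_def by metis
  define u' where "u' = u - unit_site c"
  show "x \<in> paths u"
    using y j l unfolding xy u'_def[symmetric]
    by (auto simp: paths_def nth_append less_Suc_eq simp del: One_nat_def)
qed

text \<open>The sum is split by the last step. The later identities and inequalities for
  \<open>Z\<close> are proved by induction along this recursion; the path lists return only for
  measurability.\<close>

lemma Z_rec:
  fixes u :: "('d::finite) site"
  assumes "u \<noteq> 0"
  shows "Z w u = exp (w u) * (\<Sum>c | u $ c \<noteq> 0. Z w (u - unit_site c))"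
proof -
  let ?S = "{c. u $ c \<noteq> 0}"
  let ?f = "\<lambda>x. exp (\<Sum>j=1..l1 u. w (x ! j))"
  have inj: "inj_on (\<lambda>x. x @ [u]) A" for A by (auto simp: inj_on_def)
  \<comment> \<open>If one list came from two directions, both predecessors would be its entry at
    the same index, so \<open>u - unit_site c\<close> and \<open>u - unit_site c'\<close> would
    agree; they differ in coordinate \<open>c\<close>, where \<open>u $ c\<close> is really
    lowered.\<close>
  have disj: "(\<lambda>x. x @ [u]) ` paths (u - unit_site c) \<inter> (\<lambda>x. x @ [u]) ` paths (u - unit_site c') = {}"
    if "c \<in> ?S" "c' \<in> ?S" "c \<noteq> c'" for c c'
  proof (rule ccontr)
    assume "\<not> ?thesis"
    then obtain y where y: "y \<in> paths (u - unit_site c)" "y \<in> paths (u - unit_site c')"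
      by auto
    have "l1 (u - unit_site c) = l1 (u - unit_site c')"
      using that l1_diff_unit[of u c] l1_diff_unit[of u c'] by simp
    then have "u - unit_site c = u - unit_site c'" using y by (auto simp: paths_def)
    then have "(u - unit_site c) $ c = (u - unit_site c') $ c" by simp
    then show False using that by simp
  qed
  have "Z w u = sum ?f (\<Union>c\<in>?S. (\<lambda>x. x @ [u]) ` paths (u - unit_site c))"
    unfolding Z_def paths_rec[OF assms] ..
  also have "\<dots> = (\<Sum>c\<in>?S. \<Sum>x\<in>(\<lambda>x. x @ [u]) ` paths (u - unit_site c). ?f x)"
    by (rule sum.UNION_disjoint) (use disj in \<open>auto intro: finite_imageI finite_paths\<close>)
  also have "\<dots> = (\<Sum>c\<in>?S. \<Sum>x\<in>paths (u - unit_site c). ?f (x @ [u]))"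
    by (rule sum.cong[OF refl], subst sum.reindex[OF inj]) (simp only: o_def)
  also have "\<dots> = (\<Sum>c\<in>?S. exp (w u) * Z w (u - unit_site c))"
  proof (rule sum.cong[OF refl])
    fix c assume c: "c \<in> ?S"
    then have l: "l1 u = Suc (l1 (u - unit_site c))"
      by (intro l1_diff_unit) simp
    have "?f (x @ [u]) = exp (w u) * exp (\<Sum>j=1..l1 (u - unit_site c). w (x ! j))"
      if "x \<in> paths (u - unit_site c)" for x
    proof -
      have "length x = Suc (l1 (u - unit_site c))" using that by (simp add: paths_def)
      then have "(\<Sum>j=1..l1 u. w ((x @ [u]) ! j)) = (\<Sum>j=1..l1 (u - unit_site c). w (x ! j)) + w u"
        unfolding l by (auto simp: nth_append intro!: sum.cong)
      then show ?thesis by (simp add: exp_add)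
    qed
    then show "(\<Sum>x\<in>paths (u - unit_site c). ?f (x @ [u])) = exp (w u) * Z w (u - unit_site c)"
      by (simp add: Z_def sum_distrib_left)
  qed
  finally show ?thesis by (simp add: sum_distrib_left)
qed

lemma site_induct [case_names zero step]:
  fixes u :: "('d::finite) site"
  assumes "P 0" and "\<And>u. u \<noteq> 0 \<Longrightarrow> (\<And>c. u $ c \<noteq> 0 \<Longrightarrow> P (u - unit_site c)) \<Longrightarrow> P u"
  shows "P u"
proof (induction "l1 u" arbitrary: u rule: less_induct)
  case less
  show ?case
  proof (cases "u = 0")
    case False
    have "l1 (u - unit_site c) < l1 u" if "u $ c \<noteq> 0" for c
      using l1_diff_unit[OF that] by simp
    then show ?thesis using less assms(2)[OF False] by blast
  qed (use assms(1) in simp)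
qed

text \<open>Leaving out \<open>0\<close> matters: it makes the partition function started at
  \<open>u\<close> independent of the one ending at \<open>u\<close>.\<close>

lemma Z_cong:
  assumes "\<And>v. v \<in> below u \<Longrightarrow> v \<noteq> 0 \<Longrightarrow> w v = w' v"
  shows "Z w u = Z w' u"
  using assms
proof (induction u rule: site_induct)
  case (step u)
  have "Z w (u - unit_site c) = Z w' (u - unit_site c)" if "u $ c \<noteq> 0" for c
    using step.IH[OF that] step.prems below_diff_unit_iff[OF that] by blast
  moreover have "w u = w' u" using step by (auto simp: below_def)
  ultimately show ?case using step.hyps by (simp add: Z_rec)
qed simp

lemma Z_unit [simp]: "Z w (unit_site c) = exp (w (unit_site c))"
proof -
  have "(unit_site c :: 'a site) \<noteq> 0" by (metis l1_unit l1_zero zero_neq_one)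
  moreover have "{d. (unit_site c :: 'a site) $ d \<noteq> 0} = {c}" by auto
  moreover have "unit_site c - unit_site c = (0 :: 'a site)" by (simp add: vec_eq_iff)
  ultimately show ?thesis by (simp add: Z_rec)
qed

text \<open>The left-hand side counts the paths through \<open>u\<close>. In the recursion at
  \<open>u + v\<close> the predecessors in directions with \<open>v $ c = 0\<close> are dropped,
  because they no longer dominate \<open>u\<close>.\<close>

lemma Z_superadditive: "Z w (u + v) \<ge> Z w u * Z (\<lambda>x. w (u + x)) v"
proof (induction v rule: site_induct)
  case (step v)
  have ne: "u + v \<noteq> 0" using step.hyps by (auto simp: vec_eq_iff)
  let ?S = "{c. v $ c \<noteq> 0}" and ?T = "{c. (u + v) $ c \<noteq> 0}"
  have "Z w u * Z (\<lambda>x. w (u + x)) v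
     = exp (w (u + v)) * (\<Sum>c\<in>?S. Z w u * Z (\<lambda>x. w (u + x)) (v - unit_site c))"
    using step.hyps by (simp add: Z_rec[of v] sum_distrib_left mult_ac)
  also have "\<dots> \<le> exp (w (u + v)) * (\<Sum>c\<in>?S. Z w (u + v - unit_site c))"
  proof (intro mult_left_mono sum_mono)
    fix c assume c: "c \<in> ?S"
    then have "u + (v - unit_site c) = u + v - unit_site c"
      by (auto simp: vec_eq_iff)
    then show "Z w u * Z (\<lambda>x. w (u + x)) (v - unit_site c) \<le> Z w (u + v - unit_site c)"
      using step.IH[of c] c by auto
  qed simp
  also have "\<dots> \<le> exp (w (u + v)) * (\<Sum>c\<in>?T. Z w (u + v - unit_site c))"
    by (intro mult_left_mono sum_mono2) (auto intro: less_imp_le Z_pos)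
  also have "\<dots> = Z w (u + v)" using ne by (simp add: Z_rec)
  finally show ?case .
qed simp

lemma ln_Z_superadditive: "ln (Z w (u + v)) \<ge> ln (Z w u) + ln (Z (\<lambda>x. w (u + x)) v)"
proof -
  have "ln (Z w u) + ln (Z (\<lambda>x. w (u + x)) v) = ln (Z w u * Z (\<lambda>x. w (u + x)) v)"
    using Z_pos[of w u] Z_pos[of "\<lambda>x. w (u + x)" v] by (simp add: ln_mult)
  also have "\<dots> \<le> ln (Z w (u + v))"
    using Z_superadditive[of w u v] Z_pos[of w u] Z_pos[of "\<lambda>x. w (u + x)" v]
    by (subst ln_le_cancel_iff) (auto simp: Z_pos)
  finally show ?thesis .
qed

text \<open>Every path to \<open>v\<close> is at exactly one site \<open>y\<close> after
  \<open>k\<close> steps, and the two legs at \<open>y\<close> multiply.\<close>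

lemma Z_level_decomposition:
  fixes v :: "('d::finite) site"
  assumes "k \<le> l1 v"
  shows "Z w v \<le> (\<Sum>y | y \<in> below v \<and> l1 y = k. Z w y * Z (\<lambda>x. w (y + x)) (v - y))"
  using assms
proof (induction v rule: site_induct)
  case zero
  then have "{y \<in> below (0 :: 'd site). l1 y = k} = {0}" by (auto simp: below_def vec_eq_iff)
  then show ?case by simp
next
  case (step v)
  let ?L = "\<lambda>u. {y \<in> below u. l1 y = k}"
  let ?t = "\<lambda>u y. Z w y * Z (\<lambda>x. w (y + x)) (u - y)"
  show ?case
  proof (cases "k = l1 v")
    case True
    then have "?t v v \<le> (\<Sum>y\<in>?L v. ?t v y)"
    proof (intro member_le_sum)
      show "v \<in> ?L v" using True by (simp add: below_def)
      show "finite (?L v)" by (rule finite_subset[OF _ finite_below[of v]]) blast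
    qed (intro less_imp_le mult_pos_pos Z_pos)
    moreover have "v - v = 0" by (simp add: vec_eq_iff)
    ultimately show ?thesis by simp
  next
    case False
    then have k: "k < l1 v" using step.prems by simp
    \<comment> \<open>The predecessors of \<open>v\<close> that still dominate \<open>y\<close>
      correspond to the predecessors of \<open>v - y\<close>; after the sums are exchanged, the
      recursion at \<open>v - y\<close> reassembles the second factor.\<close>
    have diff: "y \<in> ?L (v - unit_site c) \<longleftrightarrow> y \<in> ?L v \<and> (v - y) $ c \<noteq> 0" if "v $ c \<noteq> 0" for c y
      using below_diff_unit_iff[OF that, of y] diff_below_nth[of y v c] by blast
    have "Z w v = exp (w v) * (\<Sum>c | v $ c \<noteq> 0. Z w (v - unit_site c))"
      using step.hyps by (rule Z_rec)
    also have "\<dots> \<le> exp (w v) * (\<Sum>c | v $ c \<noteq> 0. \<Sum>y\<in>?L (v - unit_site c). ?t (v - unit_site c) y)"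
    proof (intro mult_left_mono sum_mono)
      fix c assume c: "c \<in> {c. v $ c \<noteq> 0}"
      then have "k \<le> l1 (v - unit_site c)" using k l1_diff_unit[of v c] by auto
      then show "Z w (v - unit_site c) \<le> (\<Sum>y\<in>?L (v - unit_site c). ?t (v - unit_site c) y)"
        using step.IH[of c] c by simp
    qed simp
    also have "(\<Sum>c | v $ c \<noteq> 0. \<Sum>y\<in>?L (v - unit_site c). ?t (v - unit_site c) y)
      = (\<Sum>y\<in>?L v. \<Sum>c | (v - y) $ c \<noteq> 0. ?t (v - unit_site c) y)"
    proof -
      have "(\<Sum>c | v $ c \<noteq> 0. \<Sum>y\<in>?L (v - unit_site c). ?t (v - unit_site c) y)
        = (\<Sum>c | v $ c \<noteq> 0. \<Sum>y\<in>{y \<in> ?L v. (v - y) $ c \<noteq> 0}. ?t (v - unit_site c) y)"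
        by (intro sum.cong refl) (use diff in blast)
      also have "\<dots> = (\<Sum>y\<in>?L v. \<Sum>c\<in>{c \<in> {c. v $ c \<noteq> 0}. (v - y) $ c \<noteq> 0}. ?t (v - unit_site c) y)"
        by (rule sum.swap_restrict) (auto intro!: finite_subset[OF _ finite_below[of v]])
      also have "\<dots> = (\<Sum>y\<in>?L v. \<Sum>c | (v - y) $ c \<noteq> 0. ?t (v - unit_site c) y)"
        by (intro sum.cong refl) auto
      finally show ?thesis .
    qed
    also have "exp (w v) * (\<Sum>y\<in>?L v. \<Sum>c | (v - y) $ c \<noteq> 0. ?t (v - unit_site c) y)
      = (\<Sum>y\<in>?L v. ?t v y)"
      unfolding sum_distrib_left
    proof (rule sum.cong[OF refl])
      fix y assume y: "y \<in> ?L v"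
      then have "v - y \<noteq> 0" using k add_diff_below[of y v] by auto
      moreover have "v - unit_site c - y = v - y - unit_site c" for c
        by (simp add: vec_eq_iff)
      ultimately show "(\<Sum>c | (v - y) $ c \<noteq> 0. exp (w v) * ?t (v - unit_site c) y) = ?t v y"
        using y by (simp add: Z_rec[of "v - y"] add_diff_below sum_distrib_left mult_ac)
    qed
    finally show ?thesis .
  qed
qed

text \<open>A path to \<open>v\<close> with \<open>v $ i \<noteq> 0\<close> has a unique last step
  in direction \<open>i\<close>, starting at some \<open>p\<close>; afterwards coordinate
  \<open>i\<close> no longer changes.\<close>

lemma Z_last_step_decomposition:
  fixes v :: "('d::finite) site"
  assumes "v $ i \<noteq> 0"
  shows "Z w v \<le> (\<Sum>p | p + unit_site i \<in> below v \<and> Suc (p $ i) = v $ i.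
    Z w p * (exp (w (p + unit_site i)) * Z (\<lambda>x. w (p + unit_site i + x)) (v - (p + unit_site i))))"
  using assms
proof (induction v rule: site_induct)
  case zero
  then have False by (metis zero_index)
  then show ?case ..
next
  case (step v)
  let ?L = "\<lambda>u. {p. p + unit_site i \<in> below u \<and> Suc (p $ i) = u $ i}"
  let ?t = "\<lambda>u p. Z w p * (exp (w (p + unit_site i)) * Z (\<lambda>x. w (p + unit_site i + x)) (u - (p + unit_site i)))"
  let ?C = "{c. v $ c \<noteq> 0}"
  have fin: "finite (?L u)" for u :: "'d site"
    by (rule finite_subset[OF _ finite_below[of u]]) (auto simp: below_def dest: spec intro: add_leD1)
  \<comment> \<open>The term \<open>p = ?q\<close> collects the paths ending with an
    \<open>i\<close>-step. Predecessors in other directions keep coordinate \<open>i\<close>, so the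
    induction hypothesis supplies the remaining terms.\<close>
  let ?q = "v - unit_site i"
  have qv: "?q + unit_site i = v" using step.prems by (rule diff_unit_add)
  then have q: "?q \<in> ?L v" using step.prems by (simp add: below_def)
  have diff: "p \<in> ?L (v - unit_site c) \<longleftrightarrow> p \<in> ?L v - {?q} \<and> (v - (p + unit_site i)) $ c \<noteq> 0"
    if "v $ c \<noteq> 0" "c \<noteq> i" for c p
  proof -
    have "p + unit_site i \<in> below (v - unit_site c) \<longleftrightarrow> p + unit_site i \<in> below v \<and> (v - (p + unit_site i)) $ c \<noteq> 0"
      using below_diff_unit_iff[OF that(1), of "p + unit_site i"]
        diff_below_nth[of "p + unit_site i" v c] by blast
    moreover have "(v - unit_site c) $ i = v $ i" using that by simp
    moreover have "p \<noteq> ?q" if "(v - (p + unit_site i)) $ c \<noteq> 0" using that qv by auto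
    ultimately show ?thesis by auto
  qed
  have "Z w v = exp (w v) * (Z w ?q + (\<Sum>c\<in>?C - {i}. Z w (v - unit_site c)))"
    using step.prems sum.remove[of ?C i "\<lambda>c. Z w (v - unit_site c)"]
    unfolding Z_rec[OF step.hyps] by auto
  also have "\<dots> \<le> exp (w v) * (Z w ?q + (\<Sum>c\<in>?C - {i}. \<Sum>p\<in>?L (v - unit_site c). ?t (v - unit_site c) p))"
  proof (intro mult_left_mono add_left_mono sum_mono)
    fix c assume c: "c \<in> ?C - {i}"
    then have "(v - unit_site c) $ i \<noteq> 0" using step.prems by auto
    then show "Z w (v - unit_site c) \<le> (\<Sum>p\<in>?L (v - unit_site c). ?t (v - unit_site c) p)"
      using step.IH[of c] c by simp
  qed simp
  also have "(\<Sum>c\<in>?C - {i}. \<Sum>p\<in>?L (v - unit_site c). ?t (v - unit_site c) p)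
      = (\<Sum>c\<in>?C - {i}. \<Sum>p\<in>{p \<in> ?L v - {?q}. (v - (p + unit_site i)) $ c \<noteq> 0}. ?t (v - unit_site c) p)"
    by (rule sum.cong[OF refl], rule sum.cong[OF _ refl],
        subst Collect_mem_eq[symmetric], rule Collect_cong, rule diff) auto
  also have "\<dots> = (\<Sum>p\<in>?L v - {?q}. \<Sum>c\<in>{c \<in> ?C - {i}. (v - (p + unit_site i)) $ c \<noteq> 0}. ?t (v - unit_site c) p)"
    by (rule sum.swap_restrict) (use fin in auto)
  also have "exp (w v) * (Z w ?q + \<dots>) = ?t v ?q + (\<Sum>p\<in>?L v - {?q}. ?t v p)"
  proof -
    have 1: "exp (w v) * Z w ?q = ?t v ?q" unfolding qv by (simp add: mult_ac)
    have 2: "exp (w v) * (\<Sum>c\<in>{c \<in> ?C - {i}. (v - (p + unit_site i)) $ c \<noteq> 0}. ?t (v - unit_site c) p) = ?t v p"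
      if p: "p \<in> ?L v - {?q}" for p
    proof -
      let ?r = "v - (p + unit_site i)"
      have pb: "p + unit_site i \<in> below v" using p by simp
      have "?r \<noteq> 0"
      proof
        assume "?r = 0"
        then have "p + unit_site i = v" using add_diff_below[OF pb] by simp
        moreover have "p = p + unit_site i - unit_site i" by (simp add: vec_eq_iff)
        ultimately have "p = ?q" by simp
        then show False using p by simp
      qed
      moreover have "{c \<in> ?C - {i}. ?r $ c \<noteq> 0} = {c. ?r $ c \<noteq> 0}"
      proof -
        have "?r $ i = 0" using p by simp
        moreover have "v $ c \<noteq> 0" if "?r $ c \<noteq> 0" for c using that by simp
        ultimately show ?thesis by blast
      qed
      moreover have "v - unit_site c - (p + unit_site i) = ?r - unit_site c" for c
        by (simp add: vec_eq_iff)
      ultimately show ?thesis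
        using add_diff_below[OF pb]
        by (simp add: Z_rec[of ?r] sum_distrib_left mult_ac)
    qed
    show ?thesis by (simp only: distrib_left 1 sum_distrib_left[of _ _ "?L v - {?q}"] 2 cong: sum.cong)
  qed
  also have "\<dots> = (\<Sum>p\<in>?L v. ?t v p)" by (rule sum.remove[OF fin q, symmetric])
  finally show ?case .
qed

text \<open>A directed path visits a site at most once, so its weight enters a summand as a factor
  \<open>exp y\<close> or not at all. This is the form required by the one-site inequality.\<close>

lemma Z_affine_in_weight:
  "\<exists>A B. A \<ge> 0 \<and> B \<ge> 0 \<and> (\<forall>y. Z (w(v := y)) u = A + B * exp y)"
proof (induction u rule: site_induct)
  case zero
  have "(0::real) \<le> 1 \<and> (0::real) \<le> 0 \<and> (\<forall>y. Z (w(v := y)) 0 = 1 + 0 * exp y)" by simp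
  then show ?case by blast
next
  case (step u)
  show ?case
  proof (cases "u = v")
    case True
    have "Z (w(v := y)) (u - unit_site c) = Z w (u - unit_site c)" if "u $ c \<noteq> 0" for y c
    proof (rule Z_cong)
      fix x assume "x \<in> below (u - unit_site c)"
      then have "x \<noteq> v" using True below_diff_unit_iff[OF that] by blast
      then show "(w(v := y)) x = w x" by simp
    qed
    then have "(\<Sum>c | u $ c \<noteq> 0. Z (w(v := y)) (u - unit_site c)) = (\<Sum>c | u $ c \<noteq> 0. Z w (u - unit_site c))" for y
      by (intro sum.cong) auto
    then have "Z (w(v := y)) u = 0 + (\<Sum>c | u $ c \<noteq> 0. Z w (u - unit_site c)) * exp y" for y
      unfolding Z_rec[OF step.hyps] using True by simp
    moreover have "(\<Sum>c | u $ c \<noteq> 0. Z w (u - unit_site c)) \<ge> 0"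
      by (intro sum_nonneg less_imp_le[OF Z_pos])
    ultimately show ?thesis by (metis order_refl)
  next
    case False
    obtain A B where AB: "\<And>c. u $ c \<noteq> 0 \<Longrightarrow> A c \<ge> 0 \<and> B c \<ge> 0 \<and>
        (\<forall>y. Z (w(v := y)) (u - unit_site c) = A c + B c * exp y)"
      using step.IH by metis
    have "(\<Sum>c | u $ c \<noteq> 0. Z (w(v := y)) (u - unit_site c))
        = (\<Sum>c | u $ c \<noteq> 0. A c) + (\<Sum>c | u $ c \<noteq> 0. B c) * exp y" for y
      using AB by (simp add: sum.distrib sum_distrib_right del: fun_upd_apply)
    then have "Z (w(v := y)) u = exp (w u) * (\<Sum>c | u $ c \<noteq> 0. A c) + (exp (w u) * (\<Sum>c | u $ c \<noteq> 0. B c)) * exp y" for y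
      unfolding Z_rec[OF step.hyps] using False by (simp add: distrib_left mult.assoc)
    moreover have "exp (w u) * (\<Sum>c | u $ c \<noteq> 0. A c) \<ge> 0" "exp (w u) * (\<Sum>c | u $ c \<noteq> 0. B c) \<ge> 0"
      using AB by (auto intro!: mult_nonneg_nonneg sum_nonneg)
    ultimately show ?thesis by blast
  qed
qed

text \<open>There are at most \<open>CARD('d) ^ l1 u\<close> paths and at least one, and the weights
  along each of them are dominated by the sum over the whole box.\<close>

lemma abs_ln_Z_le:
  fixes u :: "('d::finite) site"
  shows "\<bar>ln (Z w u)\<bar> \<le> real (l1 u) * ln (real CARD('d)) + (\<Sum>v\<in>below u. \<bar>w v\<bar>)"
proof (induction u rule: site_induct)
  case zero
  show ?case by (simp add: sum_nonneg)
next
  case (step u)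
  let ?S = "{c. u $ c \<noteq> 0}" and ?D = "real CARD('d)"
  let ?R = "\<Sum>v\<in>below u. \<bar>w v\<bar>"
  let ?b = "real (l1 u - 1) * ln ?D + (?R - \<bar>w u\<bar>)"
  have bel: "(\<Sum>v\<in>below (u - unit_site c). \<bar>w v\<bar>) \<le> ?R - \<bar>w u\<bar>" if "u $ c \<noteq> 0" for c
  proof -
    have "below (u - unit_site c) \<subseteq> below u - {u}"
    proof
      fix x assume x: "x \<in> below (u - unit_site c)"
      then show "x \<in> below u - {u}" using below_diff_unit_iff[OF that] by auto
    qed
    then have "(\<Sum>v\<in>below (u - unit_site c). \<bar>w v\<bar>) \<le> (\<Sum>v\<in>below u - {u}. \<bar>w v\<bar>)"
      by (intro sum_mono2) auto
    also have "\<dots> = ?R - \<bar>w u\<bar>"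
      by (subst sum_diff1) (simp_all add: below_def[of u, THEN arg_cong[where f="\<lambda>S. u \<in> S"]])
    finally show ?thesis .
  qed
  have lc: "\<bar>ln (Z w (u - unit_site c))\<bar> \<le> ?b" if c: "c \<in> ?S" for c
  proof -
    have "l1 (u - unit_site c) = l1 u - 1" using l1_diff_unit[of u c] c by simp
    then show ?thesis using step.IH[of c] bel[of c] c by simp
  qed
  have up: "Z w (u - unit_site c) \<le> exp ?b" if "c \<in> ?S" for c
    using lc[OF that] Z_pos[of w "u - unit_site c"] by (metis abs_le_D1 exp_le_cancel_iff exp_ln)
  have lo: "Z w (u - unit_site c) \<ge> exp (- ?b)" if "c \<in> ?S" for c
    using lc[OF that] Z_pos[of w "u - unit_site c"]
    by (metis abs_le_D2 exp_le_cancel_iff exp_ln minus_le_iff)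
  obtain c where c: "c \<in> ?S" using step.hyps by (auto simp: vec_eq_iff)
  have l: "real (l1 u) = real (l1 u - 1) + 1" using l1_diff_unit[of u c] c by simp
  have D: "?D \<ge> 1" by (simp add: Suc_leI)
  have "(\<Sum>c\<in>?S. Z w (u - unit_site c)) \<le> real (card ?S) * exp ?b"
    using sum_bounded_above[of ?S, OF up] by simp
  also have "\<dots> \<le> ?D * exp ?b" by (intro mult_right_mono) (auto intro: card_mono)
  finally have s1: "(\<Sum>c\<in>?S. Z w (u - unit_site c)) \<le> ?D * exp ?b" .
  have "exp (- ?b) \<le> Z w (u - unit_site c)" using lo c by blast
  also have "\<dots> \<le> (\<Sum>c\<in>?S. Z w (u - unit_site c))"
    using c by (intro member_le_sum) (auto intro: less_imp_le Z_pos)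
  finally have s2: "exp (- ?b) \<le> (\<Sum>c\<in>?S. Z w (u - unit_site c))" .
  define s where "s = (\<Sum>c\<in>?S. Z w (u - unit_site c))"
  have sp: "s > 0" using s2 less_le_trans[OF exp_gt_zero] unfolding s_def by blast
  have "ln s \<le> ln (?D * exp ?b)" using s1 sp D unfolding s_def[symmetric] by (subst ln_le_cancel_iff) auto
  then have 1: "ln s \<le> ln ?D + ?b" using D by (simp add: ln_mult)
  have "ln (exp (- ?b)) \<le> ln s" using s2 sp unfolding s_def[symmetric] by (subst ln_le_cancel_iff) auto
  then have 2: "- ?b \<le> ln s" by simp
  have "ln (Z w u) = w u + ln s"
    using step.hyps sp unfolding Z_rec[OF step.hyps] s_def[symmetric] by (simp add: ln_mult)
  moreover have "ln ?D \<ge> 0" using D by simp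
  moreover have "real (l1 u) * ln ?D = real (l1 u - 1) * ln ?D + ln ?D"
    by (subst l) (simp only: distrib_right mult_1)
  ultimately show ?case using 1 2 abs_ge_self[of "w u"] abs_ge_minus_self[of "w u"]
    unfolding abs_le_iff by linarith
qed

section \<open>Independent fields\<close>

lemma Z_neq_0 [simp]: "Z w u \<noteq> 0"
  using Z_pos[of w u] by simp

text \<open>The sum is at most a product of geometric series, one per coordinate, hence bounded
  uniformly in \<open>v\<close>. It normalises the weights of the union bound in
  \<open>tail_rotate_le\<close>.\<close>

lemma sum_power_below_le:
  fixes v :: "('d::finite) site" and z :: real
  assumes z: "0 < z" "z < 1"
  shows "(\<Sum>q\<in>below v. z ^ l1 q) \<le> (1 / (1 - z)) ^ CARD('d)"
proof -
  have "below v \<subseteq> vec_lambda ` (PiE UNIV (\<lambda>i. {..v $ i}))"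
  proof
    fix q assume "q \<in> below v"
    then have "vec_nth q \<in> PiE UNIV (\<lambda>i. {..v $ i})" by (auto simp: below_def)
    then have "vec_lambda (vec_nth q) \<in> vec_lambda ` (PiE UNIV (\<lambda>i. {..v $ i}))" by (rule imageI)
    then show "q \<in> vec_lambda ` (PiE UNIV (\<lambda>i. {..v $ i}))" by simp
  qed
  then have "(\<Sum>q\<in>below v. z ^ l1 q) \<le> (\<Sum>q\<in>vec_lambda ` (PiE UNIV (\<lambda>i. {..v $ i})). z ^ l1 q)"
    using z by (intro sum_mono2 finite_imageI finite_PiE) auto
  also have "\<dots> = (\<Sum>g\<in>PiE UNIV (\<lambda>i. {..v $ i}). \<Prod>i\<in>UNIV. z ^ g i)"
  proof (subst sum.reindex)
    show "inj_on vec_lambda (PiE UNIV (\<lambda>i. {..v $ i}))"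
      by (rule inj_onI) (metis vec_lambda_inverse UNIV_I)
  qed (simp add: l1_def power_sum)
  also have "\<dots> = (\<Prod>i\<in>UNIV. \<Sum>k\<in>{..v $ i}. z ^ k)"
    by (rule prod_sum_PiE[symmetric]) auto
  also have "\<dots> \<le> (\<Prod>i\<in>(UNIV :: 'd set). 1 / (1 - z))"
  proof (intro prod_mono conjI)
    fix i :: 'd
    show "(\<Sum>k\<in>{..v $ i}. z ^ k) \<le> 1 / (1 - z)"
      using z by (subst sum_gp0) (auto simp: divide_simps)
  qed (use z in \<open>auto intro!: sum_nonneg\<close>)
  finally show ?thesis by simp
qed

section \<open>Tails of sums of independent variables\<close>

context prob_space
begin

lemma prob_ge_eq_distr:
  fixes X :: "'a \<Rightarrow> real"
  assumes [measurable]: "X \<in> borel_measurable M"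
  shows "prob {s \<in> space M. X s \<ge> r} = measure (distr M borel X) {r..}"
proof -
  have "X -` {r..} \<inter> space M = {s \<in> space M. X s \<ge> r}" by auto
  moreover have "measure (distr M borel X) {r..} = prob (X -` {r..} \<inter> space M)"
    by (rule measure_distr[OF assms]) simp
  ultimately show ?thesis by (simp only:)
qed

lemma indep_prob_ge:
  fixes X Y :: "'a \<Rightarrow> real"
  assumes ind: "indep_var borel X borel Y"
  shows "prob {s \<in> space M. X s \<ge> a \<and> Y s \<ge> b} = prob {s \<in> space M. X s \<ge> a} * prob {s \<in> space M. Y s \<ge> (b::real)}"
proof -
  have "{s \<in> space M. X s \<ge> a \<and> Y s \<ge> b} = (\<lambda>x. (X x, Y x)) -` ({a..} \<times> {b..}) \<inter> space M"
    "{s \<in> space M. X s \<ge> a} = X -` {a..} \<inter> space M" "{s \<in> space M. Y s \<ge> b} = Y -` {b..} \<inter> space M"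
    by auto
  then show ?thesis using indep_varD[OF ind, of "{a..}" "{b..}"] by simp
qed

lemma indep_nn_integral_mult:
  assumes ind: "indep_var borel X borel Y"
    and [measurable]: "f \<in> borel_measurable borel" "g \<in> borel_measurable borel"
  shows "(\<integral>\<^sup>+s. f (X s) * g (Y s) \<partial>M) = (\<integral>\<^sup>+s. f (X s) \<partial>M) * (\<integral>\<^sup>+s. g (Y s) \<partial>M)"
proof -
  have rv [measurable]: "X \<in> borel_measurable M" "Y \<in> borel_measurable M"
    and eq: "distr M borel X \<Otimes>\<^sub>M distr M borel Y = distr M (borel \<Otimes>\<^sub>M borel) (\<lambda>x. (X x, Y x))"
    using ind unfolding indep_var_distribution_eq by auto
  interpret Y: prob_space "distr M borel Y" by (rule prob_space_distr) simp
  have "(\<integral>\<^sup>+s. f (X s) * g (Y s) \<partial>M) = (\<integral>\<^sup>+p. f (fst p) * g (snd p) \<partial>distr M (borel \<Otimes>\<^sub>M borel) (\<lambda>x. (X x, Y x)))"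
    by (subst nn_integral_distr) auto
  also have "\<dots> = (\<integral>\<^sup>+x. \<integral>\<^sup>+y. f x * g y \<partial>distr M borel Y \<partial>distr M borel X)"
    unfolding eq[symmetric] by (subst Y.nn_integral_fst[symmetric]) auto
  also have "\<dots> = (\<integral>\<^sup>+s. f (X s) \<partial>M) * (\<integral>\<^sup>+s. g (Y s) \<partial>M)"
    by (simp add: nn_integral_cmult nn_integral_multc nn_integral_distr)
  finally show ?thesis .
qed

lemma indep_sum_tail:
  fixes X Y :: "'a \<Rightarrow> real"
  assumes ind: "indep_var borel X borel Y"
  shows "ennreal (prob {s \<in> space M. X s + Y s \<ge> r})
      = (\<integral>\<^sup>+y. ennreal (prob {s \<in> space M. X s \<ge> r - y}) \<partial>distr M borel Y)"
proof -
  have rv [measurable]: "X \<in> borel_measurable M" "Y \<in> borel_measurable M"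
    and eq: "distr M borel X \<Otimes>\<^sub>M distr M borel Y = distr M (borel \<Otimes>\<^sub>M borel) (\<lambda>x. (X x, Y x))"
    using ind unfolding indep_var_distribution_eq by blast+
  interpret X: prob_space "distr M borel X" by (rule prob_space_distr[OF rv(1)])
  interpret Y: prob_space "distr M borel Y" by (rule prob_space_distr[OF rv(2)])
  have P: "pair_sigma_finite (distr M borel X) (distr M borel Y)"
    unfolding pair_sigma_finite_def
    by (intro conjI X.sigma_finite_measure_axioms Y.sigma_finite_measure_axioms)
  have S: "{p :: real \<times> real. fst p + snd p \<ge> r} \<in> sets (borel \<Otimes>\<^sub>M borel)"
    unfolding borel_prod by (intro borel_closed closed_Collect_le continuous_intros)
  have "(\<lambda>x. (X x, Y x)) -` {p. fst p + snd p \<ge> r} \<inter> space M = {s \<in> space M. X s + Y s \<ge> r}" by auto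
  then have "emeasure M {s \<in> space M. X s + Y s \<ge> r}
      = emeasure (distr M (borel \<Otimes>\<^sub>M borel) (\<lambda>x. (X x, Y x))) {p. fst p + snd p \<ge> r}"
    using emeasure_distr[OF measurable_Pair[OF rv] S] by (simp only:)
  then have "ennreal (prob {s \<in> space M. X s + Y s \<ge> r})
      = emeasure (distr M (borel \<Otimes>\<^sub>M borel) (\<lambda>x. (X x, Y x))) {p. fst p + snd p \<ge> r}"
    by (simp only: emeasure_eq_measure)
  also have "\<dots> = (\<integral>\<^sup>+y. emeasure (distr M borel X) ((\<lambda>x. (x, y)) -` {p. fst p + snd p \<ge> r}) \<partial>distr M borel Y)"
    unfolding eq[symmetric] by (rule pair_sigma_finite.emeasure_pair_measure_alt2[OF P]) (use S in simp)
  also have "\<dots> = (\<integral>\<^sup>+y. ennreal (prob {s \<in> space M. X s \<ge> r - y}) \<partial>distr M borel Y)"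
  proof (rule nn_integral_cong)
    fix y :: real
    have "(\<lambda>x. (x, y)) -` {p. fst p + snd p \<ge> r} = {r - y..}" by auto
    then show "emeasure (distr M borel X) ((\<lambda>x. (x, y)) -` {p. fst p + snd p \<ge> r})
        = ennreal (prob {s \<in> space M. X s \<ge> r - y})"
      by (simp add: prob_ge_eq_distr[OF rv(1)] X.emeasure_eq_measure)
  qed
  finally show ?thesis .
qed

text \<open>Condition on the second summand: \<open>Y\<close> and \<open>Y'\<close> have the same
  law, and the comparison of \<open>X\<close> with \<open>X'\<close> holds at every level, hence
  also at the random level \<open>r - Y\<close>.\<close>

lemma indep_sum_tail_le:
  fixes X Y :: "'a \<Rightarrow> real"
  assumes ind: "indep_var borel X borel Y" and ind': "indep_var borel X' borel Y'"
    and Y: "distr M borel Y = distr M borel Y'" and N: "N \<ge> 0"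
    and le: "\<And>r. prob {s \<in> space M. X s \<ge> r} \<le> N * prob {s \<in> space M. X' s \<ge> r - \<delta>}"
  shows "prob {s \<in> space M. X s + Y s \<ge> r} \<le> N * prob {s \<in> space M. X' s + Y' s \<ge> r - (\<delta> :: real)}"
proof -
  note conv = indep_sum_tail
  have m: "(\<lambda>y. ennreal (prob {s \<in> space M. X' s \<ge> r - \<delta> - y})) \<in> borel_measurable borel"
  proof -
    have X': "X' \<in> borel_measurable M"
      using ind' unfolding indep_var_distribution_eq by blast
    have "mono (\<lambda>y. prob {s \<in> space M. X' s \<ge> r - \<delta> - y})"
    proof (intro monoI finite_measure_mono)
      show "{s \<in> space M. X' s \<ge> r - \<delta> - y} \<in> events" for y
        using X' unfolding borel_measurable_iff_ge by blast
    qed auto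
    from borel_measurable_mono[OF this] show ?thesis by (rule measurable_compose) measurable
  qed
  have "ennreal (prob {s \<in> space M. X s + Y s \<ge> r})
      \<le> (\<integral>\<^sup>+y. ennreal N * ennreal (prob {s \<in> space M. X' s \<ge> r - \<delta> - y}) \<partial>distr M borel Y)"
    unfolding conv[OF ind]
  proof (rule nn_integral_mono)
    fix y :: real
    show "ennreal (prob {s \<in> space M. X s \<ge> r - y}) \<le> ennreal N * ennreal (prob {s \<in> space M. X' s \<ge> r - \<delta> - y})"
    proof -
      have "r - y - \<delta> = r - \<delta> - y" by simp
      then show ?thesis using le[of "r - y"] N by (simp only: ennreal_mult[symmetric] measure_nonneg ennreal_leI)
    qed
  qed
  also have "\<dots> = ennreal N * ennreal (prob {s \<in> space M. X' s + Y' s \<ge> r - \<delta>})"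
    unfolding conv[OF ind'] Y by (rule nn_integral_cmult) (simp only: measurable_distr_eq1 m)
  finally show ?thesis using N by (simp add: ennreal_mult[symmetric])
qed

end

section \<open>Functionals and tails of an i.i.d. field\<close>

locale iid_field = prob_space M for M :: "'a measure" +
  fixes \<omega> :: "('d::finite) site \<Rightarrow> 'a \<Rightarrow> real"
  assumes indep: "indep_vars (\<lambda>_. borel) \<omega> UNIV"
    and ident: "\<And>v. distr M borel (\<omega> v) = distr M borel (\<omega> 0)"
begin

abbreviation weight_law :: "real measure" where
  "weight_law \<equiv> distr M borel (\<omega> 0)"

abbreviation field_space :: "('d site \<Rightarrow> real) measure" where
  "field_space \<equiv> PiM UNIV (\<lambda>_. borel)"

lemma measurable_weight [measurable]: "\<omega> v \<in> borel_measurable M"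
  using indep by (auto simp: indep_vars_def)

lemma measurable_field [measurable]: "(\<lambda>s v. \<omega> (f v) s) \<in> measurable M field_space"
  by (rule measurable_PiM_single') auto

lemma prob_space_weight_law: "prob_space weight_law"
  by (rule prob_space_distr) simp

lemma measurable_Z [measurable]: "(\<lambda>w. Z w u) \<in> borel_measurable field_space"
  unfolding Z_def by measurable

lemma measurable_shift [measurable]: "(\<lambda>w x. w (u + x)) \<in> measurable field_space field_space"
  by (rule measurable_PiM_single') auto

text \<open>An injection only relabels i.i.d. variables. Injectivity is the right generality because
  translations of nonnegative sites are not onto.\<close>

lemma field_law:
  assumes "inj f"
  shows "distr M field_space (\<lambda>s v. \<omega> (f v) s) = PiM UNIV (\<lambda>_. weight_law)"
proof -
  have 1: "distr M field_space (\<lambda>s v. \<omega> v s) = PiM UNIV (\<lambda>_. weight_law)"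
  proof -
    have "distr M field_space (\<lambda>s v. \<omega> v s) = PiM UNIV (\<lambda>v. distr M borel (\<omega> v))"
      using indep_vars_iff_distr_eq_PiM[where I = UNIV and M' = "\<lambda>_. borel" and X = \<omega>] indep by (simp add: restrict_UNIV)
    also have "\<dots> = PiM UNIV (\<lambda>_. weight_law)" by (rule PiM_cong) (rule refl, rule ident)
    finally show ?thesis .
  qed
  have "distr M field_space (\<lambda>s v. \<omega> (f v) s)
      = distr (distr M field_space (\<lambda>s v. \<omega> v s)) field_space (\<lambda>w v. w (f v))"
    by (subst distr_distr) (auto simp: o_def intro!: measurable_PiM_single')
  also have "\<dots> = distr (PiM UNIV (\<lambda>_. weight_law)) (PiM UNIV (\<lambda>_. weight_law)) (\<lambda>w. \<lambda>v\<in>UNIV. w (f v))"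
    unfolding 1 by (rule distr_cong) (auto intro!: sets_PiM_cong)
  also have "\<dots> = PiM UNIV (\<lambda>_. weight_law)"
    by (rule distr_PiM_reindex[where M = "\<lambda>_. weight_law"])
      (use assms prob_space_weight_law in auto)
  finally show ?thesis .
qed

lemma functional_law:
  assumes [measurable]: "F \<in> borel_measurable field_space" and "inj f"
  shows "distr M borel (\<lambda>s. F (\<lambda>v. \<omega> (f v) s)) = distr M borel (\<lambda>s. F (\<lambda>v. \<omega> v s))"
proof -
  have "distr M borel (\<lambda>s. F (\<lambda>v. \<omega> (g v) s)) = distr (PiM UNIV (\<lambda>_. weight_law)) borel F"
    if "inj g" for g
    by (subst field_law[OF that, symmetric], subst distr_distr) (auto simp: o_def)
  from this[OF assms(2)] this[of id] show ?thesis by simp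
qed

lemma shifted_functional_law:
  assumes "F \<in> borel_measurable field_space"
  shows "distr M borel (\<lambda>s. F (\<lambda>v. \<omega> (u + v) s)) = distr M borel (\<lambda>s. F (\<lambda>v. \<omega> v s))"
  by (rule functional_law[OF assms]) (auto simp: inj_def)

lemma indep_functionals:
  assumes [measurable]: "F \<in> borel_measurable field_space" "G \<in> borel_measurable field_space"
    and F: "\<And>w w'. (\<And>v. v \<in> A \<Longrightarrow> w v = w' v) \<Longrightarrow> F w = F w'"
    and G: "\<And>w w'. (\<And>v. v \<in> B \<Longrightarrow> w v = w' v) \<Longrightarrow> G w = G w'"
    and disj: "A \<inter> B = {}"
  shows "indep_var borel (\<lambda>s. F (\<lambda>v. \<omega> v s)) borel (\<lambda>s. G (\<lambda>v. \<omega> v s))"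
proof -
  \<comment> \<open>Extends a field on \<open>A\<close> by \<open>0\<close>, so that
    \<open>F\<close>, which expects a full field, can be written as a function of the restriction to
    \<open>A\<close>.\<close>
  let ?e = "\<lambda>A x v. if v \<in> A then x v else (0::real)"
  have e [measurable]: "?e A \<in> measurable (PiM A (\<lambda>_. borel)) field_space" for A
  proof (rule measurable_PiM_single')
    show "(\<lambda>x. ?e A x v) \<in> borel_measurable (PiM A (\<lambda>_. borel))" for v
      by (cases "v \<in> A") simp_all
  qed auto
  have "indep_var borel ((\<lambda>x. F (?e A x)) \<circ> (\<lambda>s. restrict (\<lambda>v. \<omega> v s) A))
      borel ((\<lambda>x. G (?e B x)) \<circ> (\<lambda>s. restrict (\<lambda>v. \<omega> v s) B))"
    by (rule indep_var_compose[OF indep_var_restrict[OF indep disj]]) auto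
  moreover have "(\<lambda>x. F (?e A x)) \<circ> (\<lambda>s. restrict (\<lambda>v. \<omega> v s) A) = (\<lambda>s. F (\<lambda>v. \<omega> v s))"
    by (auto simp: fun_eq_iff intro!: F)
  moreover have "(\<lambda>x. G (?e B x)) \<circ> (\<lambda>s. restrict (\<lambda>v. \<omega> v s) B) = (\<lambda>s. G (\<lambda>v. \<omega> v s))"
    by (auto simp: fun_eq_iff intro!: G)
  ultimately show ?thesis by simp
qed

text \<open>The first variable sees the box below \<open>u\<close>, the second only sites
  \<open>u + x\<close> with \<open>x \<noteq> 0\<close>. The single common site of the closed boxes
  is \<open>u\<close>, and its weight belongs to the first leg.\<close>

lemma indep_Z_shift:
  assumes [measurable]: "f \<in> borel_measurable borel" "g \<in> borel_measurable borel"
  shows "indep_var borel (\<lambda>s. f (Z (\<lambda>v. \<omega> v s) u)) borel (\<lambda>s. g (Z (\<lambda>x. \<omega> (u + x) s) v))"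
proof (rule indep_functionals[where F = "\<lambda>w. f (Z w u)" and G = "\<lambda>w. g (Z (\<lambda>x. w (u + x)) v)"
      and A = "below u" and B = "(\<lambda>x. u + x) ` (- {0})"])
  show "f (Z w u) = f (Z w' u)" if "\<And>v. v \<in> below u \<Longrightarrow> w v = w' v" for w w'
    using Z_cong[of u w w'] that by simp
  show "g (Z (\<lambda>x. w (u + x)) v) = g (Z (\<lambda>x. w' (u + x)) v)"
    if "\<And>v. v \<in> (\<lambda>x. u + x) ` (- {0}) \<Longrightarrow> w v = w' v" for w w'
    using Z_cong[of v "\<lambda>x. w (u + x)" "\<lambda>x. w' (u + x)"] that by simp
  show "below u \<inter> (\<lambda>x. u + x) ` (- {0}) = {}"
    by (auto simp: below_def vec_eq_iff)
qed measurable

lemma nn_integral_Z_shift: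
  assumes [measurable]: "f \<in> borel_measurable borel"
  shows "(\<integral>\<^sup>+s. f (Z (\<lambda>x. \<omega> (u + x) s) v) \<partial>M) = (\<integral>\<^sup>+s. f (Z (\<lambda>x. \<omega> x s) v) \<partial>M)"
proof -
  have 1: "distr M borel (\<lambda>s. Z (\<lambda>x. \<omega> (u + x) s) v) = distr M borel (\<lambda>s. Z (\<lambda>x. \<omega> x s) v)"
    by (rule shifted_functional_law) simp
  have "(\<integral>\<^sup>+s. f (Z (\<lambda>x. \<omega> (u + x) s) v) \<partial>M) = (\<integral>\<^sup>+y. f y \<partial>distr M borel (\<lambda>s. Z (\<lambda>x. \<omega> (u + x) s) v))"
    by (subst nn_integral_distr) auto
  also have "\<dots> = (\<integral>\<^sup>+s. f (Z (\<lambda>x. \<omega> x s) v) \<partial>M)"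
    unfolding 1 by (subst nn_integral_distr) auto
  finally show ?thesis .
qed

lemma nn_integral_Z_mult:
  assumes [measurable]: "f \<in> borel_measurable borel" "g \<in> borel_measurable borel"
  shows "(\<integral>\<^sup>+s. f (Z (\<lambda>x. \<omega> x s) u) * g (Z (\<lambda>x. \<omega> (u + x) s) v) \<partial>M)
    = (\<integral>\<^sup>+s. f (Z (\<lambda>x. \<omega> x s) u) \<partial>M) * (\<integral>\<^sup>+s. g (Z (\<lambda>x. \<omega> x s) v) \<partial>M)"
  using indep_nn_integral_mult[OF indep_Z_shift[of "\<lambda>x. x" "\<lambda>x. x" u v], of f g]
  by (simp add: nn_integral_Z_shift)

definition tail :: "'d site \<Rightarrow> real \<Rightarrow> real" where
  "tail v r = prob {s \<in> space M. ln (Z (\<lambda>x. \<omega> x s) v) \<ge> r}"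

lemma tail_shift: "prob {s \<in> space M. ln (Z (\<lambda>x. \<omega> (u + x) s) v) \<ge> r} = tail v r"
proof -
  have "distr M borel (\<lambda>s. ln (Z (\<lambda>x. \<omega> (u + x) s) v)) = distr M borel (\<lambda>s. ln (Z (\<lambda>x. \<omega> x s) v))"
    by (rule shifted_functional_law[where F = "\<lambda>w. ln (Z w v)"]) simp
  then show ?thesis by (simp add: tail_def prob_ge_eq_distr)
qed

lemma tail_superadditive: "tail (u + v) (r + t) \<ge> tail u r * tail v t"
proof -
  have "tail u r * tail v t = prob {s \<in> space M. ln (Z (\<lambda>x. \<omega> x s) u) \<ge> r \<and> ln (Z (\<lambda>x. \<omega> (u + x) s) v) \<ge> t}"
    using indep_prob_ge[OF indep_Z_shift[of ln ln u v], of r t] by (simp add: tail_shift tail_def)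
  also have "\<dots> \<le> tail (u + v) (r + t)"
    unfolding tail_def
  proof (rule finite_measure_mono)
    show "{s \<in> space M. ln (Z (\<lambda>x. \<omega> x s) u) \<ge> r \<and> ln (Z (\<lambda>x. \<omega> (u + x) s) v) \<ge> t}
      \<subseteq> {s \<in> space M. ln (Z (\<lambda>x. \<omega> x s) (u + v)) \<ge> r + t}"
      using ln_Z_superadditive[of _ u v] by (auto intro: order_trans[OF add_mono])
  qed measurable
  finally show ?thesis .
qed

lemma tail_antimono: "r \<le> t \<Longrightarrow> tail v t \<le> tail v r"
  unfolding tail_def by (intro finite_measure_mono) auto

lemma tail_le_1: "tail v r \<le> 1" and tail_nonneg: "tail v r \<ge> 0"
  unfolding tail_def by auto

lemma tail_0: "r \<le> 0 \<Longrightarrow> tail 0 r = 1"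
  unfolding tail_def by (simp add: prob_space)

lemma tail_unit: "tail (unit_site c) r = prob {s \<in> space M. \<omega> 0 s \<ge> r}"
  unfolding tail_def Z_unit ln_exp prob_ge_eq_distr[OF measurable_weight] ident[of "unit_site c"] ..

text \<open>One fixed path is followed and each of its weights is required to be at least
  \<open>r\<close>. This crude bound is the source of all positivity and finiteness of logarithmic
  tails.\<close>

lemma tail_power_le: "tail v (real (l1 v) * r) \<ge> prob {s \<in> space M. \<omega> 0 s \<ge> r} ^ l1 v"
proof (induction v rule: site_induct)
  case zero
  then show ?case by (simp add: tail_0)
next
  case (step v)
  then obtain c where c: "v $ c \<noteq> 0" by (auto simp: vec_eq_iff)
  let ?u = "v - unit_site c"
  have l: "l1 v = Suc (l1 ?u)" using c by (rule l1_diff_unit)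
  have "prob {s \<in> space M. \<omega> 0 s \<ge> r} ^ l1 v
      = prob {s \<in> space M. \<omega> 0 s \<ge> r} ^ l1 ?u * prob {s \<in> space M. \<omega> 0 s \<ge> r}"
    unfolding l by simp
  also have "\<dots> \<le> tail ?u (real (l1 ?u) * r) * tail (unit_site c) r"
    unfolding tail_unit using step.IH[OF c] by (intro mult_right_mono) auto
  also have "\<dots> \<le> tail (?u + unit_site c) (real (l1 ?u) * r + r)"
    by (rule tail_superadditive)
  also have "\<dots> = tail v (real (l1 v) * r)"
    unfolding diff_unit_add[OF c] l by (simp add: algebra_simps)
  finally show ?case .
qed

end

section \<open>Turning steps into another direction\<close>

definition rotate_site :: "'d \<Rightarrow> 'd \<Rightarrow> ('d::finite) site \<Rightarrow> 'd site" where
  "rotate_site i j v = (\<chi> c. if c = i then 0 else if c = j then v $ j + v $ i else v $ c)"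

lemma rotate_site_add: "rotate_site i j (u + v) = rotate_site i j u + rotate_site i j v"
  by (simp add: rotate_site_def vec_eq_iff)

lemma rotate_site_unit: "i \<noteq> j \<Longrightarrow> rotate_site i j (unit_site i) = unit_site j"
  by (simp add: rotate_site_def vec_eq_iff)

lemma rotate_site_id: "v $ i = 0 \<Longrightarrow> rotate_site i j v = v"
  by (auto simp: rotate_site_def vec_eq_iff)

context iid_field
begin

text \<open>Turning every step in direction \<open>i\<close> into a step in direction \<open>j\<close>. Once the starting points of
  the \<open>i\<close>-steps are fixed, the remaining sum over paths is a product of independent pieces, which
  can be realised along the rotated paths; the factor accounts for the number of ways to choose
  the starting points.\<close>

lemma tail_rotate_le:
  fixes z :: real
  assumes z: "0 < z" "z < 1" and ij: "i \<noteq> j"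
  defines "K \<equiv> (1 / (1 - z)) ^ CARD('d)"
  defines "N \<equiv> \<lambda>v. K ^ (v $ i) * (1 / z) ^ l1 v"
  shows "tail v r \<le> N v * tail (rotate_site i j v) (r - ln (N v))"
proof (induction "v $ i" arbitrary: v r)
  case 0
  have K1: "N v \<ge> 1" using 0[symmetric] z by (simp add: N_def)
  have "tail v r \<le> tail v (r - ln (N v))" using K1 by (intro tail_antimono) simp
  also have "\<dots> \<le> N v * tail v (r - ln (N v))"
    using K1 tail_nonneg[of v "r - ln (N v)"] mult_right_mono[of 1 "N v" "tail v (r - ln (N v))"] by simp
  finally show ?case using 0 by (simp add: rotate_site_id)
next
  case (Suc m)
  have K: "K \<ge> 1" unfolding K_def using z by (intro one_le_power) (simp add: field_simps)
  have Npos: "N p > 0" for p using K z by (simp add: N_def)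
  define S where "S = {p. p + unit_site i \<in> below v \<and> Suc (p $ i) = v $ i}"
  \<comment> \<open>Weights for the union bound over \<open>p\<close>, decaying geometrically with
    the distance from \<open>v\<close>. Their sum is at most \<open>1\<close> uniformly in
    \<open>v\<close>, whereas the number of candidates \<open>p\<close> is not bounded.\<close>
  define c where "c p = z ^ l1 (v - p) / K" for p
  define Y where "Y p w = exp (w (p + unit_site i)) * Z (\<lambda>x. w (p + unit_site i + x)) (v - (p + unit_site i))" for p w
  have pv: "p \<in> below v" if "p \<in> S" for p
    using that by (auto simp: S_def below_add_iff add.assoc)
  have fin: "finite S" by (rule finite_subset[OF _ finite_below[of v]]) (use pv in blast)
  have cpos: "c p > 0" for p using z K by (simp add: c_def)
  have csum: "(\<Sum>p\<in>S. c p) \<le> 1"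
  proof -
    have "(\<Sum>p\<in>S. z ^ l1 (v - p)) = (\<Sum>q\<in>(\<lambda>p. v - p) ` S. z ^ l1 q)"
    proof (subst sum.reindex)
      show "inj_on (\<lambda>p. v - p) S"
      proof (rule inj_onI)
        fix p q assume "p \<in> S" "q \<in> S" "v - p = v - q"
        then show "p = q" using add_diff_below[OF pv] by (metis add_right_cancel)
      qed
    qed simp
    also have "\<dots> \<le> (\<Sum>q\<in>below v. z ^ l1 q)"
    proof (rule sum_mono2)
      show "(\<lambda>p. v - p) ` S \<subseteq> below v" by (auto simp: below_def)
    qed (use z in auto)
    also have "\<dots> \<le> K" unfolding K_def by (rule sum_power_below_le[OF z])
    finally show ?thesis using K by (simp add: c_def sum_divide_distrib[symmetric])
  qed
  \<comment> \<open>This identity explains the form of \<open>N\<close>. The level losses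
    \<open>ln (N p)\<close> from the induction and \<open>- ln (c p)\<close> from the union bound
    add up to \<open>ln (N v)\<close>, and the prefactors \<open>N p\<close> sum to at most
    \<open>N v\<close>.\<close>
  have Nc: "N p = c p * N v" if "p \<in> S" for p
  proof -
    have "l1 v = l1 p + l1 (v - p)" using add_diff_below[OF pv[OF that]] by (metis l1_add)
    moreover have "v $ i = Suc (p $ i)" using that by (simp add: S_def)
    ultimately show ?thesis using z K by (simp add: N_def c_def power_add power_divide)
  qed
  have Ypos: "Y p w > 0" for p w by (simp add: Y_def Z_pos)
  have mY [measurable]: "(\<lambda>w. ln (Y p w)) \<in> borel_measurable field_space" for p
    unfolding Y_def by measurable
  have step: "prob {s \<in> space M. ln (Z (\<lambda>x. \<omega> x s) p) + ln (Y p (\<lambda>x. \<omega> x s)) \<ge> r + ln (c p)}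
      \<le> N p * tail (rotate_site i j v) (r - ln (N v))" if p: "p \<in> S" for p
  proof -
    define q where "q = p + unit_site i"
    define q' where "q' = rotate_site i j p + unit_site j"
    define u where "u = v - q"
    define G where "G w = ln (exp (w 0) * Z w u)" for w :: "'d site \<Rightarrow> real"
    have mG [measurable]: "G \<in> borel_measurable field_space" unfolding G_def by measurable
    have qv: "q \<in> below v" using p by (simp add: S_def q_def)
    have v: "v = q + u" unfolding u_def using add_diff_below[OF qv] by simp
    \<comment> \<open>After the last \<open>i\<close>-step there is none left, so the rotation acts
      only on \<open>p\<close> and on that step, and leaves the final leg \<open>u\<close> as it
      is.\<close>
    have ui: "u $ i = 0" using p by (simp add: u_def q_def S_def)
    have rv: "rotate_site i j v = rotate_site i j p + unit_site j + u"
      unfolding v q_def by (simp add: rotate_site_add rotate_site_unit[OF ij] rotate_site_id[OF ui])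
    have YG: "ln (Y p w) = G (\<lambda>x. w (q + x))" for w
      by (simp add: Y_def G_def q_def u_def)
    have ind: "indep_var borel (\<lambda>s. ln (Z (\<lambda>x. \<omega> x s) a)) borel (\<lambda>s. G (\<lambda>x. \<omega> (a + unit_site b + x) s))" for a b
    proof (rule indep_functionals[where F = "\<lambda>w. ln (Z w a)" and G = "\<lambda>w. G (\<lambda>x. w (a + unit_site b + x))"
          and A = "below a" and B = "range (\<lambda>x. a + unit_site b + x)"])
      show "ln (Z w a) = ln (Z w' a)" if "\<And>v. v \<in> below a \<Longrightarrow> w v = w' v" for w w'
        using Z_cong[of a w w'] that by simp
      show "below a \<inter> range (\<lambda>x. a + unit_site b + x) = {}"
      proof -
        have "\<not> a $ b + 1 + x $ b \<le> a $ b" for x :: "'d site" by simp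
        then show ?thesis by (auto simp: below_def dest!: spec[of _ b])
      qed
      show "G (\<lambda>x. w (a + unit_site b + x)) = G (\<lambda>x. w' (a + unit_site b + x))"
        if "\<And>v. v \<in> range (\<lambda>x. a + unit_site b + x) \<Longrightarrow> w v = w' v" for w w'
        using that by simp
      show "(\<lambda>w. ln (Z w a)) \<in> borel_measurable field_space" by measurable
      show "(\<lambda>w. G (\<lambda>x. w (a + unit_site b + x))) \<in> borel_measurable field_space"
        by (rule measurable_compose[OF measurable_shift mG])
    qed
    \<comment> \<open>The piece \<open>G\<close> is moved from \<open>p + unit_site i\<close> to the
      end of the rotated \<open>p\<close>. It keeps its law and its independence of the first leg,
      which the induction hypothesis compares because \<open>p\<close> has one
      \<open>i\<close>-coordinate less than \<open>v\<close>.\<close>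
    have "prob {s \<in> space M. ln (Z (\<lambda>x. \<omega> x s) p) + G (\<lambda>x. \<omega> (p + unit_site i + x) s) \<ge> r + ln (c p)}
      \<le> N p * prob {s \<in> space M. ln (Z (\<lambda>x. \<omega> x s) (rotate_site i j p))
          + G (\<lambda>x. \<omega> (rotate_site i j p + unit_site j + x) s) \<ge> r + ln (c p) - ln (N p)}"
    proof (rule indep_sum_tail_le[OF ind ind])
      show "distr M borel (\<lambda>s. G (\<lambda>x. \<omega> (p + unit_site i + x) s))
          = distr M borel (\<lambda>s. G (\<lambda>x. \<omega> (rotate_site i j p + unit_site j + x) s))"
        unfolding shifted_functional_law[OF mG, of "p + unit_site i"]
          shifted_functional_law[OF mG, of "rotate_site i j p + unit_site j"] ..
      have "m = p $ i" using p Suc.hyps(2) by (simp add: S_def)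
      from Suc.hyps(1)[OF this] show "prob {s \<in> space M. ln (Z (\<lambda>x. \<omega> x s) p) \<ge> r}
          \<le> N p * prob {s \<in> space M. ln (Z (\<lambda>x. \<omega> x s) (rotate_site i j p)) \<ge> r - ln (N p)}" for r
        unfolding tail_def .
    qed (use Npos[of p] in simp)
    also have "r + ln (c p) - ln (N p) = r - ln (N v)"
      using cpos[of p] Npos[of v] unfolding Nc[OF p] by (simp add: ln_mult)
    also have "prob {s \<in> space M. ln (Z (\<lambda>x. \<omega> x s) (rotate_site i j p))
          + G (\<lambda>x. \<omega> (rotate_site i j p + unit_site j + x) s) \<ge> r - ln (N v)}
        \<le> tail (rotate_site i j v) (r - ln (N v))"
      unfolding tail_def
    proof (rule finite_measure_mono, safe)
      fix s assume s: "s \<in> space M" and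
        le: "r - ln (N v) \<le> ln (Z (\<lambda>x. \<omega> x s) (rotate_site i j p)) + G (\<lambda>x. \<omega> (rotate_site i j p + unit_site j + x) s)"
      let ?w = "\<lambda>x. \<omega> x s" and ?a = "rotate_site i j p"
      have "G (\<lambda>x. ?w (?a + unit_site j + x)) = ?w (?a + unit_site j) + ln (Z (\<lambda>x. ?w (?a + unit_site j + x)) u)"
        unfolding G_def by (simp add: ln_mult Z_pos)
      also have "\<dots> = ln (Z (\<lambda>x. ?w (?a + x)) (unit_site j)) + ln (Z (\<lambda>x. ?w (?a + (unit_site j + x))) u)"
        by (simp add: add.assoc)
      also have "\<dots> \<le> ln (Z (\<lambda>x. ?w (?a + x)) (unit_site j + u))"
        by (rule ln_Z_superadditive)
      finally show "r - ln (N v) \<le> ln (Z ?w (rotate_site i j v))"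
        using le ln_Z_superadditive[of ?w ?a "unit_site j + u"] unfolding rv by (simp add: add.assoc)
    qed measurable
    finally show ?thesis using Npos[of p] unfolding YG q_def by simp
  qed
  have ev: "{s \<in> space M. ln (Z (\<lambda>x. \<omega> x s) p) + ln (Y p (\<lambda>x. \<omega> x s)) \<ge> r + ln (c p)} \<in> events" for p
  proof -
    have "(\<lambda>s. ln (Z (\<lambda>x. \<omega> x s) p) + ln (Y p (\<lambda>x. \<omega> x s))) \<in> borel_measurable M"
      by (intro borel_measurable_add measurable_compose[OF measurable_field[of "\<lambda>x. x"] mY]) measurable
    then show ?thesis unfolding borel_measurable_iff_ge by blast
  qed
  \<comment> \<open>If each term of the decomposition stayed below \<open>exp r * c p\<close>, then
    \<open>Z\<close> would stay below \<open>exp r\<close>, the weights \<open>c p\<close> adding up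
    to at most \<open>1\<close>.\<close>
  have "tail v r \<le> prob (\<Union>p\<in>S. {s \<in> space M. ln (Z (\<lambda>x. \<omega> x s) p) + ln (Y p (\<lambda>x. \<omega> x s)) \<ge> r + ln (c p)})"
    unfolding tail_def
  proof (rule finite_measure_mono)
    show "{s \<in> space M. r \<le> ln (Z (\<lambda>x. \<omega> x s) v)}
      \<subseteq> (\<Union>p\<in>S. {s \<in> space M. ln (Z (\<lambda>x. \<omega> x s) p) + ln (Y p (\<lambda>x. \<omega> x s)) \<ge> r + ln (c p)})"
    proof
      fix s assume s: "s \<in> {s \<in> space M. r \<le> ln (Z (\<lambda>x. \<omega> x s) v)}"
      let ?w = "\<lambda>x. \<omega> x s"
      show "s \<in> (\<Union>p\<in>S. {s \<in> space M. ln (Z (\<lambda>x. \<omega> x s) p) + ln (Y p (\<lambda>x. \<omega> x s)) \<ge> r + ln (c p)})"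
      proof (rule ccontr)
        assume "\<not> ?thesis"
        then have lt: "ln (Z ?w p) + ln (Y p ?w) < r + ln (c p)" if "p \<in> S" for p
          unfolding not_le[symmetric] using that s by blast
        have "Z ?w p * Y p ?w < exp r * c p" if p: "p \<in> S" for p
        proof -
          have "ln (Z ?w p * Y p ?w) < r + ln (c p)" using lt[OF p] Ypos[of p ?w] by (simp add: ln_mult)
          then have "exp (ln (Z ?w p * Y p ?w)) < exp (r + ln (c p))" by simp
          then show ?thesis using cpos[of p] by (simp add: exp_add Z_pos Ypos)
        qed
        moreover have "S \<noteq> {}"
        proof -
          have "v $ i \<noteq> 0" using Suc.hyps(2) by simp
          then have "v - unit_site i \<in> S"
            by (simp add: S_def diff_unit_add) (simp add: below_def)
          then show ?thesis by blast
        qed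
        ultimately have "(\<Sum>p\<in>S. Z ?w p * Y p ?w) < (\<Sum>p\<in>S. exp r * c p)"
          using fin by (intro sum_strict_mono) auto
        also have "\<dots> \<le> exp r" using csum by (simp add: sum_distrib_left[symmetric] mult_left_le)
        finally have "Z ?w v < exp r"
          using Z_last_step_decomposition[of v i ?w] Suc.hyps(2) unfolding S_def Y_def by fastforce
        then have "ln (Z ?w v) < r" using Z_pos[of ?w v] by (metis exp_less_cancel_iff exp_ln)
        then show False using s by simp
      qed
    qed
    show "(\<Union>p\<in>S. {s \<in> space M. ln (Z (\<lambda>x. \<omega> x s) p) + ln (Y p (\<lambda>x. \<omega> x s)) \<ge> r + ln (c p)}) \<in> events"
      by (intro sets.finite_UN fin ev)
  qed
  also have "\<dots> \<le> (\<Sum>p\<in>S. prob {s \<in> space M. ln (Z (\<lambda>x. \<omega> x s) p) + ln (Y p (\<lambda>x. \<omega> x s)) \<ge> r + ln (c p)})"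
    by (rule finite_measure_subadditive_finite[OF fin]) (use ev in blast)
  also have "\<dots> \<le> (\<Sum>p\<in>S. N p * tail (rotate_site i j v) (r - ln (N v)))"
    by (rule sum_mono) (rule step)
  also have "\<dots> = (\<Sum>p\<in>S. c p) * (N v * tail (rotate_site i j v) (r - ln (N v)))"
    unfolding sum_distrib_right by (intro sum.cong) (simp_all add: Nc)
  also have "\<dots> \<le> 1 * (N v * tail (rotate_site i j v) (r - ln (N v)))"
    using csum Npos[of v] tail_nonneg by (intro mult_right_mono) simp_all
  finally show ?case by simp
qed

end

section \<open>The rate function\<close>

text \<open>Rounding produces the constant defect \<open>C\<close>, and junk values for small
  \<open>n\<close> the threshold \<open>N\<close>. Subtracting \<open>C\<close> once makes the
  sequence exactly superadditive, and the linear bound keeps the supremum finite.\<close>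

lemma fekete_superadditive:
  fixes b :: "nat \<Rightarrow> real"
  assumes super: "\<And>m n. m \<ge> N \<Longrightarrow> n \<ge> N \<Longrightarrow> b (m + n) \<ge> b m + b n - C"
    and bound: "\<And>n. b n \<le> K * real n"
  shows "convergent (\<lambda>n. b n / real n)"
proof -
  define N' where "N' = Suc N"
  define c where "c n = b n - C" for n
  define L where "L = (SUP n\<in>{N'..}. c n / real n)"
  have cs: "c (m + n) \<ge> c m + c n" if "m \<ge> N" "n \<ge> N" for m n
    using super[OF that] by (simp add: c_def)
  have bdd: "bdd_above ((\<lambda>n. c n / real n) ` {N'..})"
  proof (rule bdd_aboveI2)
    fix n assume "n \<in> {N'..}"
    then have n: "real n \<ge> 1" by (simp add: N'_def)
    have "c n \<le> K * real n + \<bar>C\<bar> * real n"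
      using bound[of n] n mult_left_mono[of 1 "real n" "\<bar>C\<bar>"] by (simp add: c_def)
    then show "c n / real n \<le> K + \<bar>C\<bar>" using n by (simp add: divide_simps algebra_simps)
  qed
  have up: "c n / real n \<le> L" if "n \<ge> N'" for n
    unfolding L_def using bdd that by (intro cSUP_upper) auto
  have iter: "c (q * m + r) \<ge> real q * c m + c r" if "m \<ge> N'" "r \<ge> m" for q m r
  proof (induction q)
    case (Suc q)
    have "c (Suc q * m + r) = c (m + (q * m + r))" by (simp add: algebra_simps)
    also have "\<dots> \<ge> c m + c (q * m + r)" using that by (intro cs) (auto simp: N'_def)
    finally show ?case using Suc by (simp add: algebra_simps)
  qed simp
  have "(\<lambda>n. c n / real n) \<longlonglongrightarrow> L"
  proof (rule order_tendstoI)
    fix a assume "a > L"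
    then show "\<forall>\<^sub>F n in sequentially. c n / real n < a"
      using up by (intro eventually_sequentiallyI[of N']) (meson le_less_trans)
  next
    fix a assume a: "a < L"
    then obtain m where m: "m \<ge> N'" "c m / real m > a"
      unfolding L_def using less_cSUP_iff[OF _ bdd, of a] by auto
    have m0: "real m > 0" using m by (simp add: N'_def)
    define D where "D = Min (c ` {m..<2 * m})"
    define E where "E = 2 * \<bar>c m\<bar> + \<bar>D\<bar>"
    have low: "c n / real n \<ge> c m / real m - E / real n" if n: "n \<ge> m" for n
    proof -
      \<comment> \<open>The remainder is taken between \<open>m\<close> and \<open>2 * m\<close>
        rather than below \<open>m\<close>, so that it stays above the threshold where
        superadditivity holds.\<close>
      define q r where "q = n div m - 1" and "r = m + n mod m"
      have "n div m \<ge> 1" using n m0 by (simp add: div_greater_zero_iff Suc_leI)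
      then have nqr: "n = q * m + r"
        unfolding q_def r_def by (metis add.assoc add.commute le_add_diff_inverse2 div_mult_mod_eq
            distrib_right mult_1)
      have r: "r \<ge> m" "r < 2 * m" using m0 by (auto simp: r_def)
      then have "D \<le> c r" unfolding D_def by (intro Min_le) auto
      then have "c n \<ge> real q * c m - \<bar>D\<bar>" using iter[OF m(1) r(1), of q] nqr by simp
      moreover have "real q * c m = real n * (c m / real m) - real r * (c m / real m)"
        using m0 unfolding nqr by (simp add: field_simps)
      moreover have "real r * (c m / real m) \<le> 2 * \<bar>c m\<bar>"
      proof -
        have "real r * (c m / real m) \<le> real r * (\<bar>c m\<bar> / real m)"
          by (intro mult_left_mono divide_right_mono) auto
        also have "\<dots> \<le> (2 * real m) * (\<bar>c m\<bar> / real m)"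
          using r by (intro mult_right_mono) auto
        also have "\<dots> = 2 * \<bar>c m\<bar>" using m0 by simp
        finally show ?thesis .
      qed
      ultimately have "c n \<ge> real n * (c m / real m) - E" by (simp add: E_def)
      moreover have n0: "real n > 0" using n m0 by simp
      ultimately have "(real n * (c m / real m) - E) / real n \<le> c n / real n"
        by (intro divide_right_mono) auto
      moreover have "(real n * (c m / real m) - E) / real n = c m / real m - E / real n"
        using n0 by (simp add: diff_divide_distrib)
      ultimately show ?thesis by simp
    qed
    have "(\<lambda>n. c m / real m - E / real n) \<longlonglongrightarrow> c m / real m - 0"
      by (intro tendsto_diff tendsto_const lim_const_over_n)
    then have "\<forall>\<^sub>F n in sequentially. c m / real m - E / real n > a"
      using m by (intro order_tendstoD(1)[where y = "c m / real m - 0"]) auto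
    then show "\<forall>\<^sub>F n in sequentially. c n / real n > a"
      using eventually_ge_at_top[of m]
      by eventually_elim (use low in \<open>meson less_le_trans\<close>)
  qed
  moreover have "(\<lambda>n. C / real n) \<longlonglongrightarrow> 0" by (rule lim_const_over_n)
  ultimately have "(\<lambda>n. c n / real n + C / real n) \<longlonglongrightarrow> L + 0" by (rule tendsto_add)
  then have "(\<lambda>n. b n / real n) \<longlonglongrightarrow> L"
    by (simp add: c_def add_divide_distrib[symmetric])
  then show ?thesis by (rule convergentI)
qed

section \<open>The orthant, its \<open>l1\<close> norm and rounding to sites\<close>

definition mass :: "real ^ ('d::finite) \<Rightarrow> real" where
  "mass u = (\<Sum>i\<in>UNIV. u $ i)"

lemma mass_nonneg: "u \<in> orthant \<Longrightarrow> mass u \<ge> 0"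
  by (auto simp: mass_def orthant_def intro: sum_nonneg)

lemma component_le_mass: "u \<in> orthant \<Longrightarrow> u $ i \<le> mass u"
  unfolding mass_def by (rule member_le_sum) (auto simp: orthant_def)

lemma orthant_pos_component: "u \<in> orthant - {0} \<Longrightarrow> \<exists>i. u $ i > 0"
  by (auto simp: orthant_def vec_eq_iff order_less_le)

lemma mass_pos: "u \<in> orthant - {0} \<Longrightarrow> mass u > 0"
  using orthant_pos_component[of u] component_le_mass[of u] by (metis DiffD1 less_le_trans)

lemma orthant_nonzero_iff: "u \<in> orthant \<Longrightarrow> u \<in> orthant - {0} \<longleftrightarrow> mass u > 0"
  using mass_pos[of u] by (auto simp: mass_def)

lemma orthant_add: "u \<in> orthant \<Longrightarrow> v \<in> orthant \<Longrightarrow> u + v \<in> orthant"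
  and orthant_scaleR: "u \<in> orthant \<Longrightarrow> a \<ge> 0 \<Longrightarrow> a *\<^sub>R u \<in> orthant"
  by (auto simp: orthant_def)

lemma mass_add: "mass (u + v) = mass u + mass v"
  and mass_diff: "mass (u - v) = mass u - mass v"
  and mass_scaleR: "mass (a *\<^sub>R u) = a * mass u"
  by (auto simp: mass_def sum.distrib sum_subtractf sum_distrib_left)

lemma tendsto_mass: "(f \<longlongrightarrow> u) F \<Longrightarrow> ((\<lambda>x. mass (f x)) \<longlongrightarrow> mass u) F"
  unfolding mass_def by (intro tendsto_intros)

lemma orthant_cone:
  assumes "u \<in> orthant - {0}" "v \<in> orthant - {0}" "a > 0" "b > 0"
  shows "a *\<^sub>R u + b *\<^sub>R v \<in> orthant - {0}"
proof (subst orthant_nonzero_iff)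
  show "a *\<^sub>R u + b *\<^sub>R v \<in> orthant" using assms by (intro orthant_add orthant_scaleR) auto
  show "mass (a *\<^sub>R u + b *\<^sub>R v) > 0"
    using mass_pos[of u] mass_pos[of v] assms by (simp add: mass_add mass_scaleR add_pos_pos)
qed

lemma floor_site_nth: "floor_site y $ i = nat \<lfloor>y $ i\<rfloor>"
  by (simp add: floor_site_def)

lemma floor_site_le: "u \<in> orthant \<Longrightarrow> real (floor_site u $ i) \<le> u $ i"
  and floor_site_gt: "u \<in> orthant \<Longrightarrow> u $ i < real (floor_site u $ i) + 1"
  by (auto simp: floor_site_nth orthant_def of_nat_nat)

lemma le_floor_site: "real k \<le> u $ i \<Longrightarrow> k \<le> floor_site u $ i"
  by (simp add: floor_site_nth le_nat_floor)

lemma l1_floor_site_le: "u \<in> orthant \<Longrightarrow> real (l1 (floor_site u)) \<le> mass u"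
  unfolding l1_def mass_def by (auto intro: sum_mono floor_site_le)

lemma l1_floor_site_ge:
  fixes u :: "real ^ ('d::finite)"
  assumes "u \<in> orthant"
  shows "real (l1 (floor_site u)) \<ge> mass u - real CARD('d)"
proof -
  have "mass u \<le> (\<Sum>i\<in>UNIV. real (floor_site u $ i) + 1)"
    unfolding mass_def using floor_site_gt[OF assms] by (intro sum_mono less_imp_le)
  then show ?thesis by (simp add: l1_def sum.distrib)
qed

lemma floor_site_below_add:
  assumes "x \<in> orthant" "y \<in> orthant"
  shows "floor_site x + floor_site y \<in> below (floor_site (x + y))"
  unfolding below_def
proof (safe)
  fix i
  have "real (floor_site x $ i + floor_site y $ i) \<le> (x + y) $ i"
    using floor_site_le[OF assms(1), of i] floor_site_le[OF assms(2), of i] by simp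
  from le_floor_site[OF this] show "(floor_site x + floor_site y) $ i \<le> floor_site (x + y) $ i"
    by simp
qed

lemma floor_site_add:
  assumes "x \<in> orthant" "y \<in> orthant"
  shows "\<exists>w. floor_site (x + y) = floor_site x + floor_site y + w \<and> (\<forall>i. w $ i \<le> 1)"
proof -
  let ?v = "floor_site x + floor_site y"
  define w where "w = floor_site (x + y) - ?v"
  have w: "floor_site (x + y) = ?v + w"
    unfolding w_def using add_diff_below[OF floor_site_below_add[OF assms]] by simp
  have "w $ i \<le> 1" for i
  proof -
    have "real (?v $ i) + real (w $ i) \<le> (x + y) $ i"
      using floor_site_le[OF orthant_add[OF assms], of i] unfolding w by simp
    moreover have "(x + y) $ i < real (?v $ i) + 2"
      using floor_site_gt[OF assms(1), of i] floor_site_gt[OF assms(2), of i] by simp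
    ultimately have "real (w $ i) < 2" by linarith
    then show ?thesis by simp
  qed
  then show ?thesis using w by blast
qed

lemma eventually_floor_site_nonzero:
  assumes "u \<in> orthant - {0}"
  shows "\<exists>N. \<forall>n\<ge>N. floor_site (real n *\<^sub>R u) \<noteq> 0"
proof -
  obtain i where i: "u $ i > 0" using orthant_pos_component[OF assms] by blast
  obtain N where N: "real N \<ge> 1 / u $ i" using real_arch_simple by blast
  have "floor_site (real n *\<^sub>R u) \<noteq> 0" if "n \<ge> N" for n
  proof -
    have "real n * u $ i \<ge> 1" using N that i
      by (smt (verit) divide_le_eq of_nat_mono mult.commute)
    then have "1 \<le> floor_site (real n *\<^sub>R u) $ i" by (intro le_floor_site) simp
    then show ?thesis by auto
  qed
  then show ?thesis by blast
qed

lemma scaled_orthant: "u \<in> orthant - {0} \<Longrightarrow> real n *\<^sub>R u \<in> orthant"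
  by (auto intro: orthant_scaleR)

section \<open>Logarithmic tails and their limits along rays\<close>

locale unbounded_field = iid_field +
  assumes unbounded: "\<And>r. prob {s \<in> space M. \<omega> 0 s > r} > 0"
begin

text \<open>The price per step of forcing weights to be at least \<open>r\<close>; unboundedness of
  the weights keeps it finite for every \<open>r\<close>.\<close>

definition cost :: "real \<Rightarrow> real" where
  "cost r = - ln (prob {s \<in> space M. \<omega> 0 s \<ge> r})"

lemma prob_weight_ge_pos: "prob {s \<in> space M. \<omega> 0 s \<ge> r} > 0"
proof -
  have "prob {s \<in> space M. \<omega> 0 s > r} \<le> prob {s \<in> space M. \<omega> 0 s \<ge> r}"
    by (intro finite_measure_mono) auto
  then show ?thesis using unbounded[of r] by linarith
qed

lemma cost_nonneg: "cost r \<ge> 0"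
  using prob_weight_ge_pos[of r] prob_le_1 by (simp add: cost_def ln_le_zero_iff)

lemma cost_mono: "r \<le> t \<Longrightarrow> cost r \<le> cost t"
proof -
  assume rt: "r \<le> t"
  have "prob {s \<in> space M. \<omega> 0 s \<ge> t} \<le> prob {s \<in> space M. \<omega> 0 s \<ge> r}"
    using rt by (intro finite_measure_mono) auto
  then show ?thesis using prob_weight_ge_pos[of t] prob_weight_ge_pos[of r] by (simp add: cost_def)
qed

text \<open>Outside the feasible pairs the tail probability is \<open>0\<close> and its logarithm has a junk value.\<close>

abbreviation feasible :: "'b site \<Rightarrow> real \<Rightarrow> bool" where
  "feasible v r \<equiv> v \<noteq> 0 \<or> r \<le> 0"

definition ltail :: "'b site \<Rightarrow> real \<Rightarrow> real" where
  "ltail v r = ln (tail v r)"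

lemma tail_pos: "feasible v r \<Longrightarrow> tail v r > 0"
proof (cases "v = 0")
  case False
  then have "real (l1 v) > 0" by (simp add: neq0_conv[symmetric] del: neq0_conv)
  then have "real (l1 v) * (r / real (l1 v)) = r" using False by simp
  then have "tail v r = tail v (real (l1 v) * (r / real (l1 v)))" by (simp only:)
  also have "\<dots> \<ge> prob {s \<in> space M. \<omega> 0 s \<ge> r / real (l1 v)} ^ l1 v"
    by (rule tail_power_le)
  finally show ?thesis using prob_weight_ge_pos by (meson less_le_trans zero_less_power)
qed (simp add: tail_0)

lemma ltail_superadditive:
  assumes "feasible u r" "feasible v t"
  shows "ltail (u + v) (r + t) \<ge> ltail u r + ltail v t"
proof -
  have p: "tail u r > 0" "tail v t > 0" using assms tail_pos by blast+
  then have "ltail u r + ltail v t = ln (tail u r * tail v t)"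
    by (simp add: ltail_def ln_mult)
  also have "\<dots> \<le> ltail (u + v) (r + t)"
    unfolding ltail_def using p tail_superadditive[of u r v t]
    by (subst ln_le_cancel_iff) (auto intro: less_le_trans[OF mult_pos_pos])
  finally show ?thesis .
qed

lemma ltail_antimono: "feasible v t \<Longrightarrow> r \<le> t \<Longrightarrow> ltail v t \<le> ltail v r"
  unfolding ltail_def using tail_pos[of v t] tail_antimono[of r t v] by simp

lemma ltail_nonpos: "feasible v r \<Longrightarrow> ltail v r \<le> 0"
  unfolding ltail_def using tail_pos[of v r] tail_le_1[of v r] by simp

lemma ltail_ge_cost:
  assumes "v \<noteq> 0"
  shows "ltail v r \<ge> - real (l1 v) * cost (r / real (l1 v))"
proof -
  have l: "real (l1 v) > 0" using assms by (simp add: neq0_conv[symmetric] del: neq0_conv)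
  have "- real (l1 v) * cost (r / real (l1 v)) = ln (prob {s \<in> space M. \<omega> 0 s \<ge> r / real (l1 v)} ^ l1 v)"
    by (simp add: cost_def ln_realpow)
  also have "\<dots> \<le> ln (tail v (real (l1 v) * (r / real (l1 v))))"
    using tail_power_le[of "r / real (l1 v)" v] prob_weight_ge_pos[of "r / real (l1 v)"]
    by (subst ln_le_cancel_iff) (auto intro: less_le_trans[OF zero_less_power])
  also have "real (l1 v) * (r / real (l1 v)) = r" using assms by simp
  also have "ln (tail v r) = ltail v r" by (simp only: ltail_def)
  finally show ?thesis .
qed

text \<open>Used for the sites left over by rounding: boundedly many steps and a level bounded above
  cost only a constant. As a nonzero site has at least one step, no single weight has to exceed
  \<open>R\<close>.\<close>

lemma ltail_ge_const:
  assumes "feasible v r" "r \<le> R" "R \<ge> 0" "real (l1 v) \<le> L"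
  shows "ltail v r \<ge> - L * cost R"
proof (cases "v = 0")
  case True
  then have "ltail v r = 0" using assms by (simp add: ltail_def tail_0)
  then show ?thesis using assms cost_nonneg[of R] by simp
next
  case False
  then have l: "real (l1 v) \<ge> 1" by (simp add: Suc_le_eq neq0_conv[symmetric] del: neq0_conv)
  have "r / real (l1 v) \<le> R"
    using l assms mult_left_mono[of 1 "real (l1 v)" R] by (simp add: divide_simps mult.commute)
  then have "real (l1 v) * cost (r / real (l1 v)) \<le> L * cost R"
    using assms l cost_nonneg by (intro mult_mono cost_mono) auto
  then show ?thesis using ltail_ge_cost[OF False, of r] by simp
qed

definition ray :: "real ^ 'b \<Rightarrow> real \<Rightarrow> nat \<Rightarrow> real" where
  "ray u r n = ltail (floor_site (real n *\<^sub>R u)) (real n * r)"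

text \<open>The negative of the rate function; \<open>rate_J_eq\<close> makes the
  identification.\<close>

definition phi :: "real ^ 'b \<Rightarrow> real \<Rightarrow> real" where
  "phi u r = lim (\<lambda>n. ray u r n / real n)"

lemma ray_convergent:
  assumes u: "u \<in> orthant - {0}"
  shows "(\<lambda>n. ray u r n / real n) \<longlonglongrightarrow> phi u r"
proof -
  obtain N where N: "\<And>n. n \<ge> N \<Longrightarrow> floor_site (real n *\<^sub>R u) \<noteq> 0"
    using eventually_floor_site_nonzero[OF u] by blast
  \<comment> \<open>For small \<open>n\<close> the rounded site may be \<open>0\<close>, where
    \<open>ray\<close> can be a junk value; it is replaced by \<open>0\<close> so that the linear
    upper bound holds for all \<open>n\<close>.\<close>
  define b where "b n = (if n \<ge> N then ray u r n else 0)" for n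
  have "convergent (\<lambda>n. b n / real n)"
  proof (rule fekete_superadditive)
    fix m n assume mn: "m \<ge> N" "n \<ge> N"
    let ?x = "real m *\<^sub>R u" and ?y = "real n *\<^sub>R u"
    let ?v = "floor_site ?x + floor_site ?y"
    have xy: "?x + ?y = real (m + n) *\<^sub>R u" by (simp add: scaleR_add_left)
    have o: "?x \<in> orthant" "?y \<in> orthant" "?x + ?y \<in> orthant"
      using u by (auto intro: scaled_orthant orthant_add)
    obtain w where w: "floor_site (?x + ?y) = ?v + w" and "\<And>i. w $ i \<le> 1"
      using floor_site_add[OF o(1,2)] by blast
    then have "l1 w \<le> CARD('b)" unfolding l1_def using sum_bounded_above[of UNIV "\<lambda>i. w $ i" 1] by simp
    \<comment> \<open>The leftover is assigned level \<open>0\<close>, which is feasible even when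
      \<open>w = 0\<close>.\<close>
    then have lw: "ltail w 0 \<ge> - real CARD('b) * cost 0" by (intro ltail_ge_const) auto
    have "ray u r (m + n) = ltail (?v + w) ((real m * r + real n * r) + 0)"
      unfolding ray_def xy[symmetric] w by (simp add: algebra_simps)
    also have "\<dots> \<ge> ltail ?v (real m * r + real n * r) + ltail w 0"
      using N[OF mn(1)] by (intro ltail_superadditive) (auto simp: vec_eq_iff)
    finally have "ray u r (m + n) \<ge> ltail ?v (real m * r + real n * r) + ltail w 0" .
    moreover have "ltail ?v (real m * r + real n * r) \<ge> ray u r m + ray u r n"
      unfolding ray_def using N mn by (intro ltail_superadditive) auto
    ultimately show "b (m + n) \<ge> b m + b n - real CARD('b) * cost 0"
      using mn lw by (simp add: b_def)
  next
    show "b n \<le> 0 * real n" for n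
      using N by (auto simp: b_def ray_def intro!: ltail_nonpos)
  qed
  then obtain l where "(\<lambda>n. b n / real n) \<longlonglongrightarrow> l" by (auto simp: convergent_def)
  moreover have "\<forall>\<^sub>F n in sequentially. b n / real n = ray u r n / real n"
    by (rule eventually_sequentiallyI[of N]) (simp add: b_def)
  ultimately have "(\<lambda>n. ray u r n / real n) \<longlonglongrightarrow> l" by (rule Lim_transform_eventually)
  then show ?thesis unfolding phi_def using limI by metis
qed

lemma phi_nonpos:
  assumes u: "u \<in> orthant - {0}"
  shows "phi u r \<le> 0"
proof -
  obtain N where N: "\<And>n. n \<ge> N \<Longrightarrow> floor_site (real n *\<^sub>R u) \<noteq> 0"
    using eventually_floor_site_nonzero[OF u] by blast
  have "ray u r n / real n \<le> 0" if "n \<ge> N" for n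
    unfolding ray_def using ltail_nonpos N[OF that] by (intro divide_nonpos_nonneg) auto
  then show ?thesis using LIMSEQ_le_const2[OF ray_convergent[OF u], of r 0] by blast
qed

end

section \<open>Convexity and continuity\<close>

lemma filterlim_nat_floor_shift:
  assumes "a > 0"
  shows "filterlim (\<lambda>n. nat \<lfloor>real n * a\<rfloor> - K) at_top sequentially"
    and "(\<lambda>n. real (nat \<lfloor>real n * a\<rfloor> - K) / real n) \<longlonglongrightarrow> a"
proof -
  define m where "m n = nat \<lfloor>real n * a\<rfloor> - K" for n
  have lo: "real (m n) \<ge> real n * a - (real K + 1)" for n
  proof -
    have "real n * a \<ge> 0" using assms by simp
    then have "real (nat \<lfloor>real n * a\<rfloor>) > real n * a - 1" by linarith
    then show ?thesis unfolding m_def by linarith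
  qed
  have hi: "real (m n) \<le> real n * a" for n
  proof -
    have "real n * a \<ge> 0" using assms by simp
    then have "real (nat \<lfloor>real n * a\<rfloor>) \<le> real n * a" by linarith
    then show ?thesis unfolding m_def by linarith
  qed
  have "filterlim (\<lambda>n. real n * a - (real K + 1)) at_top sequentially"
    using assms by real_asymp
  then have "filterlim (\<lambda>n. real (m n)) at_top sequentially"
    by (rule filterlim_at_top_mono) (use lo in auto)
  then show "filterlim (\<lambda>n. nat \<lfloor>real n * a\<rfloor> - K) at_top sequentially"
    unfolding m_def filterlim_sequentially_iff_filterlim_real .
  have l1: "(\<lambda>n. a - (real K + 1) / real n) \<longlonglongrightarrow> a" by real_asymp
  have l2: "(\<lambda>n. a) \<longlonglongrightarrow> a" by simp
  have "(\<lambda>n. real (m n) / real n) \<longlonglongrightarrow> a"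
  proof (rule tendsto_sandwich[OF _ _ l1 l2])
    show "\<forall>\<^sub>F n in sequentially. a - (real K + 1) / real n \<le> real (m n) / real n"
    proof (rule eventually_sequentiallyI[of 1])
      fix n :: nat assume "n \<ge> 1"
      then have n: "real n > 0" by simp
      have "a - (real K + 1) / real n = (real n * a - (real K + 1)) / real n"
        using n by (simp add: diff_divide_distrib)
      also have "\<dots> \<le> real (m n) / real n" using lo n by (intro divide_right_mono) auto
      finally show "a - (real K + 1) / real n \<le> real (m n) / real n" .
    qed
    show "\<forall>\<^sub>F n in sequentially. real (m n) / real n \<le> a"
    proof (rule eventually_sequentiallyI[of 1])
      fix n :: nat assume "n \<ge> 1"
      then show "real (m n) / real n \<le> a" using hi[of n] by (simp add: divide_simps mult.commute)
    qed
  qed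
  then show "(\<lambda>n. real (nat \<lfloor>real n * a\<rfloor> - K) / real n) \<longlonglongrightarrow> a" by (simp add: m_def)
qed

section \<open>Concavity and comparison of nearby points\<close>

context unbounded_field
begin

text \<open>Both summands are run \<open>K\<close> steps short of their share, so that the leftover site is nonzero and
  can absorb any bounded deficit in the level at bounded cost.\<close>

lemma phi_cone:
  assumes u: "u \<in> orthant - {0}" and v: "v \<in> orthant - {0}" and a: "a > 0" and b: "b > 0"
  shows "phi (a *\<^sub>R u + b *\<^sub>R v) (a * r + b * t) \<ge> a * phi u r + b * phi v t"
proof -
  define W where "W = a *\<^sub>R u + b *\<^sub>R v"
  have W: "W \<in> orthant - {0}" unfolding W_def using assms by (rule orthant_cone)
  obtain i where i: "u $ i > 0" using orthant_pos_component[OF u] by blast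
  \<comment> \<open>\<open>K\<close> steps along \<open>u\<close> advance at least one unit in
    coordinate \<open>i\<close>, so holding them back leaves a nonzero site.\<close>
  obtain K where K: "real K \<ge> 1 / u $ i" using real_arch_simple by blast
  have Ki: "real K * u $ i \<ge> 1" using K i by (simp add: divide_le_eq)
  define m where "m n = nat \<lfloor>real n * a\<rfloor> - K" for n
  define k where "k n = nat \<lfloor>real n * b\<rfloor> - K" for n
  \<comment> \<open>\<open>R\<close> bounds the level deficit \<open>e\<close> and \<open>L\<close>
    the length of the leftover \<open>d\<close>, both independently of \<open>n\<close>; the last
    summand of \<open>L\<close> accounts for the two roundings.\<close>
  define R where "R = (real K + 1) * (\<bar>r\<bar> + \<bar>t\<bar>)"
  define L where "L = (real K + 1) * (mass u + mass v) + 2 * real CARD('b)"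
  note ma = filterlim_nat_floor_shift[OF a, of K, folded m_def]
  note kb = filterlim_nat_floor_shift[OF b, of K, folded k_def]
  obtain N1 where N1: "\<And>n. n \<ge> N1 \<Longrightarrow> floor_site (real n *\<^sub>R u) \<noteq> 0"
    using eventually_floor_site_nonzero[OF u] by blast
  obtain N2 where N2: "\<And>n. n \<ge> N2 \<Longrightarrow> floor_site (real n *\<^sub>R v) \<noteq> 0"
    using eventually_floor_site_nonzero[OF v] by blast
  have ev: "\<forall>\<^sub>F n in sequentially. n \<ge> 1 \<and> m n \<ge> max N1 1 \<and> k n \<ge> max N2 1"
    using ma(1) kb(1) eventually_ge_at_top[of "1 :: nat"] unfolding filterlim_at_top
    by (intro eventually_conj) blast+
  have main: "ray u r (m n) + ray v t (k n) - L * cost R \<le> ray W (a * r + b * t) n"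
    if n: "n \<ge> 1 \<and> m n \<ge> max N1 1 \<and> k n \<ge> max N2 1" for n
  proof -
    let ?x = "real (m n) *\<^sub>R u" and ?y = "real (k n) *\<^sub>R v" and ?w = "real n *\<^sub>R W"
    let ?s = "floor_site ?x + floor_site ?y"
    have am: "real (m n) + real K \<le> real n * a" "real n * a \<le> real (m n) + real K + 1"
      using n unfolding m_def by linarith+
    have bk: "real (k n) + real K \<le> real n * b" "real n * b \<le> real (k n) + real K + 1"
      using n unfolding k_def by linarith+
    have o: "?x \<in> orthant" "?y \<in> orthant" "?w \<in> orthant"
      using u v W by (auto intro: scaled_orthant)
    have un: "u $ c \<ge> 0" "v $ c \<ge> 0" for c using u v by (auto simp: orthant_def)
    have gap: "real (m n) * u $ c + real K * u $ c + real (k n) * v $ c \<le> ?w $ c" for c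
    proof -
      have "(real (m n) + real K) * u $ c \<le> (real n * a) * u $ c" "real (k n) * v $ c \<le> (real n * b) * v $ c"
        using am bk un by (auto intro!: mult_right_mono)
      then show ?thesis by (simp add: W_def algebra_simps)
    qed
    have sb: "?s \<in> below (floor_site ?w)"
      unfolding below_def
    proof safe
      fix c
      have "real K * u $ c \<ge> 0" using un by simp
      then have "real (?s $ c) \<le> ?w $ c"
        using gap[of c] floor_site_le[OF o(1), of c] floor_site_le[OF o(2), of c] by simp
      from le_floor_site[OF this] show "?s $ c \<le> floor_site ?w $ c" by simp
    qed
    define d where "d = floor_site ?w - ?s"
    have w: "floor_site ?w = ?s + d" unfolding d_def using add_diff_below[OF sb] by simp
    have dn: "d \<noteq> 0"
    proof
      assume "d = 0"
      then have "floor_site ?w $ i = ?s $ i" using w by simp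
      moreover have "real (?s $ i + 1) \<le> ?w $ i"
        using gap[of i] Ki floor_site_le[OF o(1), of i] floor_site_le[OF o(2), of i] by simp
      from le_floor_site[OF this] have "?s $ i + 1 \<le> floor_site ?w $ i" by simp
      ultimately show False by simp
    qed
    have dl: "real (l1 d) \<le> L"
    proof -
      have "real (l1 (floor_site ?w)) \<le> real n * mass W"
        using l1_floor_site_le[OF o(3)] by (simp add: mass_scaleR)
      moreover have "real (l1 (floor_site ?w)) = real (l1 (floor_site ?x)) + real (l1 (floor_site ?y)) + real (l1 d)"
        unfolding w by simp
      moreover have "real (l1 (floor_site ?x)) \<ge> real (m n) * mass u - real CARD('b)"
        using l1_floor_site_ge[OF o(1)] by (simp add: mass_scaleR)
      moreover have "real (l1 (floor_site ?y)) \<ge> real (k n) * mass v - real CARD('b)"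
        using l1_floor_site_ge[OF o(2)] by (simp add: mass_scaleR)
      moreover have "real n * mass W \<le> (real (m n) + real K + 1) * mass u + (real (k n) + real K + 1) * mass v"
      proof -
        have "real n * mass W = (real n * a) * mass u + (real n * b) * mass v"
          by (simp add: W_def mass_add mass_scaleR algebra_simps)
        also have "\<dots> \<le> (real (m n) + real K + 1) * mass u + (real (k n) + real K + 1) * mass v"
          using am bk mass_nonneg u v by (intro add_mono mult_right_mono) auto
        finally show ?thesis .
      qed
      ultimately show ?thesis unfolding L_def by (simp add: algebra_simps)
    qed
    define e where "e = (real n * a - real (m n)) * r + (real n * b - real (k n)) * t"
    have "e \<le> R"
    proof -
      have "(real n * a - real (m n)) * r \<le> (real K + 1) * \<bar>r\<bar>"
      proof -
        have "(real n * a - real (m n)) * r \<le> (real n * a - real (m n)) * \<bar>r\<bar>"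
          using am by (intro mult_left_mono) auto
        also have "\<dots> \<le> (real K + 1) * \<bar>r\<bar>" using am by (intro mult_right_mono) auto
        finally show ?thesis .
      qed
      moreover have "(real n * b - real (k n)) * t \<le> (real K + 1) * \<bar>t\<bar>"
      proof -
        have "(real n * b - real (k n)) * t \<le> (real n * b - real (k n)) * \<bar>t\<bar>"
          using bk by (intro mult_left_mono) auto
        also have "\<dots> \<le> (real K + 1) * \<bar>t\<bar>" using bk by (intro mult_right_mono) auto
        finally show ?thesis .
      qed
      ultimately show ?thesis unfolding e_def R_def by (simp add: algebra_simps)
    qed
    then have le: "ltail d e \<ge> - L * cost R"
      using dn dl by (intro ltail_ge_const) (auto simp: R_def)
    have "ray W (a * r + b * t) n = ltail (?s + d) ((real (m n) * r + real (k n) * t) + e)"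
      unfolding ray_def w e_def by (simp add: algebra_simps)
    also have "\<dots> \<ge> ltail ?s (real (m n) * r + real (k n) * t) + ltail d e"
      using dn N1[of "m n"] n by (intro ltail_superadditive) (auto simp: vec_eq_iff)
    finally have "ray W (a * r + b * t) n \<ge> ltail ?s (real (m n) * r + real (k n) * t) + ltail d e" .
    moreover have "ltail ?s (real (m n) * r + real (k n) * t) \<ge> ray u r (m n) + ray v t (k n)"
      unfolding ray_def using N1[of "m n"] N2[of "k n"] n by (intro ltail_superadditive) auto
    ultimately show ?thesis using le by simp
  qed
  have "(\<lambda>n. ray u r (m n) / real (m n) * (real (m n) / real n) +
      ray v t (k n) / real (k n) * (real (k n) / real n) - L * cost R / real n)
      \<longlonglongrightarrow> phi u r * a + phi v t * b - 0"
    by (intro tendsto_diff tendsto_add tendsto_mult ma kb lim_const_over_n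
        filterlim_compose[OF ray_convergent[OF u] ma(1)] filterlim_compose[OF ray_convergent[OF v] kb(1)])
  moreover have "\<forall>\<^sub>F n in sequentially. ray u r (m n) / real (m n) * (real (m n) / real n) +
      ray v t (k n) / real (k n) * (real (k n) / real n) - L * cost R / real n
      \<le> ray W (a * r + b * t) n / real n"
    using ev
  proof eventually_elim
    case (elim n)
    have "(ray u r (m n) + ray v t (k n) - L * cost R) / real n \<le> ray W (a * r + b * t) n / real n"
      using main[OF elim] by (intro divide_right_mono) auto
    then show ?case using elim by (simp add: add_divide_distrib diff_divide_distrib)
  qed
  ultimately have "phi u r * a + phi v t * b - 0 \<le> phi W (a * r + b * t)"
    by (intro tendsto_le[OF _ ray_convergent[OF W]]) auto
  then show ?thesis by (simp add: W_def mult.commute)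
qed

text \<open>All weights of one path are forced up; for large \<open>n\<close> at least
  \<open>n * mass h / 2\<close> steps are available, hence the factor \<open>2\<close>. If
  \<open>r\<close> is of the order of \<open>mass h\<close>, the bound is a constant times
  \<open>mass h\<close>, so small displacements are cheap.\<close>

lemma phi_ge_cost:
  assumes h: "h \<in> orthant - {0}"
  shows "phi h r \<ge> - mass h * cost (2 * \<bar>r\<bar> / mass h)"
proof -
  have mh: "mass h > 0" using mass_pos[OF h] .
  obtain N where N: "real N \<ge> 2 * real CARD('b) / mass h" using real_arch_simple by blast
  have "ray h r n / real n \<ge> - mass h * cost (2 * \<bar>r\<bar> / mass h)" if n: "n \<ge> max N 1" for n
  proof -
    let ?v = "floor_site (real n *\<^sub>R h)"
    have n0: "real n > 0" using n by simp
    have o: "real n *\<^sub>R h \<in> orthant" using h by (rule scaled_orthant)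
    have "2 * real CARD('b) / mass h \<le> real n" using N n by linarith
    then have "2 * real CARD('b) \<le> real n * mass h" using mh by (simp add: divide_le_eq)
    then have lo: "real (l1 ?v) \<ge> real n * mass h / 2"
      using l1_floor_site_ge[OF o] by (simp add: mass_scaleR)
    have hi: "real (l1 ?v) \<le> real n * mass h"
      using l1_floor_site_le[OF o] by (simp add: mass_scaleR)
    have pos: "real n * mass h / 2 > 0" using n0 mh by simp
    then have v0: "?v \<noteq> 0" using lo by auto
    have "real n * r / real (l1 ?v) \<le> real n * \<bar>r\<bar> / (real n * mass h / 2)"
      using pos lo n0 by (intro frac_le mult_left_mono) auto
    also have "\<dots> = 2 * \<bar>r\<bar> / mass h" using n0 by (simp add: field_simps)
    finally have "cost (real n * r / real (l1 ?v)) \<le> cost (2 * \<bar>r\<bar> / mass h)" by (rule cost_mono)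
    then have "real (l1 ?v) * cost (real n * r / real (l1 ?v)) \<le> real n * mass h * cost (2 * \<bar>r\<bar> / mass h)"
      using hi cost_nonneg by (intro mult_mono) auto
    then have "ray h r n \<ge> - (real n * mass h * cost (2 * \<bar>r\<bar> / mass h))"
      using ltail_ge_cost[OF v0, of "real n * r"] by (simp add: ray_def)
    then have "- (real n * mass h * cost (2 * \<bar>r\<bar> / mass h)) / real n \<le> ray h r n / real n"
      by (rule divide_right_mono) simp
    then show ?thesis using n0 by simp
  qed
  then show ?thesis using LIMSEQ_le_const[OF ray_convergent[OF h], of _ r] by blast
qed

text \<open>Write \<open>y\<close> as \<open>(1 - e) *\<^sub>R x\<close> plus a vector
  \<open>h\<close> of the orthant and apply \<open>phi_cone\<close>; the factor \<open>1 - e\<close>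
  in front of \<open>phi x a\<close> can be removed since \<open>phi\<close> is nonpositive. The
  constants \<open>A\<close> and \<open>B\<close> bracket the mass of \<open>h\<close>.\<close>

lemma phi_perturb:
  assumes x: "x \<in> orthant - {0}" and y: "y \<in> orthant - {0}" and e: "0 < e" "e < 1"
    and h: "\<And>i. (1 - e) * x $ i \<le> y $ i"
    and A: "0 < A" "A \<le> mass y - (1 - e) * mass x" and B: "mass y - (1 - e) * mass x \<le> B"
    and S: "\<bar>b - (1 - e) * a\<bar> \<le> S"
  shows "phi y b \<ge> phi x a - B * cost (2 * S / A)"
proof -
  define h where "h = y - (1 - e) *\<^sub>R x"
  have mh: "mass h = mass y - (1 - e) * mass x" by (simp add: h_def mass_diff mass_scaleR)
  have ho: "h \<in> orthant" using h by (simp add: orthant_def h_def)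
  then have h0: "h \<in> orthant - {0}" using A mh by (subst orthant_nonzero_iff) auto
  have "phi ((1 - e) *\<^sub>R x + 1 *\<^sub>R h) ((1 - e) * a + 1 * (b - (1 - e) * a))
      \<ge> (1 - e) * phi x a + 1 * phi h (b - (1 - e) * a)"
    using e by (intro phi_cone x h0) auto
  then have "phi y b \<ge> (1 - e) * phi x a + phi h (b - (1 - e) * a)" by (simp add: h_def)
  moreover have "(1 - e) * phi x a \<ge> phi x a"
    using phi_nonpos[OF x, of a] e by (simp add: algebra_simps mult_nonneg_nonpos)
  moreover have "phi h (b - (1 - e) * a) \<ge> - B * cost (2 * S / A)"
  proof -
    have "2 * \<bar>b - (1 - e) * a\<bar> / mass h \<le> 2 * S / A"
      using S A mh by (intro frac_le) auto
    then have "mass h * cost (2 * \<bar>b - (1 - e) * a\<bar> / mass h) \<le> B * cost (2 * S / A)"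
      using A B mh cost_nonneg by (intro mult_mono cost_mono) auto
    then show ?thesis using phi_ge_cost[OF h0, of "b - (1 - e) * a"] by simp
  qed
  ultimately show ?thesis by simp
qed

end

section \<open>Continuity up to the boundary of the orthant\<close>

definition rotate_vec :: "('d::finite) set \<Rightarrow> 'd \<Rightarrow> real ^ 'd \<Rightarrow> real ^ 'd" where
  "rotate_vec I j v = (\<chi> c. if c \<in> I then 0 else if c = j then v $ j + (\<Sum>i\<in>I. v $ i) else v $ c)"

lemma mass_rotate_vec:
  assumes "j \<notin> I"
  shows "mass (rotate_vec I j v) = mass v"
proof -
  have "mass (rotate_vec I j v) = (\<Sum>c\<in>- I - {j}. v $ c) + (v $ j + (\<Sum>i\<in>I. v $ i))"
  proof -
    have "mass (rotate_vec I j v) = (\<Sum>c\<in>- I. rotate_vec I j v $ c)"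
      unfolding mass_def by (intro sum.mono_neutral_right) (auto simp: rotate_vec_def)
    also have "\<dots> = rotate_vec I j v $ j + (\<Sum>c\<in>- I - {j}. rotate_vec I j v $ c)"
      using assms by (intro sum.remove) auto
    also have "(\<Sum>c\<in>- I - {j}. rotate_vec I j v $ c) = (\<Sum>c\<in>- I - {j}. v $ c)"
      by (intro sum.cong) (auto simp: rotate_vec_def)
    finally show ?thesis using assms by (simp add: rotate_vec_def)
  qed
  also have "\<dots> = (\<Sum>c\<in>- I. v $ c) + (\<Sum>i\<in>I. v $ i)"
    using assms sum.remove[of "- I" j "\<lambda>c. v $ c"] by simp
  also have "\<dots> = mass v"
    unfolding mass_def using sum.union_disjoint[of "- I" I "\<lambda>c. v $ c"] by (simp add: Un_commute)
  finally show ?thesis .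
qed

lemma rotate_vec_orthant: "v \<in> orthant \<Longrightarrow> rotate_vec I j v \<in> orthant"
  by (auto simp: orthant_def rotate_vec_def intro!: add_nonneg_nonneg sum_nonneg)

lemma rotate_vec_orthant_nonzero: "j \<notin> I \<Longrightarrow> v \<in> orthant - {0} \<Longrightarrow> rotate_vec I j v \<in> orthant - {0}"
  using mass_pos[of v] by (subst orthant_nonzero_iff) (auto simp: mass_rotate_vec intro: rotate_vec_orthant)

context unbounded_field
begin

text \<open>The exponential rate of the factor \<open>N\<close> in \<open>tail_rotate_le\<close> is
  at most \<open>h\<close>; it is lost once in the probability and once in the level. The first
  summand is small when \<open>v $ i\<close> is, the second when \<open>z\<close> is close to
  \<open>1\<close>.\<close>

lemma phi_rotate1:
  assumes v: "v \<in> orthant - {0}" and ij: "i \<noteq> j" and z: "0 < z" "z < 1"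
  defines "h \<equiv> v $ i * (real CARD('b) * ln (1 / (1 - z))) + mass v * ln (1 / z)"
  shows "phi v r \<le> h + phi (rotate_vec {i} j v) (r - h)"
proof -
  define w where "w = rotate_vec {i} j v"
  have w: "w \<in> orthant - {0}" unfolding w_def using ij v by (intro rotate_vec_orthant_nonzero) auto
  define K where "K = (1 / (1 - z)) ^ CARD('b)"
  have lK: "ln K = real CARD('b) * ln (1 / (1 - z))" unfolding K_def using z by (simp add: ln_realpow)
  have K: "K \<ge> 1" unfolding K_def using z by (intro one_le_power) (simp add: field_simps)
  have lz: "ln (1 / z) \<ge> 0" using z by simp
  have main: "ray v r n \<le> real n * h + ray w (r - h) n + real CARD('b) * cost 0"
    if n0: "floor_site (real n *\<^sub>R v) \<noteq> 0" for n
  proof -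
    let ?f = "floor_site (real n *\<^sub>R v)" and ?g = "floor_site (real n *\<^sub>R w)"
    let ?s = "rotate_site i j ?f"
    define N where "N = K ^ (?f $ i) * (1 / z) ^ l1 ?f"
    have o: "real n *\<^sub>R v \<in> orthant" "real n *\<^sub>R w \<in> orthant" using v w by (auto intro: scaled_orthant)
    have Np: "N > 0" using K z by (simp add: N_def)
    have lN: "ln N = real (?f $ i) * ln K + real (l1 ?f) * ln (1 / z)"
      using K z by (simp add: N_def ln_mult ln_realpow)
    have "real (?f $ i) * ln K + real (l1 ?f) * ln (1 / z) \<le> (real n * v $ i) * ln K + (real n * mass v) * ln (1 / z)"
      using K lz floor_site_le[OF o(1), of i] l1_floor_site_le[OF o(1)]
      by (intro add_mono mult_right_mono) (auto simp: mass_scaleR)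
    then have lNh: "ln N \<le> real n * h" unfolding lN h_def lK by (simp add: algebra_simps)
    have ls: "rotate_site i j ?f \<noteq> 0"
    proof
      assume a: "rotate_site i j ?f = 0"
      have "?f $ c = 0" for c
        using arg_cong[OF a, of "\<lambda>x. x $ c"] arg_cong[OF a, of "\<lambda>x. x $ j"] ij
        by (auto simp: rotate_site_def split: if_splits)
      then show False using n0 by (simp add: vec_eq_iff)
    qed
    have wi: "w $ c = (if c = i then 0 else if c = j then v $ j + v $ i else v $ c)" for c
      by (simp add: w_def rotate_vec_def)
    \<comment> \<open>Rotation and rounding do not commute: the fractional parts of coordinates
      \<open>i\<close> and \<open>j\<close> may add up to a further unit. The difference
      \<open>d\<close> is at most one in each coordinate and is assigned level
      \<open>0\<close>.\<close>
    have sb: "?s \<in> below ?g"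
      unfolding below_def
    proof safe
      fix c
      have "real (?s $ c) \<le> (real n *\<^sub>R w) $ c"
        using floor_site_le[OF o(1), of c] floor_site_le[OF o(1), of i] floor_site_le[OF o(1), of j]
        by (auto simp: rotate_site_def wi algebra_simps)
      from le_floor_site[OF this] show "?s $ c \<le> ?g $ c" .
    qed
    define d where "d = ?g - ?s"
    have g: "?g = ?s + d" unfolding d_def using add_diff_below[OF sb] by simp
    have "d $ c \<le> 1" for c
    proof -
      have "real (?g $ c) \<le> (real n *\<^sub>R w) $ c" by (rule floor_site_le[OF o(2)])
      moreover have "(real n *\<^sub>R w) $ c < real (?s $ c) + 2"
        using floor_site_gt[OF o(1), of c] floor_site_gt[OF o(1), of i] floor_site_gt[OF o(1), of j]
        by (auto simp: rotate_site_def wi algebra_simps)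
      moreover have "?g $ c = ?s $ c + d $ c" unfolding g by simp
      ultimately have "real (d $ c) < 2" by linarith
      then show ?thesis by simp
    qed
    then have "l1 d \<le> CARD('b)" unfolding l1_def using sum_bounded_above[of UNIV "\<lambda>i. d $ i" 1] by simp
    then have ld: "ltail d 0 \<ge> - real CARD('b) * cost 0" by (intro ltail_ge_const) auto
    have tp: "tail ?s (real n * r - ln N) > 0" "tail ?f (real n * r) > 0" using ls n0 tail_pos by blast+
    have "tail ?f (real n * r) \<le> N * tail ?s (real n * r - ln N)"
      unfolding N_def K_def by (rule tail_rotate_le[OF z ij])
    then have "ln (tail ?f (real n * r)) \<le> ln (N * tail ?s (real n * r - ln N))"
      using tp Np by (subst ln_le_cancel_iff) auto
    also have "\<dots> = ln N + ln (tail ?s (real n * r - ln N))" using tp Np by (simp add: ln_mult)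
    finally have "ray v r n \<le> ln N + ltail ?s (real n * r - ln N)" unfolding ray_def ltail_def .
    also have "ltail ?s (real n * r - ln N) \<le> ltail ?s (real n * (r - h))"
      using ls lNh by (intro ltail_antimono) (auto simp: algebra_simps)
    finally have "ray v r n \<le> real n * h + ltail ?s (real n * (r - h))" using lNh by simp
    moreover have "ltail (?s + d) (real n * (r - h) + 0) \<ge> ltail ?s (real n * (r - h)) + ltail d 0"
      using ls by (intro ltail_superadditive) auto
    then have "ray w (r - h) n \<ge> ltail ?s (real n * (r - h)) + ltail d 0"
      unfolding ray_def g by simp
    ultimately show ?thesis using ld by simp
  qed
  obtain N where N: "\<And>n. n \<ge> N \<Longrightarrow> floor_site (real n *\<^sub>R v) \<noteq> 0"
    using eventually_floor_site_nonzero[OF v] by blast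
  have "(\<lambda>n. h + ray w (r - h) n / real n + real CARD('b) * cost 0 / real n) \<longlonglongrightarrow> h + phi w (r - h) + 0"
    by (intro tendsto_add tendsto_const ray_convergent[OF w] lim_const_over_n)
  moreover have "\<forall>\<^sub>F n in sequentially. ray v r n / real n \<le> h + ray w (r - h) n / real n + real CARD('b) * cost 0 / real n"
  proof (rule eventually_sequentiallyI[of "max N 1"])
    fix n assume n: "n \<ge> max N 1"
    have "ray v r n / real n \<le> (real n * h + ray w (r - h) n + real CARD('b) * cost 0) / real n"
      using main[OF N] n by (intro divide_right_mono) auto
    then show "ray v r n / real n \<le> h + ray w (r - h) n / real n + real CARD('b) * cost 0 / real n"
      using n by (simp add: add_divide_distrib)
  qed
  ultimately have "phi v r \<le> h + phi w (r - h) + 0"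
    by (intro tendsto_le[OF _ _ ray_convergent[OF v]]) auto
  then show ?thesis by (simp add: w_def)
qed

text \<open>Directions are removed one at a time. A rotation changes neither the mass nor the
  coordinates of \<open>I\<close> still to be treated, so the losses simply add up.\<close>

lemma phi_rotate:
  assumes v: "v \<in> orthant - {0}" and j: "j \<notin> I" and z: "0 < z" "z < 1"
  defines "h \<equiv> \<lambda>I. (\<Sum>i\<in>I. v $ i) * (real CARD('b) * ln (1 / (1 - z))) + real (card I) * (mass v * ln (1 / z))"
  shows "phi v r \<le> h I + phi (rotate_vec I j v) (r - h I)"
proof -
  have "finite I" by simp
  then show ?thesis using j
  proof (induction I rule: finite_induct)
    case empty
    have "rotate_vec {} j v = v" by (simp add: rotate_vec_def vec_eq_iff)
    then show ?case by (simp add: h_def)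
  next
    case (insert i I)
    let ?w = "rotate_vec I j v"
    have w: "?w \<in> orthant - {0}" using insert v by (intro rotate_vec_orthant_nonzero) auto
    have wi: "?w $ i = v $ i" using insert by (auto simp: rotate_vec_def)
    have mw: "mass ?w = mass v" using insert by (intro mass_rotate_vec) auto
    have ww: "rotate_vec {i} j ?w = rotate_vec (insert i I) j v"
      using insert by (auto simp: rotate_vec_def vec_eq_iff)
    let ?h = "v $ i * (real CARD('b) * ln (1 / (1 - z))) + mass v * ln (1 / z)"
    have "phi ?w (r - h I) \<le> ?h + phi (rotate_vec (insert i I) j v) (r - h I - ?h)"
      using phi_rotate1[OF w _ z, of i j "r - h I"] insert.prems unfolding wi mw ww by auto
    moreover have "h (insert i I) = h I + ?h" using insert by (simp add: h_def algebra_simps)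
    ultimately show ?case using insert by (simp add: algebra_simps)
  qed
qed

lemma phi_tendsto:
  assumes u: "u \<in> orthant - {0}" and U: "\<And>k. U k \<in> orthant - {0}"
    and lim: "U \<longlonglongrightarrow> u" and R: "R \<longlonglongrightarrow> r"
  shows "(\<lambda>k. phi (U k) (R k)) \<longlonglongrightarrow> phi u r"
proof (rule order_tendstoI)
  define m where "m = mass u"
  \<comment> \<open>With \<open>A = e * m / 2\<close>, \<open>B = 2 * e * m\<close> and
    \<open>S = e * (\<bar>r\<bar> + 2)\<close> in \<open>phi_perturb\<close>, the argument
    \<open>2 * S / A\<close> of the cost is this number for every \<open>e\<close>, so the loss
    \<open>e * (c - 1)\<close> is linear in \<open>e\<close>.\<close>
  define \<rho> where "\<rho> = 4 * (\<bar>r\<bar> + 2) / m"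
  define c where "c = 1 + 2 * m * cost \<rho>"
  define eps where "eps \<eta> = min (1 / 2) (\<eta> / (2 * c))" for \<eta> :: real
  have m: "m > 0" unfolding m_def by (rule mass_pos[OF u])
  have c: "c \<ge> 1" unfolding c_def using m cost_nonneg by simp
  have eps: "0 < eps \<eta>" "eps \<eta> < 1" "eps \<eta> * c < \<eta>" if "\<eta> > 0" for \<eta>
  proof -
    show "0 < eps \<eta>" "eps \<eta> < 1" using that c by (auto simp: eps_def)
    have "eps \<eta> * c \<le> \<eta> / (2 * c) * c" unfolding eps_def using c by (intro mult_right_mono) auto
    also have "\<dots> < \<eta>" using c that by simp
    finally show "eps \<eta> * c < \<eta>" .
  qed
  have cost_eq: "(2 * e * m) * cost (2 * (e * (\<bar>r\<bar> + 2)) / (e * m / 2)) = e * (c - 1)" if "e > 0" for e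
  proof -
    have "2 * (e * (\<bar>r\<bar> + 2)) / (e * m / 2) = \<rho>" using that m by (simp add: \<rho>_def field_simps)
    then show ?thesis by (simp add: c_def)
  qed
  have comp: "(\<lambda>k. U k $ i) \<longlonglongrightarrow> u $ i" for i by (intro tendsto_intros lim)
  have ms: "(\<lambda>k. mass (U k)) \<longlonglongrightarrow> m" unfolding m_def by (rule tendsto_mass[OF lim])
  have un: "u $ i \<ge> 0" "U k $ i \<ge> 0" for i k using u U[of k] by (auto simp: orthant_def)
  {
    \<comment> \<open>For the lower bound, \<open>U k\<close> has to dominate
      \<open>(1 - e) *\<^sub>R u\<close>. Coordinates with \<open>u $ i = 0\<close> impose nothing,
      so the boundary causes no difficulty here.\<close>
    fix a assume a: "a < phi u r"
    define e where "e = eps (phi u r - a)"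
    have e: "0 < e" "e < 1" "e * c < phi u r - a" unfolding e_def using eps a by auto
    have em: "e * m > 0" using e m by simp
    have "\<forall>\<^sub>F k in sequentially. (1 - e) * u $ i \<le> U k $ i" for i
    proof (cases "u $ i = 0")
      case False
      then have "(1 - e) * u $ i < u $ i" using un(1)[of i] e by (simp add: algebra_simps)
      from order_tendstoD(1)[OF comp this] show ?thesis by eventually_elim simp
    qed (use un in simp)
    then have E1: "\<forall>\<^sub>F k in sequentially. \<forall>i. (1 - e) * u $ i \<le> U k $ i"
      by (rule eventually_all_finite)
    have l2: "(\<lambda>k. mass (U k) - (1 - e) * m) \<longlonglongrightarrow> m - (1 - e) * m" by (intro tendsto_intros ms)
    have l2': "e * m / 2 < m - (1 - e) * m" "m - (1 - e) * m < 2 * e * m"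
      using em by (simp_all add: algebra_simps)
    have l3: "(\<lambda>k. \<bar>R k - (1 - e) * r\<bar>) \<longlonglongrightarrow> \<bar>r - (1 - e) * r\<bar>" by (intro tendsto_intros R)
    have "\<bar>r - (1 - e) * r\<bar> = e * \<bar>r\<bar>" using e by (simp add: algebra_simps abs_mult)
    then have l3': "\<bar>r - (1 - e) * r\<bar> < e * (\<bar>r\<bar> + 2)" using e by (simp add: algebra_simps)
    show "\<forall>\<^sub>F k in sequentially. a < phi (U k) (R k)"
      using E1 order_tendstoD(1)[OF l2 l2'(1)] order_tendstoD(2)[OF l2 l2'(2)] order_tendstoD(2)[OF l3 l3']
    proof eventually_elim
      case (elim k)
      have "phi (U k) (R k) \<ge> phi u r - (2 * e * m) * cost (2 * (e * (\<bar>r\<bar> + 2)) / (e * m / 2))"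
        using elim em by (intro phi_perturb[OF u U e(1,2)]) (auto simp: m_def)
      then show "a < phi (U k) (R k)" unfolding cost_eq[OF e(1)] using e by (simp add: algebra_simps)
    qed
  }
  {
    \<comment> \<open>With the roles exchanged, \<open>(1 - e) * U k $ i \<le> u $ i\<close> would
      be needed, which fails where \<open>u $ i = 0 < U k $ i\<close>. The coordinates in
      \<open>I\<close> are therefore rotated into a direction \<open>j\<close> of the face
      first.\<close>
    fix a assume a: "a > phi u r"
    define e where "e = eps (a - phi u r)"
    have e: "0 < e" "e < 1" "e * c < a - phi u r" unfolding e_def using eps a by auto
    have em: "e * m > 0" using e m by simp
    obtain j where j: "u $ j > 0" using orthant_pos_component[OF u] by blast
    define I where "I = {i. u $ i = 0}"
    have jI: "j \<notin> I" using j by (simp add: I_def)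
    \<comment> \<open>\<open>z\<close> is so close to \<open>1\<close> that the part of the rotation
      loss proportional to the mass is at most \<open>e / 2\<close> in the limit. The other part has
      a large factor \<open>C\<close>, but \<open>C\<close> is fixed and multiplies a sum tending to
      \<open>0\<close>.\<close>
    define z where "z = exp (- (e / (2 * (real CARD('b) * m + 1))))"
    have dm: "real CARD('b) * m + 1 > 0" using m by (simp add: add_nonneg_pos)
    have z: "0 < z" "z < 1" unfolding z_def using e dm by simp_all
    define C where "C = real CARD('b) * ln (1 / (1 - z))"
    define H where "H k = (\<Sum>i\<in>I. U k $ i) * C + real (card I) * (mass (U k) * ln (1 / z))" for k
    define W where "W k = rotate_vec I j (U k)" for k
    define \<tau> where "\<tau> = real (card I) * (m * ln (1 / z))"
    have W: "W k \<in> orthant - {0}" for k unfolding W_def by (rule rotate_vec_orthant_nonzero[OF jI U])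
    have mW: "mass (W k) = mass (U k)" for k unfolding W_def by (rule mass_rotate_vec[OF jI])
    have lz: "ln (1 / z) = e / (2 * (real CARD('b) * m + 1))" by (simp add: z_def ln_div)
    have \<tau>: "0 \<le> \<tau>" "\<tau> \<le> e / 2"
    proof -
      show "0 \<le> \<tau>" unfolding \<tau>_def lz using m e dm by (intro mult_nonneg_nonneg) auto
      have "\<tau> \<le> real CARD('b) * (m * ln (1 / z))"
        unfolding \<tau>_def using m z by (intro mult_right_mono mult_nonneg_nonneg) (auto intro: card_mono)
      also have "\<dots> \<le> (real CARD('b) * m + 1) * ln (1 / z)" using z by (simp add: algebra_simps)
      also have "\<dots> = e / 2" unfolding lz using dm by (simp add: field_simps)
      finally show "\<tau> \<le> e / 2" .
    qed
    have sI: "(\<lambda>k. \<Sum>i\<in>I. U k $ i) \<longlonglongrightarrow> 0"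
    proof -
      have "(\<lambda>k. \<Sum>i\<in>I. U k $ i) \<longlonglongrightarrow> (\<Sum>i\<in>I. u $ i)" by (intro tendsto_sum comp)
      then show ?thesis by (simp add: I_def)
    qed
    have H: "H \<longlonglongrightarrow> \<tau>"
    proof -
      have "H \<longlonglongrightarrow> 0 * C + real (card I) * (m * ln (1 / z))"
        unfolding H_def by (intro tendsto_intros sI ms)
      then show ?thesis by (simp add: \<tau>_def)
    qed
    have "\<forall>\<^sub>F k in sequentially. (1 - e) * W k $ i \<le> u $ i" for i
    proof (cases "i \<in> I")
      case True
      then show ?thesis by (simp add: W_def rotate_vec_def I_def)
    next
      case False
      have "(\<lambda>k. W k $ i) \<longlonglongrightarrow> u $ i"
      proof (cases "i = j")
        case True
        have "(\<lambda>k. U k $ j + (\<Sum>i\<in>I. U k $ i)) \<longlonglongrightarrow> u $ j + 0" by (intro tendsto_add comp sI)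
        then show ?thesis using True jI by (simp add: W_def rotate_vec_def)
      next
        case n: False
        then show ?thesis using False comp[of i] by (simp add: W_def rotate_vec_def)
      qed
      then have l: "(\<lambda>k. (1 - e) * W k $ i) \<longlonglongrightarrow> (1 - e) * u $ i" by (rule tendsto_mult_left)
      have "u $ i > 0" using False un(1)[of i] by (simp add: I_def)
      then have "(1 - e) * u $ i < u $ i" using e by (simp add: algebra_simps)
      from order_tendstoD(2)[OF l this] show ?thesis by eventually_elim simp
    qed
    then have E1: "\<forall>\<^sub>F k in sequentially. \<forall>i. (1 - e) * W k $ i \<le> u $ i"
      by (rule eventually_all_finite)
    have l2: "(\<lambda>k. m - (1 - e) * mass (W k)) \<longlonglongrightarrow> m - (1 - e) * m" unfolding mW by (intro tendsto_intros ms)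
    have l2': "e * m / 2 < m - (1 - e) * m" "m - (1 - e) * m < 2 * e * m"
      using em by (simp_all add: algebra_simps)
    have l3: "(\<lambda>k. \<bar>r - (1 - e) * (R k - H k)\<bar>) \<longlonglongrightarrow> \<bar>r - (1 - e) * (r - \<tau>)\<bar>" by (intro tendsto_intros R H)
    have l3': "\<bar>r - (1 - e) * (r - \<tau>)\<bar> < e * (\<bar>r\<bar> + 2)"
    proof -
      have "r - (1 - e) * (r - \<tau>) = e * r + (1 - e) * \<tau>" by (simp add: algebra_simps)
      also have "\<bar>\<dots>\<bar> \<le> e * \<bar>r\<bar> + (1 - e) * \<tau>"
        using e \<tau> by (intro order_trans[OF abs_triangle_ineq]) (simp add: abs_mult)
      also have "(1 - e) * \<tau> \<le> 1 * \<tau>" using e \<tau> by (intro mult_right_mono) auto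
      finally show ?thesis using \<tau> e by (simp add: algebra_simps)
    qed
    have "\<tau> < e" using \<tau> e by simp
    with H have E4: "\<forall>\<^sub>F k in sequentially. H k < e" by (rule order_tendstoD(2))
    show "\<forall>\<^sub>F k in sequentially. phi (U k) (R k) < a"
      using E1 order_tendstoD(1)[OF l2 l2'(1)] order_tendstoD(2)[OF l2 l2'(2)] order_tendstoD(2)[OF l3 l3'] E4
    proof eventually_elim
      case (elim k)
      have "phi u r \<ge> phi (W k) (R k - H k) - (2 * e * m) * cost (2 * (e * (\<bar>r\<bar> + 2)) / (e * m / 2))"
        using elim em by (intro phi_perturb[OF W u e(1,2)]) (auto simp: m_def)
      moreover have "phi (U k) (R k) \<le> H k + phi (W k) (R k - H k)"
        unfolding H_def C_def W_def by (rule phi_rotate[OF U jI z])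
      ultimately show "phi (U k) (R k) < a" unfolding cost_eq[OF e(1)] using e elim by (simp add: algebra_simps)
    qed
  }
qed

lemma phi_continuous: "continuous_on ((orthant - {0}) \<times> UNIV) (\<lambda>(u, r). phi u r)"
proof (rule continuous_on_sequentiallyI)
  fix X :: "nat \<Rightarrow> (real ^ 'b) \<times> real" and a
  assume X: "\<forall>n. X n \<in> (orthant - {0}) \<times> UNIV" and a: "a \<in> (orthant - {0}) \<times> UNIV" and l: "X \<longlonglongrightarrow> a"
  have "(\<lambda>n. phi (fst (X n)) (snd (X n))) \<longlonglongrightarrow> phi (fst a) (snd a)"
    using X a by (intro phi_tendsto tendsto_fst tendsto_snd l) (auto simp: mem_Times_iff)
  then show "(\<lambda>n. case X n of (u, r) \<Rightarrow> phi u r) \<longlonglongrightarrow> (case a of (u, r) \<Rightarrow> phi u r)"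
    by (simp add: case_prod_unfold)
qed

lemma phi_concave: "convex_on ((orthant - {0}) \<times> UNIV) (\<lambda>(u, r). - phi u r)"
proof (rule convex_onI)
  fix t :: real and x y :: "(real ^ 'b) \<times> real"
  assume t: "0 < t" "t < 1" and x: "x \<in> (orthant - {0}) \<times> UNIV" and y: "y \<in> (orthant - {0}) \<times> UNIV"
  have "phi ((1 - t) *\<^sub>R fst x + t *\<^sub>R fst y) ((1 - t) * snd x + t * snd y)
      \<ge> (1 - t) * phi (fst x) (snd x) + t * phi (fst y) (snd y)"
    using x y t by (intro phi_cone) (auto simp: mem_Times_iff)
  then show "(case (1 - t) *\<^sub>R x + t *\<^sub>R y of (u, r) \<Rightarrow> - phi u r)
      \<le> (1 - t) * (case x of (u, r) \<Rightarrow> - phi u r) + t * (case y of (u, r) \<Rightarrow> - phi u r)"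
    by (simp add: case_prod_unfold)
next
  show "convex ((orthant - {0 :: real ^ 'b}) \<times> (UNIV :: real set))"
  proof (rule convex_Times)
    show "convex (orthant - {0 :: real ^ 'b})"
      unfolding convex_alt
    proof safe
      fix x y :: "real ^ 'b" and t :: real
      assume *: "x \<in> orthant" "y \<in> orthant" "x \<noteq> 0" "y \<noteq> 0" "0 \<le> t" "t \<le> 1"
      have "(1 - t) *\<^sub>R x + t *\<^sub>R y \<in> orthant - {0}"
      proof (cases "t = 0 \<or> t = 1")
        case False
        then show ?thesis using * by (intro orthant_cone) auto
      qed (use * in auto)
      then show "(1 - t) *\<^sub>R x + t *\<^sub>R y \<in> orthant" "(1 - t) *\<^sub>R x + t *\<^sub>R y = 0 \<Longrightarrow> False" by auto
    qed
  qed simp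
qed

end

section \<open>Concentration\<close>

lemma exp_mult_le_affine:
  fixes p x :: real
  assumes "0 \<le> p" "p \<le> 1"
  shows "exp (p * x) \<le> 1 - p + p * exp x"
proof -
  have 1: "exp x \<ge> exp (p * x) * (1 + (x - p * x))"
    using exp_ge_add_one_self[of "x - p * x"]
    by (simp add: exp_diff field_simps)
  have 2: "1 \<ge> exp (p * x) * (1 + (0 - p * x))"
    using exp_ge_add_one_self[of "0 - p * x"] by (simp add: exp_minus field_simps)
  have "exp (p * x) = p * (exp (p * x) * (1 + (x - p * x))) + (1 - p) * (exp (p * x) * (1 + (0 - p * x)))"
    by (simp add: algebra_simps)
  also have "\<dots> \<le> p * exp x + (1 - p) * 1"
    using 1 2 assms by (intro add_mono mult_left_mono) auto
  finally show ?thesis by simp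
qed

lemma exp_le_quadratic: "exp y \<le> 1 + y + y\<^sup>2 * exp \<bar>y\<bar>" for y :: real
proof -
  have "exp y * (1 - y) \<le> exp y * exp (- y)"
    using exp_ge_add_one_self[of "- y"] by (intro mult_left_mono) auto
  then have 1: "exp y - 1 - y \<le> y * (exp y - 1)" by (simp add: exp_minus algebra_simps)
  have "y * (exp y - 1) \<le> y * (y * exp \<bar>y\<bar>)"
  proof (cases "y \<ge> 0")
    case True
    have "exp y * (1 - y) \<le> 1" using \<open>exp y * (1 - y) \<le> exp y * exp (- y)\<close> by (simp add: exp_minus)
    then have "exp y - 1 \<le> y * exp y" by (simp add: algebra_simps)
    then show ?thesis using True by (intro mult_left_mono) auto
  next
    case False
    have "exp y - 1 \<ge> y" using exp_ge_add_one_self[of y] by linarith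
    then have "y * (exp y - 1) \<le> y * y" using False by (intro mult_left_mono_neg) auto
    also have "\<dots> \<le> (y * y) * exp \<bar>y\<bar>" using mult_left_mono[of 1 "exp \<bar>y\<bar>" "y * y"] by simp
    finally show ?thesis by (simp add: mult.assoc)
  qed
  then show ?thesis using 1 by (simp add: power2_eq_square)
qed

context
  fixes p :: real
  assumes p: "0 \<le> p" "p \<le> 1"
begin

text \<open>Up to the factor \<open>a + b\<close>, the one-site dependence
  \<open>a + b * exp x\<close> is \<open>1 - p + p * exp x\<close> with
  \<open>p = b / (a + b)\<close>. Its logarithm is studied here with bounds uniform in
  \<open>p\<close>.\<close>

lemma mix_pos: "1 - p + p * exp x > (0 :: real)"
  using exp_mult_le_affine[OF p, of x] exp_gt_zero[of "p * x"] by linarith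

lemma ln_mix_ge: "p * x \<le> ln (1 - p + p * exp x)"
  using exp_mult_le_affine[OF p, of x] mix_pos[of x] by (simp add: ln_ge_iff)

lemma abs_ln_mix_le: "\<bar>ln (1 - p + p * exp x)\<bar> \<le> \<bar>x\<bar>"
proof (cases "x \<ge> 0")
  case True
  have "1 - p \<le> (1 - p) * exp x" using p True mult_left_mono[of 1 "exp x" "1 - p"] by simp
  then have "1 - p + p * exp x \<le> exp x" by (simp add: algebra_simps)
  then have "ln (1 - p + p * exp x) \<le> x" using mix_pos[of x] by (metis exp_gt_zero ln_exp ln_le_cancel_iff)
  moreover have "ln (1 - p + p * exp x) \<ge> 0"
    using ln_mix_ge[of x] p True by (meson mult_nonneg_nonneg order_trans)
  ultimately show ?thesis by simp
next
  case False
  have "p * exp x \<le> p * 1" using False p by (intro mult_left_mono) auto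
  then have "ln (1 - p + p * exp x) \<le> 0" using mix_pos[of x] by (subst ln_le_zero_iff) auto
  moreover have "p * x \<ge> x" using False p mult_right_mono_neg[of p 1 x] by simp
  ultimately show ?thesis using False ln_mix_ge[of x] by linarith
qed

text \<open>The tilted probability \<open>q\<close> controls the square of the logarithm for positive \<open>x\<close>; for negative
  \<open>x\<close> the bound \<open>p * x \<le> ln _ \<le> 0\<close> has to be used instead, as \<open>q\<close> may be much smaller than \<open>p\<close>.\<close>

lemma ln_mix_sq_le:
  "(ln (1 - p + p * exp x))\<^sup>2 \<le> (p * exp x / (1 - p + p * exp x) + p) * (1 + \<bar>x\<bar>)\<^sup>2"
proof (cases "x \<ge> 0")
  case True
  define s where "s = p * (exp x - 1)"
  define X where "X = ln (1 - p + p * exp x)"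
  define q where "q = p * exp x / (1 - p + p * exp x)"
  have s: "s \<ge> 0" using p True by (simp add: s_def)
  have mix: "1 - p + p * exp x = 1 + s" by (simp add: s_def algebra_simps)
  have X0: "X \<ge> 0" unfolding X_def mix using s by simp
  have Xs: "X \<le> s" unfolding X_def mix using s by (intro ln_add_one_self_le_self)
  have Xx: "X \<le> x" using abs_ln_mix_le[of x] True unfolding X_def by simp
  have qs: "q \<ge> s / (1 + s)" unfolding q_def mix using p s by (intro divide_right_mono) (auto simp: s_def algebra_simps)
  \<comment> \<open>Equivalent to \<open>X \<le> s\<close>; in this form the bound carries the
    factor \<open>s / (1 + s)\<close>, which the tilted probability dominates.\<close>
  have "X \<le> s / (1 + s) * (1 + X)" using s Xs by (simp add: field_simps)
  also have "\<dots> \<le> q * (1 + X)" using qs X0 by (intro mult_right_mono) auto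
  also have "\<dots> \<le> q * (1 + x)" using Xx qs s by (intro mult_left_mono) (auto intro: order_trans[OF _ qs])
  finally have 1: "X \<le> q * (1 + x)" .
  have q0: "q \<ge> 0" using qs s by (meson divide_nonneg_nonneg add_nonneg_nonneg order_trans zero_le_one)
  have "X\<^sup>2 \<le> (q * (1 + x)) * (1 + x)"
    unfolding power2_eq_square using 1 Xx X0 True q0 by (intro mult_mono) auto
  also have "\<dots> = q * (1 + \<bar>x\<bar>)\<^sup>2" using True by (simp add: power2_eq_square)
  also have "\<dots> \<le> (q + p) * (1 + \<bar>x\<bar>)\<^sup>2" using p by (intro mult_right_mono) auto
  finally show ?thesis unfolding X_def q_def .
next
  case False
  define X where "X = ln (1 - p + p * exp x)"
  have q: "p * exp x / (1 - p + p * exp x) \<ge> 0" using p mix_pos[of x] by simp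
  have "p * exp x \<le> p * 1" using False p by (intro mult_left_mono) auto
  then have "X \<le> 0" unfolding X_def using mix_pos[of x] by (subst ln_le_zero_iff) auto
  moreover have "X \<ge> p * x" unfolding X_def by (rule ln_mix_ge)
  ultimately have "\<bar>X\<bar> \<le> p * \<bar>x\<bar>" using False by simp
  then have "\<bar>X\<bar>\<^sup>2 \<le> (p * \<bar>x\<bar>)\<^sup>2" by (intro power_mono) auto
  also have "\<dots> = p * (p * \<bar>x\<bar>\<^sup>2)" by (simp add: power2_eq_square)
  also have "\<dots> \<le> p * (1 * (1 + \<bar>x\<bar>)\<^sup>2)"
    using p by (intro mult_left_mono mult_mono power_mono) auto
  also have "\<dots> \<le> (p * exp x / (1 - p + p * exp x) + p) * (1 + \<bar>x\<bar>)\<^sup>2"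
    using q by (simp only: mult_1) (intro mult_right_mono, auto)
  finally show ?thesis by (simp add: X_def)
qed

text \<open>A convex function lies above its tangent, and the quotient is the derivative at
  \<open>x\<close>. Factoring out the value at \<open>x\<close> leaves a mixture with parameter
  \<open>q\<close>, to which convexity of \<open>exp\<close> applies.\<close>

lemma ln_mix_shift:
  "ln (1 - p + p * exp (x + y)) \<ge> ln (1 - p + p * exp x) + p * exp x / (1 - p + p * exp x) * y"
proof -
  define q where "q = p * exp x / (1 - p + p * exp x)"
  have q: "0 \<le> q" "q \<le> 1" unfolding q_def using p mix_pos[of x] by (auto simp: divide_le_eq)
  have m: "1 - p + p * exp x \<noteq> 0" using mix_pos[of x] by simp
  have e: "1 - p + p * exp (x + y) = (1 - p + p * exp x) * (1 - q + q * exp y)"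
  proof -
    define m where "m = 1 - p + p * exp x"
    have "m * q = p * exp x" using mix_pos[of x] by (simp add: q_def m_def)
    moreover have "m * (1 - q + q * exp y) = m - m * q + (m * q) * exp y" by (simp add: algebra_simps)
    ultimately show ?thesis by (simp add: m_def exp_add)
  qed
  have pos: "1 - q + q * exp y > 0" using exp_mult_le_affine[OF q, of y] exp_gt_zero[of "q * y"] by linarith
  have "ln (1 - q + q * exp y) \<ge> q * y"
    using exp_mult_le_affine[OF q, of y] pos by (simp add: ln_ge_iff)
  then show ?thesis unfolding e using m pos mix_pos[of x] by (simp add: ln_mult q_def)
qed

text \<open>The tilted probability is at least \<open>p\<close> times a fixed positive function, so
  an error proportional to \<open>p\<close> can be charged to its integral.\<close>

lemma tilted_ge: "p * exp x / (1 - p + p * exp x) \<ge> p * min 1 (exp x)"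
proof (cases "x \<ge> 0")
  case True
  have "1 - p \<le> (1 - p) * exp x" using p True mult_left_mono[of 1 "exp x" "1 - p"] by simp
  then have "1 - p + p * exp x \<le> exp x" by (simp add: algebra_simps)
  then have "p * (1 - p + p * exp x) \<le> p * exp x" using p by (intro mult_left_mono) auto
  then show ?thesis using True mix_pos[of x] by (simp add: pos_le_divide_eq)
next
  case False
  have "p * exp x \<le> p * 1" using False p by (intro mult_left_mono) auto
  then have "(p * exp x) * (1 - p + p * exp x) \<le> (p * exp x) * 1" using p by (intro mult_left_mono) auto
  then show ?thesis using False mix_pos[of x] by (simp add: pos_le_divide_eq)
qed

end

text \<open>Jensen's inequality for \<open>exp\<close>; with the extended integral it also covers
  the case where \<open>exp\<close> of \<open>f\<close> is not integrable.\<close>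

lemma (in prob_space) exp_integral_le:
  fixes f :: "'a \<Rightarrow> real"
  assumes f: "integrable M f"
  shows "ennreal (exp (integral\<^sup>L M f)) \<le> (\<integral>\<^sup>+x. ennreal (exp (f x)) \<partial>M)"
proof (cases "integrable M (\<lambda>x. exp (f x))")
  case True
  define m where "m = integral\<^sup>L M f"
  have "exp m = (\<integral>x. exp m * (1 + (f x - m)) \<partial>M)"
    using f by (simp add: m_def prob_space)
  also have "\<dots> \<le> (\<integral>x. exp (f x) \<partial>M)"
  proof (rule integral_mono[OF _ True])
    show "integrable M (\<lambda>x. exp m * (1 + (f x - m)))" using f by simp
    show "exp m * (1 + (f x - m)) \<le> exp (f x)" for x
    proof -
      have "exp m * (1 + (f x - m)) \<le> exp m * exp (f x - m)"
        by (intro mult_left_mono exp_ge_add_one_self) auto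
      then show ?thesis by (simp add: exp_add[symmetric])
    qed
  qed
  finally show ?thesis unfolding m_def using True by (subst nn_integral_eq_integral) auto
next
  case False
  have m: "(\<lambda>x. exp (f x)) \<in> borel_measurable M" using f by simp
  have "(\<integral>\<^sup>+x. ennreal (exp (f x)) \<partial>M) = \<infinity>"
  proof (rule ccontr)
    assume "\<not> ?thesis"
    then have "(\<integral>\<^sup>+x. ennreal (exp (f x)) \<partial>M) < \<infinity>" by (simp add: less_top)
    then have "integrable M (\<lambda>x. exp (f x))" by (intro integrableI_nonneg m) auto
    then show False using False by blast
  qed
  then show ?thesis by simp
qed

text \<open>The weight of a single site enters the partition function as \<open>a + b * exp x\<close>. Increasing it
  by an amount of order \<open>t\<close> compensates the loss in Jensen's inequality.\<close>

lemma one_site_inequality: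
  fixes \<nu> :: "real measure"
  assumes \<nu>: "prob_space \<nu>" and sets [measurable_cong]: "sets \<nu> = sets borel"
    and s: "s > 0" and int: "integrable \<nu> (\<lambda>x. exp (s * \<bar>x\<bar>))"
  shows "\<exists>C\<ge>0. \<forall>t a b. 0 < t \<longrightarrow> t \<le> s / 2 \<longrightarrow> a \<ge> 0 \<longrightarrow> b \<ge> 0 \<longrightarrow> a + b > 0 \<longrightarrow>
    (\<integral>\<^sup>+x. ennreal (exp (t * ln (a + b * exp x))) \<partial>\<nu>)
      \<le> ennreal (exp (t * (\<integral>x. ln (a + b * exp (x + t * C * exp (s * \<bar>x\<bar>))) \<partial>\<nu>)))"
proof -
  interpret prob_space \<nu> by fact
  \<comment> \<open>\<open>D\<close> is the price of replacing
    \<open>(1 + \<bar>x\<bar>)\<^sup>2\<close> by \<open>exp (s / 2 * \<bar>x\<bar>)\<close>. The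
    other half of \<open>s\<close> absorbs \<open>exp (t * \<bar>x\<bar>)\<close>, hence the
    restriction \<open>t \<le> s / 2\<close>.\<close>
  define D where "D = (max 1 (4 / s))\<^sup>2"
  define \<kappa> where "\<kappa> = (\<integral>x. min 1 (exp x) \<partial>\<nu>)"
  define H where "H = (\<integral>x. exp (s * \<bar>x\<bar>) \<partial>\<nu>)"
  \<comment> \<open>One summand for each part of \<open>ln_mix_sq_le\<close>: the part with
    \<open>q\<close> is bounded directly, the part with \<open>p\<close> is charged to
    \<open>q\<close> through \<open>tilted_ge\<close>, which brings in
    \<open>\<kappa>\<close>.\<close>
  define C where "C = D + D * H / \<kappa>"
  have imin: "integrable \<nu> (\<lambda>x. min 1 (exp x))"
    by (rule integrable_const_bound[where B = 1]) auto
  have \<kappa>: "\<kappa> > 0"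
  proof -
    have "\<kappa> \<ge> 0" unfolding \<kappa>_def by (intro integral_nonneg_AE) auto
    moreover have "\<kappa> \<noteq> 0"
    proof
      assume "\<kappa> = 0"
      then have "AE x in \<nu>. min 1 (exp x) = 0"
        unfolding \<kappa>_def using imin by (subst (asm) integral_nonneg_eq_0_iff_AE) auto
      then have "AE x in \<nu>. False" by eventually_elim (auto simp: min_def split: if_splits)
      then show False using AE_False by simp
    qed
    ultimately show ?thesis by simp
  qed
  have D1: "D \<ge> 1" unfolding D_def by simp
  have H0: "H \<ge> 0" unfolding H_def by (intro integral_nonneg_AE) auto
  have C0: "C \<ge> 0" unfolding C_def using \<kappa> D1 H0 by (intro add_nonneg_nonneg divide_nonneg_nonneg mult_nonneg_nonneg) auto
  have DE: "(1 + \<bar>x\<bar>)\<^sup>2 * exp (t * \<bar>x\<bar>) \<le> D * exp (s * \<bar>x\<bar>)" if "t \<le> s / 2" for t x :: real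
  proof -
    have "1 + \<bar>x\<bar> \<le> max 1 (4 / s) * (1 + s / 4 * \<bar>x\<bar>)"
    proof -
      have "\<bar>x\<bar> = (4 / s) * (s / 4 * \<bar>x\<bar>)" using s by simp
      also have "\<dots> \<le> max 1 (4 / s) * (s / 4 * \<bar>x\<bar>)" using s by (intro mult_right_mono) auto
      moreover have "max 1 (4 / s) \<ge> 1" by simp
      ultimately show ?thesis unfolding distrib_left by linarith
    qed
    also have "\<dots> \<le> max 1 (4 / s) * exp (s / 4 * \<bar>x\<bar>)"
      by (intro mult_left_mono exp_ge_add_one_self) auto
    finally have "(1 + \<bar>x\<bar>)\<^sup>2 \<le> (max 1 (4 / s) * exp (s / 4 * \<bar>x\<bar>))\<^sup>2" by (intro power_mono) auto
    also have "\<dots> = D * exp (s / 2 * \<bar>x\<bar>)"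
      by (simp add: D_def power_mult_distrib exp_double[symmetric])
    finally have "(1 + \<bar>x\<bar>)\<^sup>2 \<le> D * exp (s / 2 * \<bar>x\<bar>)" .
    moreover have "t * \<bar>x\<bar> \<le> s / 2 * \<bar>x\<bar>" using that by (rule mult_right_mono) simp
    ultimately have "(1 + \<bar>x\<bar>)\<^sup>2 * exp (t * \<bar>x\<bar>) \<le> (D * exp (s / 2 * \<bar>x\<bar>)) * exp (s / 2 * \<bar>x\<bar>)"
      using D1 by (intro mult_mono) simp_all
    also have "\<dots> = D * exp (s * \<bar>x\<bar>)" by (simp add: exp_add[symmetric])
    finally show ?thesis .
  qed
  have iabs: "integrable \<nu> (\<lambda>x. \<bar>x\<bar>)"
  proof (rule Bochner_Integration.integrable_bound)
    show "integrable \<nu> (\<lambda>x. (1 / s) * exp (s * \<bar>x\<bar>))" using int by simp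
    show "AE x in \<nu>. norm \<bar>x\<bar> \<le> norm ((1 / s) * exp (s * \<bar>x\<bar>))"
    proof (rule AE_I2)
      fix x
      have "s * \<bar>x\<bar> \<le> exp (s * \<bar>x\<bar>)" using exp_ge_add_one_self[of "s * \<bar>x\<bar>"] by linarith
      then show "norm \<bar>x\<bar> \<le> norm ((1 / s) * exp (s * \<bar>x\<bar>))" using s by (simp add: field_simps)
    qed
  qed simp
  have main: "(\<integral>\<^sup>+x. ennreal (exp (t * ln (a + b * exp x))) \<partial>\<nu>)
      \<le> ennreal (exp (t * (\<integral>x. ln (a + b * exp (x + t * C * exp (s * \<bar>x\<bar>))) \<partial>\<nu>)))"
    if t: "0 < t" "t \<le> s / 2" and ab: "a \<ge> 0" "b \<ge> 0" "a + b > 0" for t a b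
  proof -
    define p where "p = b / (a + b)"
    have p: "0 \<le> p" "p \<le> 1" using ab by (auto simp: p_def)
    define q where "q x = p * exp x / (1 - p + p * exp x)" for x
    define X where "X x = ln (1 - p + p * exp x)" for x
    define th where "th x = t * C * exp (s * \<bar>x\<bar>)" for x
    have dec: "ln (a + b * exp x) = ln (a + b) + X x" for x
    proof -
      have "(a + b) * p = b" using ab by (simp add: p_def)
      moreover have "(a + b) * (1 - p + p * exp x) = (a + b) - (a + b) * p + ((a + b) * p) * exp x"
        by (simp add: algebra_simps)
      ultimately have "a + b * exp x = (a + b) * (1 - p + p * exp x)" by simp
      then show ?thesis unfolding X_def using ab mix_pos[OF p, of x] by (simp add: ln_mult)
    qed
    have [measurable]: "X \<in> borel_measurable borel" "q \<in> borel_measurable borel" "th \<in> borel_measurable borel"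
      unfolding X_def q_def th_def by measurable
    have Xx: "\<bar>X x\<bar> \<le> \<bar>x\<bar>" for x unfolding X_def by (rule abs_ln_mix_le[OF p])
    have q01: "0 \<le> q x" "q x \<le> 1" for x
      unfolding q_def using p mix_pos[OF p, of x] by (auto simp: divide_le_eq)
    have iq: "integrable \<nu> (\<lambda>x. q x * exp (s * \<bar>x\<bar>))"
      by (rule Bochner_Integration.integrable_bound[OF int]) (use q01 in \<open>auto simp: abs_mult intro!: mult_left_le_one_le\<close>)
    have iq': "integrable \<nu> q"
      by (rule integrable_const_bound[where B = 1]) (use q01 in auto)
    have iX: "integrable \<nu> X"
      by (rule Bochner_Integration.integrable_bound[OF iabs]) (use Xx in auto)
    have ith: "integrable \<nu> th" unfolding th_def using int by simp
    have sq: "(X x)\<^sup>2 * exp (t * \<bar>x\<bar>) \<le> D * (q x * exp (s * \<bar>x\<bar>)) + p * D * exp (s * \<bar>x\<bar>)" for x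
    proof -
      have "(X x)\<^sup>2 * exp (t * \<bar>x\<bar>) \<le> ((q x + p) * (1 + \<bar>x\<bar>)\<^sup>2) * exp (t * \<bar>x\<bar>)"
        unfolding X_def q_def by (intro mult_right_mono ln_mix_sq_le[OF p]) auto
      also have "\<dots> = (q x + p) * ((1 + \<bar>x\<bar>)\<^sup>2 * exp (t * \<bar>x\<bar>))" by (simp add: mult.assoc)
      also have "\<dots> \<le> (q x + p) * (D * exp (s * \<bar>x\<bar>))" using q01 p DE[OF t(2)] by (intro mult_left_mono) auto
      finally show ?thesis by (simp add: algebra_simps)
    qed
    have isq: "integrable \<nu> (\<lambda>x. (X x)\<^sup>2 * exp (t * \<bar>x\<bar>))"
    proof (rule Bochner_Integration.integrable_bound)
      show "integrable \<nu> (\<lambda>x. D * (q x * exp (s * \<bar>x\<bar>)) + p * D * exp (s * \<bar>x\<bar>))" using iq int by simp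
      show "AE x in \<nu>. norm ((X x)\<^sup>2 * exp (t * \<bar>x\<bar>)) \<le> norm (D * (q x * exp (s * \<bar>x\<bar>)) + p * D * exp (s * \<bar>x\<bar>))"
        using sq by (auto simp: abs_mult intro: order_trans[OF _ abs_ge_self])
    qed measurable
    have sqint: "(\<integral>x. (X x)\<^sup>2 * exp (t * \<bar>x\<bar>) \<partial>\<nu>) \<le> C * (\<integral>x. q x * exp (s * \<bar>x\<bar>) \<partial>\<nu>)"
    proof -
      have "(\<integral>x. (X x)\<^sup>2 * exp (t * \<bar>x\<bar>) \<partial>\<nu>) \<le> (\<integral>x. D * (q x * exp (s * \<bar>x\<bar>)) + p * D * exp (s * \<bar>x\<bar>) \<partial>\<nu>)"
        using isq iq int sq by (intro integral_mono) auto
      also have "\<dots> = D * (\<integral>x. q x * exp (s * \<bar>x\<bar>) \<partial>\<nu>) + p * D * H"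
        using iq int by (simp add: H_def)
      also have "p * D * H \<le> D * H / \<kappa> * (\<integral>x. q x * exp (s * \<bar>x\<bar>) \<partial>\<nu>)"
      proof -
        have "p * \<kappa> = (\<integral>x. p * min 1 (exp x) \<partial>\<nu>)" by (simp add: \<kappa>_def)
        also have "\<dots> \<le> (\<integral>x. q x * exp (s * \<bar>x\<bar>) \<partial>\<nu>)"
        proof (rule integral_mono)
          show "integrable \<nu> (\<lambda>x. p * min 1 (exp x))" using imin by simp
          show "p * min 1 (exp x) \<le> q x * exp (s * \<bar>x\<bar>)" for x
          proof -
            have "p * min 1 (exp x) \<le> q x" unfolding q_def by (rule tilted_ge[OF p])
            also have "\<dots> \<le> q x * exp (s * \<bar>x\<bar>)" using q01 s mult_left_mono[of 1 "exp (s * \<bar>x\<bar>)" "q x"] by simp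
            finally show ?thesis .
          qed
        qed (rule iq)
        finally have "p * \<kappa> \<le> (\<integral>x. q x * exp (s * \<bar>x\<bar>) \<partial>\<nu>)" .
        then have "D * H / \<kappa> * (p * \<kappa>) \<le> D * H / \<kappa> * (\<integral>x. q x * exp (s * \<bar>x\<bar>) \<partial>\<nu>)"
          using \<kappa> D1 H0 by (intro mult_left_mono divide_nonneg_nonneg mult_nonneg_nonneg) auto
        then show ?thesis using \<kappa> by (simp add: mult_ac)
      qed
      finally show ?thesis by (simp add: C_def algebra_simps)
    qed
    have iX': "integrable \<nu> (\<lambda>x. X (x + th x))"
    proof (rule Bochner_Integration.integrable_bound)
      show "integrable \<nu> (\<lambda>x. \<bar>x\<bar> + \<bar>th x\<bar>)" using iabs ith by simp
      show "AE x in \<nu>. norm (X (x + th x)) \<le> norm (\<bar>x\<bar> + \<bar>th x\<bar>)"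
        using Xx by (auto intro!: AE_I2 intro: order_trans[OF _ abs_triangle_ineq])
    qed measurable
    \<comment> \<open>By the tangent inequality, raising \<open>x\<close> by \<open>th x\<close>
      increases the mean of \<open>X\<close> by at least \<open>t\<close> times the bound in
      \<open>sqint\<close>; this is what pays for the second-order term of the exponential.\<close>
    have gain: "t * (C * (\<integral>x. q x * exp (s * \<bar>x\<bar>) \<partial>\<nu>)) \<le> (\<integral>x. X (x + th x) \<partial>\<nu>) - (\<integral>x. X x \<partial>\<nu>)"
    proof -
      have "t * (C * (\<integral>x. q x * exp (s * \<bar>x\<bar>) \<partial>\<nu>)) = (\<integral>x. t * (C * (q x * exp (s * \<bar>x\<bar>))) \<partial>\<nu>)" by simp
      also have "\<dots> \<le> (\<integral>x. X (x + th x) - X x \<partial>\<nu>)"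
      proof (rule integral_mono)
        show "t * (C * (q x * exp (s * \<bar>x\<bar>))) \<le> X (x + th x) - X x" for x
          using ln_mix_shift[OF p, of x "th x"] by (simp add: X_def q_def th_def mult_ac)
      qed (use iq iX iX' in auto)
      also have "\<dots> = (\<integral>x. X (x + th x) \<partial>\<nu>) - (\<integral>x. X x \<partial>\<nu>)" using iX iX' by simp
      finally show ?thesis .
    qed
    let ?f = "\<lambda>x. 1 + t * X x + t\<^sup>2 * ((X x)\<^sup>2 * exp (t * \<bar>x\<bar>))"
    have fge: "exp (t * X x) \<le> ?f x" for x
    proof -
      have "exp (t * X x) \<le> 1 + t * X x + (t * X x)\<^sup>2 * exp \<bar>t * X x\<bar>" by (rule exp_le_quadratic)
      also have "(t * X x)\<^sup>2 * exp \<bar>t * X x\<bar> \<le> (t * X x)\<^sup>2 * exp (t * \<bar>x\<bar>)"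
        using Xx t by (intro mult_left_mono) (auto simp: abs_mult intro!: mult_left_mono)
      finally show ?thesis by (simp add: power_mult_distrib mult.assoc)
    qed
    have "(\<integral>\<^sup>+x. ennreal (exp (t * X x)) \<partial>\<nu>) \<le> (\<integral>\<^sup>+x. ennreal (?f x) \<partial>\<nu>)"
      using fge by (intro nn_integral_mono ennreal_leI)
    also have "\<dots> = ennreal (\<integral>x. ?f x \<partial>\<nu>)"
      using iX isq fge by (intro nn_integral_eq_integral) (auto intro!: AE_I2 intro: order_trans[OF less_imp_le[OF exp_gt_zero]])
    also have "\<dots> = ennreal (1 + (t * (\<integral>x. X x \<partial>\<nu>) + t\<^sup>2 * (\<integral>x. (X x)\<^sup>2 * exp (t * \<bar>x\<bar>) \<partial>\<nu>)))"
      using iX isq by (simp add: prob_space add.assoc)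
    also have "\<dots> \<le> ennreal (exp (t * (\<integral>x. X (x + th x) \<partial>\<nu>)))"
    proof (rule ennreal_leI)
      have "t * (\<integral>x. X x \<partial>\<nu>) + t\<^sup>2 * (\<integral>x. (X x)\<^sup>2 * exp (t * \<bar>x\<bar>) \<partial>\<nu>)
          = t * ((\<integral>x. X x \<partial>\<nu>) + t * (\<integral>x. (X x)\<^sup>2 * exp (t * \<bar>x\<bar>) \<partial>\<nu>))"
        by (simp add: algebra_simps power2_eq_square)
      also have "\<dots> \<le> t * (\<integral>x. X (x + th x) \<partial>\<nu>)"
      proof (rule mult_left_mono)
        have "t * (\<integral>x. (X x)\<^sup>2 * exp (t * \<bar>x\<bar>) \<partial>\<nu>) \<le> t * (C * (\<integral>x. q x * exp (s * \<bar>x\<bar>) \<partial>\<nu>))"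
          using t by (intro mult_left_mono[OF sqint]) auto
        then show "(\<integral>x. X x \<partial>\<nu>) + t * (\<integral>x. (X x)\<^sup>2 * exp (t * \<bar>x\<bar>) \<partial>\<nu>) \<le> (\<integral>x. X (x + th x) \<partial>\<nu>)"
          using gain by linarith
      qed (use t in simp)
      finally show "1 + (t * (\<integral>x. X x \<partial>\<nu>) + t\<^sup>2 * (\<integral>x. (X x)\<^sup>2 * exp (t * \<bar>x\<bar>) \<partial>\<nu>))
          \<le> exp (t * (\<integral>x. X (x + th x) \<partial>\<nu>))"
        by (meson exp_ge_add_one_self exp_le_cancel_iff order_trans)
    qed
    finally have le: "(\<integral>\<^sup>+x. ennreal (exp (t * X x)) \<partial>\<nu>) \<le> ennreal (exp (t * (\<integral>x. X (x + th x) \<partial>\<nu>)))" .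
    have "(\<integral>\<^sup>+x. ennreal (exp (t * ln (a + b * exp x))) \<partial>\<nu>)
        = (\<integral>\<^sup>+x. ennreal (exp (t * ln (a + b))) * ennreal (exp (t * X x)) \<partial>\<nu>)"
      by (simp add: dec distrib_left exp_add ennreal_mult)
    also have "\<dots> = ennreal (exp (t * ln (a + b))) * (\<integral>\<^sup>+x. ennreal (exp (t * X x)) \<partial>\<nu>)"
      by (rule nn_integral_cmult) measurable
    also have "\<dots> \<le> ennreal (exp (t * ln (a + b))) * ennreal (exp (t * (\<integral>x. X (x + th x) \<partial>\<nu>)))"
      using le by (intro mult_left_mono) auto
    also have "\<dots> = ennreal (exp (t * (\<integral>x. ln (a + b * exp (x + th x)) \<partial>\<nu>)))"
    proof -
      have "(\<integral>x. ln (a + b * exp (x + th x)) \<partial>\<nu>) = ln (a + b) + (\<integral>x. X (x + th x) \<partial>\<nu>)"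
        unfolding dec using iX' by (simp add: prob_space)
      then show ?thesis by (simp add: ennreal_mult[symmetric] exp_add[symmetric] distrib_left)
    qed
    finally show ?thesis by (simp add: th_def)
  qed
  then show ?thesis using C0 by blast
qed

text \<open>The sites of \<open>S\<close> are the integration variables, all others stay frozen at
  \<open>w\<close>. A full field is produced because \<open>F\<close> is a function of full
  fields.\<close>

definition override_field :: "'i set \<Rightarrow> ('i \<Rightarrow> real) \<Rightarrow> ('i \<Rightarrow> real) \<Rightarrow> 'i \<Rightarrow> real" where
  "override_field S w x v = (if v \<in> S then x v else w v)"

lemma measurable_override_field [measurable]:
  "override_field S w \<in> measurable (PiM S (\<lambda>_. borel)) (PiM UNIV (\<lambda>_. borel))"
proof (rule measurable_PiM_single')
  show "(\<lambda>x. override_field S w x v) \<in> borel_measurable (PiM S (\<lambda>_. borel))" for v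
    by (cases "v \<in> S") (simp_all add: override_field_def)
qed auto

text \<open>The one-site inequality is iterated over the sites; the convexity of \<open>f \<mapsto> ln \<integral> exp f\<close> allows
  the expectation over the sites treated before to be pulled out.\<close>

lemma tensorise_exponential_bound:
  fixes \<nu> :: "real measure" and F :: "('i \<Rightarrow> real) \<Rightarrow> real"
  assumes \<nu>: "prob_space \<nu>" and sets: "sets \<nu> = sets borel"
    and F [measurable]: "F \<in> borel_measurable (PiM UNIV (\<lambda>_. borel))"
    and B: "finite B" and growth: "\<And>w. \<bar>F w\<bar> \<le> c0 + (\<Sum>v\<in>B. \<bar>w v\<bar>)"
    and iabs: "integrable \<nu> (\<lambda>x. \<bar>x\<bar>)" and ig: "integrable \<nu> g" and t: "t > 0"
    and site: "\<And>w v. (\<integral>\<^sup>+y. ennreal (exp (t * F (w(v := y)))) \<partial>\<nu>)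
      \<le> ennreal (exp (t * (\<integral>y. F (w(v := g y)) \<partial>\<nu>)))"
    and S: "finite S"
  shows "(\<integral>\<^sup>+x. ennreal (exp (t * F (override_field S w x))) \<partial>PiM S (\<lambda>_. \<nu>))
    \<le> ennreal (exp (t * (\<integral>x. F (override_field S w (\<lambda>v. g (x v))) \<partial>PiM S (\<lambda>_. \<nu>))))"
  using S
proof (induction S arbitrary: w rule: finite_induct)
  case empty
  interpret P: product_sigma_finite "\<lambda>_::'i. \<nu>"
    using \<nu> by (simp add: product_sigma_finite_def prob_space_imp_sigma_finite)
  have "override_field {} w x = w" for x :: "'i \<Rightarrow> real" by (simp add: override_field_def fun_eq_iff)
  then show ?case by (simp add: PiM_empty)
next
  case (insert a S)
  interpret N: prob_space \<nu> by fact
  interpret P: product_sigma_finite "\<lambda>_::'i. \<nu>"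
    by standard
  note [measurable_cong] = sets
  have sPi [measurable_cong]: "sets (PiM S (\<lambda>_. \<nu>)) = sets (PiM S (\<lambda>_. borel))" for S :: "'i set"
    by (rule sets_PiM_cong) (simp_all add: sets)
  have gm [measurable]: "g \<in> borel_measurable borel" using ig by (simp add: measurable_cong_sets[OF sets])
  let ?M = "PiM S (\<lambda>_. \<nu>)"
  interpret Q: prob_space ?M using \<nu> by (intro prob_space_PiM) auto
  \<comment> \<open>The sites of \<open>S\<close> already carry the raised weights, the new site
    \<open>a\<close> still the original value \<open>y\<close>.\<close>
  define G where "G x y = F (override_field S (w(a := y)) (\<lambda>v. g (x v)))" for x :: "'i \<Rightarrow> real" and y :: real
  have ogm: "(\<lambda>p. override_field S (w(a := snd p)) (\<lambda>v. g (fst p v)))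
      \<in> measurable (PiM S (\<lambda>_. borel) \<Otimes>\<^sub>M borel) (PiM UNIV (\<lambda>_. borel))"
  proof (rule measurable_PiM_single')
    show "(\<lambda>p. override_field S (w(a := snd p)) (\<lambda>v. g (fst p v)) v)
        \<in> borel_measurable (PiM S (\<lambda>_. borel) \<Otimes>\<^sub>M borel)" for v
      by (cases "v \<in> S"; cases "v = a") (simp_all add: override_field_def)
  qed auto
  have Gm: "(\<lambda>p. G (fst p) (snd p)) \<in> borel_measurable (PiM S (\<lambda>_. borel) \<Otimes>\<^sub>M borel)"
    unfolding G_def by (rule measurable_compose[OF ogm F])
  have Gm' [measurable]: "case_prod G \<in> borel_measurable (?M \<Otimes>\<^sub>M \<nu>)"
    using Gm by (simp add: case_prod_unfold measurable_cong_sets[OF sets_pair_measure_cong[OF sPi sets] refl])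
  have Gx [measurable]: "(\<lambda>x. G x y) \<in> borel_measurable ?M" for y
    by (rule measurable_compose[OF _ Gm', of "\<lambda>x. (x, y)", simplified]) (simp add: sets_eq_imp_space_eq[OF sets])
  have Gg: "(\<lambda>(x, y). G x (g y)) \<in> borel_measurable (?M \<Otimes>\<^sub>M \<nu>)"
  proof -
    have "(\<lambda>p. (fst p, g (snd p))) \<in> measurable (?M \<Otimes>\<^sub>M \<nu>) (?M \<Otimes>\<^sub>M \<nu>)" by measurable
    from measurable_compose[OF this Gm'] show ?thesis by (simp add: case_prod_unfold)
  qed
  have icomp: "integrable ?M (\<lambda>x. h (x v))" if v: "v \<in> S" and h: "integrable \<nu> h" for v and h :: "real \<Rightarrow> real"
  proof -
    have d: "distr ?M \<nu> (\<lambda>x. x v) = \<nu>" using v \<nu> by (intro distr_PiM_component) auto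
    have "integrable (distr ?M \<nu> (\<lambda>x. x v)) h" unfolding d by (rule h)
    then show ?thesis using v h by (subst (asm) integrable_distr_eq) auto
  qed
  have ib: "integrable ?M (\<lambda>x. c0 + (\<Sum>v\<in>B. if v \<in> S then \<bar>g (x v)\<bar> else if v = a then e else \<bar>w v\<bar>))" for e
  proof (intro Bochner_Integration.integrable_add Bochner_Integration.integrable_sum Q.integrable_const)
    fix v assume "v \<in> B"
    show "integrable ?M (\<lambda>x. if v \<in> S then \<bar>g (x v)\<bar> else if v = a then e else \<bar>w v\<bar>)"
      using icomp[of v "\<lambda>y. \<bar>g y\<bar>"] ig by (cases "v \<in> S") simp_all
  qed
  have Gb: "\<bar>G x y\<bar> \<le> c0 + (\<Sum>v\<in>B. if v \<in> S then \<bar>g (x v)\<bar> else if v = a then \<bar>y\<bar> else \<bar>w v\<bar>)" for x y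
  proof -
    have "\<bar>G x y\<bar> \<le> c0 + (\<Sum>v\<in>B. \<bar>override_field S (w(a := y)) (\<lambda>v. g (x v)) v\<bar>)"
      unfolding G_def by (rule growth)
    also have "(\<Sum>v\<in>B. \<bar>override_field S (w(a := y)) (\<lambda>v. g (x v)) v\<bar>)
        = (\<Sum>v\<in>B. if v \<in> S then \<bar>g (x v)\<bar> else if v = a then \<bar>y\<bar> else \<bar>w v\<bar>)"
      by (intro sum.cong) (simp_all add: override_field_def)
    finally show ?thesis .
  qed
  have iG: "integrable ?M (\<lambda>x. G x y)" for y
    by (rule Bochner_Integration.integrable_bound[OF ib[of "\<bar>y\<bar>"] Gx])
      (use Gb in \<open>auto intro: order_trans[OF _ abs_ge_self]\<close>)
  define c where "c x = (\<integral>y. G x (g y) \<partial>\<nu>)" for x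
  have cm [measurable]: "c \<in> borel_measurable ?M"
    unfolding c_def by (rule N.borel_measurable_lebesgue_integral) (use Gg in simp)
  have iGy: "integrable \<nu> (\<lambda>y. c0 + (\<Sum>v\<in>B. if v \<in> S then \<bar>g (x v)\<bar> else if v = a then \<bar>g y\<bar> else \<bar>w v\<bar>))" for x
  proof (intro Bochner_Integration.integrable_add Bochner_Integration.integrable_sum N.integrable_const)
    show "integrable \<nu> (\<lambda>y. if v \<in> S then \<bar>g (x v)\<bar> else if v = a then \<bar>g y\<bar> else \<bar>w v\<bar>)" for v
      using ig by (cases "v \<in> S"; cases "v = a") simp_all
  qed
  have ic: "integrable ?M c"
  proof (rule Bochner_Integration.integrable_bound[OF ib[of "\<integral>y. \<bar>g y\<bar> \<partial>\<nu>"] cm], rule AE_I2)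
    fix x
    have "\<bar>c x\<bar> \<le> (\<integral>y. c0 + (\<Sum>v\<in>B. if v \<in> S then \<bar>g (x v)\<bar> else if v = a then \<bar>g y\<bar> else \<bar>w v\<bar>) \<partial>\<nu>)"
      unfolding c_def
    proof (rule order_trans[OF integral_abs_bound])
      show "(\<integral>y. \<bar>G x (g y)\<bar> \<partial>\<nu>) \<le> (\<integral>y. c0 + (\<Sum>v\<in>B. if v \<in> S then \<bar>g (x v)\<bar> else if v = a then \<bar>g y\<bar> else \<bar>w v\<bar>) \<partial>\<nu>)"
        by (rule integral_mono'[OF iGy Gb order_trans[OF abs_ge_zero Gb]])
    qed
    also have "\<dots> = c0 + (\<Sum>v\<in>B. \<integral>y. (if v \<in> S then \<bar>g (x v)\<bar> else if v = a then \<bar>g y\<bar> else \<bar>w v\<bar>) \<partial>\<nu>)"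
    proof -
      have i: "integrable \<nu> (\<lambda>y. if v \<in> S then \<bar>g (x v)\<bar> else if v = a then \<bar>g y\<bar> else \<bar>w v\<bar>)" for v
        using ig by (cases "v \<in> S"; cases "v = a") simp_all
      show ?thesis
        by (subst Bochner_Integration.integral_add) (auto simp: i N.prob_space intro!: Bochner_Integration.integrable_sum Bochner_Integration.integral_sum)
    qed
    also have "\<dots> = c0 + (\<Sum>v\<in>B. if v \<in> S then \<bar>g (x v)\<bar> else if v = a then (\<integral>y. \<bar>g y\<bar> \<partial>\<nu>) else \<bar>w v\<bar>)"
      by (intro arg_cong2[where f = "(+)"] refl sum.cong) (simp add: N.prob_space)
    finally show "norm (c x) \<le> norm (c0 + (\<Sum>v\<in>B. if v \<in> S then \<bar>g (x v)\<bar> else if v = a then (\<integral>y. \<bar>g y\<bar> \<partial>\<nu>) else \<bar>w v\<bar>))"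
      by simp
  qed
  have upd: "override_field (insert a S) w (x(a := y)) = override_field S (w(a := y)) x" for x y
    using insert.hyps by (auto simp: override_field_def fun_eq_iff)
  have updw: "override_field S (w(a := y)) x = (override_field S w x)(a := y)" for x y
    using insert.hyps by (auto simp: override_field_def fun_eq_iff)
  have exp_m: "(\<lambda>x. ennreal (exp (t * F (override_field (insert a S) w x)))) \<in> borel_measurable (PiM (insert a S) (\<lambda>_. \<nu>))"
    by measurable
  have pair: "pair_sigma_finite ?M \<nu>"
    unfolding pair_sigma_finite_def by (intro conjI Q.sigma_finite_measure_axioms N.sigma_finite_measure_axioms)
  let ?I = "integral\<^sup>L ?M c"
  have "(\<integral>\<^sup>+x. ennreal (exp (t * F (override_field (insert a S) w x))) \<partial>PiM (insert a S) (\<lambda>_. \<nu>))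
    = (\<integral>\<^sup>+y. \<integral>\<^sup>+x. ennreal (exp (t * F (override_field S (w(a := y)) x))) \<partial>?M \<partial>\<nu>)"
    by (subst P.product_nn_integral_insert_rev[OF insert.hyps exp_m]) (simp only: upd)
  also have "\<dots> \<le> (\<integral>\<^sup>+y. ennreal (exp (t * (\<integral>x. G x y \<partial>?M))) \<partial>\<nu>)"
    unfolding G_def by (intro nn_integral_mono insert.IH)
  \<comment> \<open>Before Jensen's inequality is applied in \<open>x\<close>, the function
    \<open>c\<close> with mean \<open>?I\<close> is subtracted. After the integrals are exchanged,
    the \<open>y\<close>-integral of \<open>exp (t * (G x y - c x))\<close> is at most
    \<open>1\<close> for each \<open>x\<close>, by the one-site bound.\<close>
  also have "\<dots> \<le> (\<integral>\<^sup>+y. ennreal (exp (t * ?I)) * (\<integral>\<^sup>+x. ennreal (exp (t * G x y)) * ennreal (exp (- t * c x)) \<partial>?M) \<partial>\<nu>)"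
  proof (rule nn_integral_mono)
    fix y
    have "t * (\<integral>x. G x y \<partial>?M) = t * ?I + (\<integral>x. t * (G x y - c x) \<partial>?M)"
      using iG ic by (simp add: algebra_simps)
    then have "ennreal (exp (t * (\<integral>x. G x y \<partial>?M))) = ennreal (exp (t * ?I)) * ennreal (exp (\<integral>x. t * (G x y - c x) \<partial>?M))"
      by (simp add: exp_add ennreal_mult)
    also have "ennreal (exp (\<integral>x. t * (G x y - c x) \<partial>?M)) \<le> (\<integral>\<^sup>+x. ennreal (exp (t * (G x y - c x))) \<partial>?M)"
      by (rule Q.exp_integral_le) (use iG ic in simp)
    also have "\<dots> = (\<integral>\<^sup>+x. ennreal (exp (t * G x y)) * ennreal (exp (- t * c x)) \<partial>?M)"
      by (simp add: ennreal_mult[symmetric] exp_add[symmetric] algebra_simps)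
    finally show "ennreal (exp (t * (\<integral>x. G x y \<partial>?M)))
        \<le> ennreal (exp (t * ?I)) * (\<integral>\<^sup>+x. ennreal (exp (t * G x y)) * ennreal (exp (- t * c x)) \<partial>?M)"
      by (simp add: mult_left_mono)
  qed
  also have "\<dots> = ennreal (exp (t * ?I)) * (\<integral>\<^sup>+y. \<integral>\<^sup>+x. ennreal (exp (t * G x y)) * ennreal (exp (- t * c x)) \<partial>?M \<partial>\<nu>)"
    by (rule nn_integral_cmult) measurable
  also have "(\<integral>\<^sup>+y. \<integral>\<^sup>+x. ennreal (exp (t * G x y)) * ennreal (exp (- t * c x)) \<partial>?M \<partial>\<nu>)
      = (\<integral>\<^sup>+x. \<integral>\<^sup>+y. ennreal (exp (t * G x y)) * ennreal (exp (- t * c x)) \<partial>\<nu> \<partial>?M)"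
    by (rule pair_sigma_finite.Fubini'[OF pair]) measurable
  also have "\<dots> \<le> (\<integral>\<^sup>+x. 1 \<partial>?M)"
  proof (rule nn_integral_mono)
    fix x
    have my: "(\<lambda>y. ennreal (exp (t * G x y))) \<in> borel_measurable \<nu>"
    proof -
      have "(\<lambda>y. override_field S (w(a := y)) (\<lambda>v. g (x v))) \<in> measurable borel (PiM UNIV (\<lambda>_. borel))"
        unfolding updw by (rule measurable_PiM_single') (auto simp: fun_upd_def)
      from measurable_compose[OF this F] have "G x \<in> borel_measurable borel" by (simp add: G_def[abs_def])
      then have "G x \<in> borel_measurable \<nu>" by (simp add: measurable_cong_sets[OF sets])
      then show ?thesis by measurable
    qed
    have "(\<integral>\<^sup>+y. ennreal (exp (t * G x y)) * ennreal (exp (- t * c x)) \<partial>\<nu>)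
        = (\<integral>\<^sup>+y. ennreal (exp (t * G x y)) \<partial>\<nu>) * ennreal (exp (- t * c x))"
      by (rule nn_integral_multc[OF my])
    also have "\<dots> \<le> ennreal (exp (t * c x)) * ennreal (exp (- t * c x))"
      using site[of "override_field S w (\<lambda>v. g (x v))" a]
      by (intro mult_right_mono) (simp_all add: G_def c_def updw)
    also have "\<dots> = 1" by (simp add: ennreal_mult[symmetric] exp_add[symmetric])
    finally show "(\<integral>\<^sup>+y. ennreal (exp (t * G x y)) * ennreal (exp (- t * c x)) \<partial>\<nu>) \<le> 1" .
  qed
  also have "(\<integral>\<^sup>+x. 1 \<partial>?M) = 1" by (simp add: Q.emeasure_space_1)
  finally have le: "(\<integral>\<^sup>+x. ennreal (exp (t * F (override_field (insert a S) w x))) \<partial>PiM (insert a S) (\<lambda>_. \<nu>))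
      \<le> ennreal (exp (t * ?I))" by (simp add: mult_left_mono)
  have "(\<integral>x. F (override_field (insert a S) w (\<lambda>v. g (x v))) \<partial>PiM (insert a S) (\<lambda>_. \<nu>)) = ?I"
  proof -
    have upd': "override_field (insert a S) w (\<lambda>v. g ((x(a := y)) v)) = override_field S (w(a := g y)) (\<lambda>v. g (x v))" for x y
      using insert.hyps by (auto simp: override_field_def fun_eq_iff)
    have "integrable (PiM (insert a S) (\<lambda>_. \<nu>)) (\<lambda>x. F (override_field (insert a S) w (\<lambda>v. g (x v))))"
    proof (rule Bochner_Integration.integrable_bound)
      let ?J = "insert a S"
      have pP: "prob_space (PiM ?J (\<lambda>_. \<nu>))" using \<nu> by (intro prob_space_PiM) auto
      have "integrable (PiM ?J (\<lambda>_. \<nu>)) (\<lambda>x. \<bar>override_field ?J w (\<lambda>v. g (x v)) v\<bar>)" for v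
      proof (cases "v \<in> ?J")
        case True
        have d: "distr (PiM ?J (\<lambda>_. \<nu>)) \<nu> (\<lambda>x. x v) = \<nu>" using True \<nu> by (intro distr_PiM_component) auto
        have "integrable (distr (PiM ?J (\<lambda>_. \<nu>)) \<nu> (\<lambda>x. x v)) (\<lambda>y. \<bar>g y\<bar>)" unfolding d using ig by simp
        then show ?thesis using True by (subst (asm) integrable_distr_eq) (auto simp: override_field_def)
      next
        case False
        then show ?thesis
          using finite_measure.integrable_const[OF prob_space.finite_measure[OF pP], of "\<bar>w v\<bar>"]
          by (simp add: override_field_def)
      qed
      then show "integrable (PiM ?J (\<lambda>_. \<nu>)) (\<lambda>x. c0 + (\<Sum>v\<in>B. \<bar>override_field ?J w (\<lambda>v. g (x v)) v\<bar>))"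
        using finite_measure.integrable_const[OF prob_space.finite_measure[OF pP], of c0]
        by (intro Bochner_Integration.integrable_add Bochner_Integration.integrable_sum) auto
      have "(\<lambda>x. override_field ?J w (\<lambda>v. g (x v))) \<in> measurable (PiM ?J (\<lambda>_. \<nu>)) (PiM UNIV (\<lambda>_. borel))"
      proof (rule measurable_PiM_single')
        show "(\<lambda>x. override_field ?J w (\<lambda>v. g (x v)) v) \<in> borel_measurable (PiM ?J (\<lambda>_. \<nu>))" for v
          by (cases "v \<in> ?J") (simp_all add: override_field_def)
      qed auto
      then show "(\<lambda>x. F (override_field ?J w (\<lambda>v. g (x v)))) \<in> borel_measurable (PiM ?J (\<lambda>_. \<nu>))"
        by (rule measurable_compose[OF _ F])
    qed (use growth in \<open>auto intro: order_trans[OF _ abs_ge_self]\<close>)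
    from P.product_integral_insert[OF insert.hyps this] show ?thesis
      unfolding upd' c_def[abs_def] G_def .
  qed
  then show ?case using le by simp
qed

section \<open>Exponential moments of the partition function\<close>

lemma powr_add_le:
  fixes a b t :: real
  assumes "a \<ge> 0" "b \<ge> 0" "0 < t" "t \<le> 1"
  shows "(a + b) powr t \<le> a powr t + b powr t"
proof (cases "a + b = 0")
  case False
  define c where "c = a + b"
  have c: "c > 0" using False assms by (simp add: c_def)
  have le: "x \<le> x powr t" if "0 \<le> x" "x \<le> 1" for x :: real
    using that assms powr_mono'[of t 1 x] by (cases "x = 0") auto
  have "1 = a / c + b / c" using c by (simp add: c_def add_divide_distrib[symmetric])
  also have "\<dots> \<le> (a / c) powr t + (b / c) powr t"
    using assms c by (intro add_mono le) (auto simp: c_def)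
  also have "\<dots> = (a powr t + b powr t) / c powr t"
    using assms c by (simp add: powr_divide add_divide_distrib)
  finally show ?thesis using c by (simp add: c_def pos_le_divide_eq)
qed (use assms in \<open>simp add: add_nonneg_eq_0_iff\<close>)

lemma powr_sum_le:
  fixes f :: "'b \<Rightarrow> real"
  assumes "finite A" "\<And>x. x \<in> A \<Longrightarrow> f x \<ge> 0" "0 < t" "t \<le> 1"
  shows "(\<Sum>x\<in>A. f x) powr t \<le> (\<Sum>x\<in>A. f x powr t)"
  using assms
proof (induction A rule: finite_induct)
  case (insert a A)
  have "(\<Sum>x\<in>insert a A. f x) powr t \<le> f a powr t + (\<Sum>x\<in>A. f x) powr t"
    using insert by (simp add: powr_add_le sum_nonneg)
  then show ?case using insert by simp
qed simp

lemma Z_shift_le: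
  assumes "\<And>v. v \<in> below u \<Longrightarrow> w' v \<le> w v + b" "b \<ge> 0"
  shows "Z w' u \<le> exp (real (l1 u) * b) * Z w u"
  using assms(1)
proof (induction u rule: site_induct)
  case (step u)
  have "Z w' u = exp (w' u) * (\<Sum>c | u $ c \<noteq> 0. Z w' (u - unit_site c))" by (rule Z_rec[OF step.hyps])
  also have "\<dots> \<le> exp (w u + b) * (\<Sum>c | u $ c \<noteq> 0. exp (real (l1 u - 1) * b) * Z w (u - unit_site c))"
  proof (intro mult_mono sum_mono sum_nonneg)
    show "exp (w' u) \<le> exp (w u + b)" using step.prems[of u] by (simp add: below_def)
    fix c assume c: "c \<in> {c. u $ c \<noteq> 0}"
    have "l1 (u - unit_site c) = l1 u - 1" using l1_diff_unit[of u c] c by simp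
    moreover have "Z w' (u - unit_site c) \<le> exp (real (l1 (u - unit_site c)) * b) * Z w (u - unit_site c)"
      using c step.prems below_diff_unit_iff[of u c] by (intro step.IH) auto
    ultimately show "Z w' (u - unit_site c) \<le> exp (real (l1 u - 1) * b) * Z w (u - unit_site c)" by simp
  qed (auto intro: less_imp_le[OF Z_pos])
  also have "\<dots> = exp (real (l1 u) * b) * Z w u"
  proof -
    have "l1 u \<noteq> 0" using step.hyps by simp
    then have "real (l1 u) = real (l1 u - 1) + 1" by linarith
    then have "exp (real (l1 u) * b) = exp b * exp (real (l1 u - 1) * b)"
      by (metis add.commute distrib_right exp_add mult_1)
    then show ?thesis unfolding Z_rec[OF step.hyps] by (simp add: exp_add sum_distrib_left mult_ac)
  qed
  finally show ?case .
qed simp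

section \<open>Means, and moments of \<open>Z\<close> of either sign\<close>

locale moment_field = unbounded_field +
  fixes \<xi> :: real
  assumes \<xi>: "\<xi> > 0" and exp_moment: "integrable M (\<lambda>s. exp (\<xi> * \<bar>\<omega> 0 s\<bar>))"
begin

definition H :: real where "H = expectation (\<lambda>s. exp (\<xi> * \<bar>\<omega> 0 s\<bar>))"

abbreviation logZ :: "'b site \<Rightarrow> 'a \<Rightarrow> real" where
  "logZ v s \<equiv> ln (Z (\<lambda>x. \<omega> x s) v)"

definition mean :: "'b site \<Rightarrow> real" where "mean v = expectation (logZ v)"

text \<open>The moment of \<open>Z\<close> of order \<open>t\<close>. Extended values allow products
  and sums of moments to be handled before any of them is known to be finite.\<close>

definition mom :: "real \<Rightarrow> 'b site \<Rightarrow> ennreal" where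
  "mom t v = (\<integral>\<^sup>+s. ennreal (exp (t * logZ v s)) \<partial>M)"

lemma weight_integral:
  assumes [measurable]: "f \<in> borel_measurable borel" and "integrable M (\<lambda>s. f (\<omega> 0 s))"
  shows "integrable M (\<lambda>s. f (\<omega> v s))" "expectation (\<lambda>s. f (\<omega> v s)) = expectation (\<lambda>s. f (\<omega> 0 s) :: real)"
proof -
  show "integrable M (\<lambda>s. f (\<omega> v s))"
    using assms(2) unfolding integrable_distr_eq[OF measurable_weight assms(1), symmetric] ident[of v] .
  show "expectation (\<lambda>s. f (\<omega> v s)) = expectation (\<lambda>s. f (\<omega> 0 s))"
    unfolding integral_distr[OF measurable_weight assms(1), symmetric] ident[of v] ..
qed

lemma exp_moment_le:
  assumes "t \<le> \<xi>"
  shows "integrable M (\<lambda>s. exp (t * \<bar>\<omega> v s\<bar>))"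
proof (rule Bochner_Integration.integrable_bound)
  show "integrable M (\<lambda>s. exp (\<xi> * \<bar>\<omega> v s\<bar>))"
    by (rule weight_integral(1)[where f = "\<lambda>x. exp (\<xi> * \<bar>x\<bar>)"]) (use exp_moment in auto)
qed (use assms in \<open>auto intro!: mult_right_mono\<close>)

lemma abs_weight_integrable: "integrable M (\<lambda>s. \<bar>\<omega> v s\<bar>)"
proof (rule Bochner_Integration.integrable_bound)
  show "integrable M (\<lambda>s. (1 / \<xi>) * exp (\<xi> * \<bar>\<omega> v s\<bar>))" using exp_moment_le[of \<xi> v] by simp
  show "AE s in M. norm \<bar>\<omega> v s\<bar> \<le> norm ((1 / \<xi>) * exp (\<xi> * \<bar>\<omega> v s\<bar>))"
  proof (rule AE_I2)
    fix s
    have "\<xi> * \<bar>\<omega> v s\<bar> \<le> exp (\<xi> * \<bar>\<omega> v s\<bar>)" using exp_ge_add_one_self[of "\<xi> * \<bar>\<omega> v s\<bar>"] by linarith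
    then show "norm \<bar>\<omega> v s\<bar> \<le> norm ((1 / \<xi>) * exp (\<xi> * \<bar>\<omega> v s\<bar>))" using \<xi> by (simp add: field_simps)
  qed
qed simp

lemma H_ge_1: "H \<ge> 1"
proof -
  have "expectation (\<lambda>s. 1) \<le> H"
    unfolding H_def using exp_moment \<xi> by (intro integral_mono) auto
  then show ?thesis by (simp add: prob_space)
qed

lemma logZ_integrable: "integrable M (logZ v)"
proof (rule Bochner_Integration.integrable_bound)
  show "integrable M (\<lambda>s. real (l1 v) * ln (real CARD('b)) + (\<Sum>x\<in>below v. \<bar>\<omega> x s\<bar>))"
    using abs_weight_integrable by auto
qed (auto intro!: AE_I2 abs_ln_Z_le)

lemma mean_shift:
  "integrable M (\<lambda>s. ln (Z (\<lambda>x. \<omega> (u + x) s) v))"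
  "expectation (\<lambda>s. ln (Z (\<lambda>x. \<omega> (u + x) s) v)) = mean v"
proof -
  have eq: "distr M borel (\<lambda>s. ln (Z (\<lambda>x. \<omega> (u + x) s) v)) = distr M borel (logZ v)"
    by (rule shifted_functional_law[where F = "\<lambda>w. ln (Z w v)"]) simp
  have "integrable (distr M borel (logZ v)) (\<lambda>x. x)" using logZ_integrable by (subst integrable_distr_eq) auto
  then show "integrable M (\<lambda>s. ln (Z (\<lambda>x. \<omega> (u + x) s) v))"
    unfolding eq[symmetric] by (subst (asm) integrable_distr_eq) auto
  have "expectation (\<lambda>s. ln (Z (\<lambda>x. \<omega> (u + x) s) v)) = integral\<^sup>L (distr M borel (\<lambda>s. ln (Z (\<lambda>x. \<omega> (u + x) s) v))) (\<lambda>x. x)"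
    by (subst integral_distr) auto
  also have "\<dots> = mean v" unfolding eq mean_def by (subst integral_distr) auto
  finally show "expectation (\<lambda>s. ln (Z (\<lambda>x. \<omega> (u + x) s) v)) = mean v" .
qed

lemma mean_superadditive: "mean (u + v) \<ge> mean u + mean v"
proof -
  have "mean u + mean v = expectation (\<lambda>s. logZ u s + ln (Z (\<lambda>x. \<omega> (u + x) s) v))"
    using mean_shift logZ_integrable by (simp add: mean_def)
  also have "\<dots> \<le> mean (u + v)"
    unfolding mean_def using mean_shift logZ_integrable ln_Z_superadditive
    by (intro integral_mono) auto
  finally show ?thesis .
qed

lemma mean_0: "mean 0 = 0"
  by (simp add: mean_def)

lemma exp_mean_le_mom: "ennreal (exp (t * mean v)) \<le> mom t v"
  using exp_integral_le[of "\<lambda>s. t * logZ v s"] logZ_integrable by (simp add: mom_def mean_def)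

lemma mom_0: "mom t 0 = 1"
  by (simp add: mom_def emeasure_space_1)

lemma mom_mult:
  "(\<integral>\<^sup>+s. ennreal (exp (t * logZ u s)) * ennreal (exp (t * ln (Z (\<lambda>x. \<omega> (u + x) s) v))) \<partial>M) = mom t u * mom t v"
  unfolding mom_def by (rule nn_integral_Z_mult) measurable

lemma mom_neg_submultiplicative:
  assumes "t \<ge> 0"
  shows "mom (- t) (u + v) \<le> mom (- t) u * mom (- t) v"
proof -
  have "mom (- t) (u + v) \<le> (\<integral>\<^sup>+s. ennreal (exp (- t * logZ u s)) * ennreal (exp (- t * ln (Z (\<lambda>x. \<omega> (u + x) s) v))) \<partial>M)"
    unfolding mom_def
  proof (rule nn_integral_mono)
    fix s
    have "t * (logZ u s + ln (Z (\<lambda>x. \<omega> (u + x) s) v)) \<le> t * logZ (u + v) s"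
      using assms by (intro mult_left_mono ln_Z_superadditive)
    then show "ennreal (exp (- t * logZ (u + v) s))
      \<le> ennreal (exp (- t * logZ u s)) * ennreal (exp (- t * ln (Z (\<lambda>x. \<omega> (u + x) s) v)))"
      by (simp add: ennreal_mult[symmetric] exp_add[symmetric] algebra_simps)
  qed
  then show ?thesis by (simp only: mom_mult)
qed

lemma mom_unit_le:
  assumes "\<bar>t\<bar> \<le> \<xi>"
  shows "mom t (unit_site c) \<le> ennreal (expectation (\<lambda>s. exp (\<bar>t\<bar> * \<bar>\<omega> 0 s\<bar>)))"
proof -
  have "mom t (unit_site c) \<le> (\<integral>\<^sup>+s. ennreal (exp (\<bar>t\<bar> * \<bar>\<omega> (unit_site c) s\<bar>)) \<partial>M)"
    unfolding mom_def by (intro nn_integral_mono) (simp add: abs_mult[symmetric])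
  also have "\<dots> = ennreal (expectation (\<lambda>s. exp (\<bar>t\<bar> * \<bar>\<omega> (unit_site c) s\<bar>)))"
    using exp_moment_le[OF assms] by (intro nn_integral_eq_integral) auto
  also have "expectation (\<lambda>s. exp (\<bar>t\<bar> * \<bar>\<omega> (unit_site c) s\<bar>)) = expectation (\<lambda>s. exp (\<bar>t\<bar> * \<bar>\<omega> 0 s\<bar>))"
    by (rule weight_integral(2)[where f = "\<lambda>x. exp (\<bar>t\<bar> * \<bar>x\<bar>)"]) (use exp_moment_le[OF assms] in auto)
  finally show ?thesis .
qed

text \<open>Interpolating convexly between the exponents \<open>0\<close> and \<open>\<xi>\<close>
  gives a bound whose exponent is linear in \<open>t\<close>, as needed to compare with terms
  \<open>t * mean v\<close> for small \<open>t\<close>.\<close>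

lemma exp_moment_small:
  assumes "0 \<le> t" "t \<le> \<xi>"
  shows "expectation (\<lambda>s. exp (t * \<bar>\<omega> 0 s\<bar>)) \<le> exp (t * (H / \<xi>))"
proof -
  have "expectation (\<lambda>s. exp (t * \<bar>\<omega> 0 s\<bar>)) \<le> expectation (\<lambda>s. 1 - t / \<xi> + t / \<xi> * exp (\<xi> * \<bar>\<omega> 0 s\<bar>))"
  proof (rule integral_mono)
    show "exp (t * \<bar>\<omega> 0 s\<bar>) \<le> 1 - t / \<xi> + t / \<xi> * exp (\<xi> * \<bar>\<omega> 0 s\<bar>)" for s
      using exp_mult_le_affine[of "t / \<xi>" "\<xi> * \<bar>\<omega> 0 s\<bar>"] assms \<xi> by simp
  qed (use exp_moment exp_moment_le assms in auto)
  also have "\<dots> = 1 - t / \<xi> + t / \<xi> * H" using exp_moment by (simp add: H_def prob_space)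
  also have "\<dots> \<le> 1 + t * (H / \<xi>)" using assms \<xi> by simp
  also have "\<dots> \<le> exp (t * (H / \<xi>))" by (rule exp_ge_add_one_self)
  finally show ?thesis .
qed

lemma mom_neg_le:
  assumes "0 \<le> t" "t \<le> \<xi>"
  shows "mom (- t) v \<le> ennreal (exp (t * (H / \<xi>) * real (l1 v)))"
proof (induction v rule: site_induct)
  case zero
  then show ?case by (simp add: mom_0)
next
  case (step v)
  then obtain c where c: "v $ c \<noteq> 0" by (auto simp: vec_eq_iff)
  let ?u = "v - unit_site c"
  have "mom (- t) v \<le> mom (- t) ?u * mom (- t) (unit_site c)"
    using mom_neg_submultiplicative[OF assms(1), of ?u "unit_site c"] unfolding diff_unit_add[OF c] .
  also have "\<dots> \<le> ennreal (exp (t * (H / \<xi>) * real (l1 ?u))) * ennreal (exp (t * (H / \<xi>)))"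
  proof (intro mult_mono step.IH[OF c])
    have "mom (- t) (unit_site c) \<le> ennreal (expectation (\<lambda>s. exp (t * \<bar>\<omega> 0 s\<bar>)))"
      using mom_unit_le[of "- t" c] assms by simp
    also have "\<dots> \<le> ennreal (exp (t * (H / \<xi>)))" by (intro ennreal_leI exp_moment_small assms)
    finally show "mom (- t) (unit_site c) \<le> ennreal (exp (t * (H / \<xi>)))" .
  qed auto
  also have "\<dots> = ennreal (exp (t * (H / \<xi>) * real (l1 v)))"
    unfolding l1_diff_unit[OF c]
    by (simp add: ennreal_mult[symmetric] exp_add[symmetric] algebra_simps add_divide_distrib)
  finally show ?case .
qed

lemma mom_level_le:
  assumes t: "0 < t" "t \<le> 1" and k: "k \<le> l1 v"
  shows "mom t v \<le> (\<Sum>y | y \<in> below v \<and> l1 y = k. mom t y * mom t (v - y))"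
proof -
  let ?L = "{y. y \<in> below v \<and> l1 y = k}"
  have fin: "finite ?L" by (rule finite_subset[OF _ finite_below[of v]]) blast
  have "mom t v \<le> (\<integral>\<^sup>+s. (\<Sum>y\<in>?L. ennreal (exp (t * logZ y s)) * ennreal (exp (t * ln (Z (\<lambda>x. \<omega> (y + x) s) (v - y))))) \<partial>M)"
    unfolding mom_def
  proof (rule nn_integral_mono)
    fix s
    let ?w = "\<lambda>x. \<omega> x s"
    have pw: "exp (t * ln (Z w u)) = Z w u powr t" for w and u :: "'b site"
      by (simp add: powr_def)
    have "exp (t * logZ v s) \<le> (\<Sum>y\<in>?L. Z ?w y * Z (\<lambda>x. ?w (y + x)) (v - y)) powr t"
      unfolding pw using t less_imp_le[OF Z_pos] by (intro powr_mono2 Z_level_decomposition[OF k]) auto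
    also have "\<dots> \<le> (\<Sum>y\<in>?L. (Z ?w y * Z (\<lambda>x. ?w (y + x)) (v - y)) powr t)"
      using t fin by (intro powr_sum_le) (auto intro: mult_nonneg_nonneg less_imp_le[OF Z_pos])
    also have "\<dots> = (\<Sum>y\<in>?L. exp (t * ln (Z ?w y)) * exp (t * ln (Z (\<lambda>x. ?w (y + x)) (v - y))))"
      unfolding pw by (simp add: powr_mult less_imp_le[OF Z_pos])
    finally show "ennreal (exp (t * logZ v s))
        \<le> (\<Sum>y\<in>?L. ennreal (exp (t * logZ y s)) * ennreal (exp (t * ln (Z (\<lambda>x. \<omega> (y + x) s) (v - y)))))"
      by (simp add: ennreal_mult[symmetric] sum_ennreal ennreal_leI)
  qed
  also have "\<dots> = (\<Sum>y\<in>?L. mom t y * mom t (v - y))"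
    by (subst nn_integral_sum) (simp_all add: mom_mult)
  finally show ?thesis .
qed

text \<open>Blocks of \<open>k\<close> steps are cut off repeatedly; each costs
  \<open>\<beta>\<close> and the logarithm of the number of its possible endpoints. The
  superadditive \<open>b\<close> is kept general: it is \<open>0\<close> in \<open>mom_crude\<close>
  and the mean in \<open>mom_linear\<close>.\<close>

lemma mom_iterate:
  fixes b :: "'b site \<Rightarrow> real"
  assumes t: "0 < t" "t \<le> 1" and k: "k \<ge> 1" and \<beta>: "\<beta> \<ge> 0"
    and b: "\<And>u v. b (u + v) \<ge> b u + b v"
    and base: "\<And>y. l1 y \<le> k \<Longrightarrow> mom t y \<le> ennreal (exp (t * b y + \<beta>))"
  shows "mom t v \<le> ennreal (exp (t * b v + (real (l1 v) / real k + 1) * (\<beta> + real CARD('b) * ln (real k + 1))))"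
proof (induction "l1 v" arbitrary: v rule: less_induct)
  case less
  define \<gamma> where "\<gamma> = \<beta> + real CARD('b) * ln (real k + 1)"
  have \<gamma>: "\<gamma> \<ge> \<beta>" unfolding \<gamma>_def by simp
  show ?case
  proof (cases "l1 v \<le> k")
    case True
    have "1 * \<gamma> \<le> (real (l1 v) / real k + 1) * \<gamma>" using \<gamma> \<beta> by (intro mult_right_mono) auto
    then have "exp (t * b v + \<beta>) \<le> exp (t * b v + (real (l1 v) / real k + 1) * \<gamma>)" using \<gamma> by simp
    then show ?thesis using base[OF True] unfolding \<gamma>_def by (meson ennreal_leI order_trans)
  next
    case False
    let ?L = "{y. y \<in> below v \<and> l1 y = k}"
    let ?e = "exp (t * b v + \<beta> + real (l1 v) / real k * \<gamma>)"
    have "mom t v \<le> (\<Sum>y\<in>?L. mom t y * mom t (v - y))"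
      using False by (intro mom_level_le t) auto
    also have "\<dots> \<le> (\<Sum>y\<in>?L. ennreal ?e)"
    proof (rule sum_mono)
      fix y assume y: "y \<in> ?L"
      have lv: "l1 (v - y) = l1 v - k" using y by (simp add: l1_diff)
      then have "l1 (v - y) < l1 v" using False k by simp
      from less[OF this] have "mom t (v - y) \<le> ennreal (exp (t * b (v - y) + (real (l1 (v - y)) / real k + 1) * \<gamma>))"
        by (simp add: \<gamma>_def)
      \<comment> \<open>Cutting off exactly \<open>k\<close> steps frees one unit of the prefactor,
        which pays for the block and for the choice of \<open>y\<close>.\<close>
      also have "real (l1 (v - y)) / real k + 1 = real (l1 v) / real k"
        unfolding lv using False k by (simp add: of_nat_diff diff_divide_distrib)
      finally have "mom t y * mom t (v - y)
          \<le> ennreal (exp (t * b y + \<beta>)) * ennreal (exp (t * b (v - y) + real (l1 v) / real k * \<gamma>))"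
        using y by (intro mult_mono base) auto
      also have "\<dots> = ennreal (exp (t * (b y + b (v - y)) + \<beta> + real (l1 v) / real k * \<gamma>))"
        by (simp add: ennreal_mult[symmetric] exp_add[symmetric] algebra_simps)
      also have "\<dots> \<le> ennreal ?e"
        using b[of y "v - y"] add_diff_below[of y v] y t by (auto intro!: ennreal_leI)
      finally show "mom t y * mom t (v - y) \<le> ennreal ?e" .
    qed
    also have "\<dots> = ennreal (real (card ?L) * ?e)"
      by (simp add: ennreal_mult ennreal_of_nat_eq_real_of_nat)
    also have "\<dots> \<le> ennreal (exp (real CARD('b) * ln (real k + 1)) * ?e)"
    proof (intro ennreal_leI mult_right_mono)
      have "card ?L \<le> card {y \<in> below v. l1 y \<le> k}"
        by (intro card_mono) (auto intro!: finite_subset[OF _ finite_below[of v]])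
      also have "\<dots> \<le> (k + 1) ^ CARD('b)" by (rule card_level)
      finally have "real (card ?L) \<le> real ((k + 1) ^ CARD('b))" by (rule of_nat_mono)
      also have "\<dots> = exp (real CARD('b) * ln (real k + 1))"
        by (simp add: exp_of_nat_mult add.commute)
      finally show "real (card ?L) \<le> exp (real CARD('b) * ln (real k + 1))" .
    qed simp
    also have "\<dots> = ennreal (exp (t * b v + (real (l1 v) / real k + 1) * \<gamma>))"
      by (simp add: exp_add[symmetric] \<gamma>_def algebra_simps)
    finally show ?thesis by (simp add: \<gamma>_def)
  qed
qed

text \<open>Blocks of one step give an exponent linear in the length, enough for integrability and
  for the linear growth of the mean.\<close>

lemma mom_crude:
  assumes "0 < t" "t \<le> 1" "t \<le> \<xi>"
  shows "mom t v \<le> ennreal (exp ((real (l1 v) + 1) * (ln H + real CARD('b) * ln 2)))"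
proof -
  have "mom t v \<le> ennreal (exp (t * 0 + (real (l1 v) / real 1 + 1) * (ln H + real CARD('b) * ln (real 1 + 1))))"
  proof (rule mom_iterate[where b = "\<lambda>_. 0"])
    show "ln H \<ge> 0" using H_ge_1 by simp
    fix y :: "'b site" assume y: "l1 y \<le> 1"
    show "mom t y \<le> ennreal (exp (t * 0 + ln H))"
    proof (cases "y = 0")
      case True
      then show ?thesis using H_ge_1 by (simp add: mom_0 ennreal_le_iff)
    next
      case False
      then obtain c where c: "y $ c \<noteq> 0" by (auto simp: vec_eq_iff)
      then have "l1 (y - unit_site c) = 0" using l1_diff_unit[OF c] y by simp
      then have "y = unit_site c" using diff_unit_add[OF c] by simp
      then have "mom t y \<le> ennreal (expectation (\<lambda>s. exp (t * \<bar>\<omega> 0 s\<bar>)))"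
        using mom_unit_le[of t c] assms by simp
      also have "\<dots> \<le> ennreal H"
        unfolding H_def using assms exp_moment exp_moment_le by (intro ennreal_leI integral_mono) (auto intro: mult_right_mono)
      finally show ?thesis using H_ge_1 by simp
    qed
  qed (use assms in auto)
  then show ?thesis by simp
qed

lemma mean_le: "\<exists>C\<ge>0. \<forall>v. mean v \<le> C * (real (l1 v) + 1)"
proof -
  define t where "t = min 1 \<xi>"
  have t: "0 < t" "t \<le> 1" "t \<le> \<xi>" using \<xi> by (auto simp: t_def)
  define c where "c = ln H + real CARD('b) * ln 2"
  have c: "c \<ge> 0" unfolding c_def using H_ge_1 by (intro add_nonneg_nonneg) auto
  have "mean v \<le> c / t * (real (l1 v) + 1)" for v
  proof -
    have "ennreal (exp (t * mean v)) \<le> ennreal (exp ((real (l1 v) + 1) * c))"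
      using exp_mean_le_mom mom_crude[OF t] unfolding c_def by (rule order_trans)
    then have "t * mean v \<le> (real (l1 v) + 1) * c" by (simp add: ennreal_le_iff)
    then show ?thesis using t by (simp add: field_simps)
  qed
  then show ?thesis using c t by (intro exI[of _ "c / t"]) auto
qed

end

text \<open>What exceeds \<open>L\<close> is bounded by a high power divided by a power of
  \<open>L\<close>; the maximum over many sites can then be replaced by a sum at little
  cost.\<close>

lemma exp_le_truncated_power:
  fixes y L :: real
  assumes "y > 0" "L \<ge> 1"
  shows "y \<le> L + y ^ Suc n / L ^ n"
proof (cases "y \<le> L")
  case True
  have "y ^ Suc n / L ^ n \<ge> 0" using assms by simp
  then show ?thesis using True by simp
next
  case False
  then have "1 \<le> (y / L) ^ n" using assms by (intro one_le_power) (simp add: pos_le_divide_eq)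
  then have "y * 1 \<le> y * (y / L) ^ n" using assms by (intro mult_left_mono) auto
  also have "\<dots> = y ^ Suc n / L ^ n" by (simp add: power_divide)
  finally show ?thesis using assms by simp
qed

lemma (in iid_field) restricted_field_law:
  "distr M (PiM S (\<lambda>_. borel)) (\<lambda>s. restrict (\<lambda>v. \<omega> v s) S) = PiM S (\<lambda>_. weight_law)"
proof -
  have "distr M (PiM S (\<lambda>_. borel)) (\<lambda>s. restrict (\<lambda>v. \<omega> v s) S)
      = distr (distr M field_space (\<lambda>s v. \<omega> v s)) (PiM S (\<lambda>_. borel)) (\<lambda>w. restrict w S)"
    by (subst distr_distr) (auto simp: o_def intro!: measurable_restrict)
  also have "distr M field_space (\<lambda>s v. \<omega> v s) = PiM UNIV (\<lambda>_. weight_law)"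
    using field_law[of "\<lambda>v. v"] by simp
  also have "distr (PiM UNIV (\<lambda>_. weight_law)) (PiM S (\<lambda>_. borel)) (\<lambda>w. restrict w S)
      = distr (PiM UNIV (\<lambda>_. weight_law)) (PiM S (\<lambda>_. weight_law)) (\<lambda>w. \<lambda>v\<in>S. w v)"
    by (rule distr_cong) (auto intro!: sets_PiM_cong)
  also have "\<dots> = PiM S (\<lambda>_. weight_law)"
    by (rule distr_PiM_reindex[where f = "\<lambda>v. v"]) (use prob_space_weight_law in auto)
  finally show ?thesis .
qed

section \<open>Sharp moment bounds for small positive exponents\<close>

context moment_field
begin

text \<open>The \<open>g\<close> of the overview; \<open>free_energy_eq\<close> identifies it with
  the almost sure limit.\<close>

definition mean_rate :: "real ^ 'b \<Rightarrow> real" where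
  "mean_rate u = lim (\<lambda>n. mean (floor_site (real n *\<^sub>R u)) / real n)"

lemma mean_rate_limit:
  assumes u: "u \<in> orthant - {0}"
  shows "(\<lambda>n. mean (floor_site (real n *\<^sub>R u)) / real n) \<longlonglongrightarrow> mean_rate u"
proof -
  let ?U = "{w :: 'b site. \<forall>i. w $ i \<le> 1}"
  obtain c where c: "c \<ge> 0" "\<And>v. mean v \<le> c * (real (l1 v) + 1)" using mean_le by blast
  have "convergent (\<lambda>n. mean (floor_site (real n *\<^sub>R u)) / real n)"
  proof (rule fekete_superadditive[where N = 0])
    fix m n :: nat
    let ?x = "real m *\<^sub>R u" and ?y = "real n *\<^sub>R u"
    have o: "?x \<in> orthant" "?y \<in> orthant" using u by (auto intro: scaled_orthant)
    obtain w where w: "floor_site (?x + ?y) = floor_site ?x + floor_site ?y + w" "\<forall>i. w $ i \<le> 1"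
      using floor_site_add[OF o] by blast
    \<comment> \<open>Rounding leaves one of finitely many sites, so the sum over all of them serves
      as a constant defect.\<close>
    have "\<bar>mean w\<bar> \<le> (\<Sum>w\<in>?U. \<bar>mean w\<bar>)"
      using w finite_bounded_sites[of 1] by (intro member_le_sum) auto
    moreover have "mean (floor_site ?x + floor_site ?y + w) \<ge> mean (floor_site ?x) + mean (floor_site ?y) + mean w"
      using mean_superadditive[of "floor_site ?x + floor_site ?y" w] mean_superadditive[of "floor_site ?x" "floor_site ?y"]
      by simp
    ultimately show "mean (floor_site (real (m + n) *\<^sub>R u))
        \<ge> mean (floor_site ?x) + mean (floor_site ?y) - (\<Sum>w\<in>?U. \<bar>mean w\<bar>)"
      using w by (simp add: scaleR_add_left)
  next
    fix n :: nat
    show "mean (floor_site (real n *\<^sub>R u)) \<le> c * (mass u + 1) * real n"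
    proof (cases "n = 0")
      case True
      have "floor_site (0 :: real ^ 'b) = 0" by (simp add: floor_site_def vec_eq_iff)
      then show ?thesis using True by (simp add: mean_0)
    next
      case False
      have "mean (floor_site (real n *\<^sub>R u)) \<le> c * (real (l1 (floor_site (real n *\<^sub>R u))) + 1)" by (rule c(2))
      also have "\<dots> \<le> c * (real n * mass u + real n)"
        using l1_floor_site_le[OF scaled_orthant[OF u], of n] False c(1)
        by (intro mult_left_mono add_mono) (auto simp: mass_scaleR)
      finally show ?thesis by (simp add: algebra_simps)
    qed
  qed
  then show ?thesis unfolding mean_rate_def by (simp add: convergent_LIMSEQ_iff)
qed

text \<open>Since \<open>Z\<close> is affine in the exponential of each weight, the one-site
  inequality can be tensorised over the box \<open>below u\<close>; the weights outside do not
  influence \<open>Z\<close> and are set to \<open>0\<close>.\<close>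

lemma mom_le_perturbed:
  assumes s: "0 < s" "s \<le> \<xi>"
  shows "\<exists>C\<ge>0. \<forall>t u. 0 < t \<longrightarrow> t \<le> s / 2 \<longrightarrow>
    mom t u \<le> ennreal (exp (t * expectation (\<lambda>x. ln (Z (\<lambda>v. \<omega> v x + t * C * exp (s * \<bar>\<omega> v x\<bar>)) u))))"
proof -
  have int: "integrable weight_law (\<lambda>x. exp (s * \<bar>x\<bar>))"
    using exp_moment_le[OF s(2), of 0] by (subst integrable_distr_eq) auto
  obtain C where C: "C \<ge> 0" and site: "\<And>t a b. 0 < t \<Longrightarrow> t \<le> s / 2 \<Longrightarrow> a \<ge> 0 \<Longrightarrow> b \<ge> 0 \<Longrightarrow> a + b > 0 \<Longrightarrow>
    (\<integral>\<^sup>+x. ennreal (exp (t * ln (a + b * exp x))) \<partial>weight_law)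
      \<le> ennreal (exp (t * (\<integral>x. ln (a + b * exp (x + t * C * exp (s * \<bar>x\<bar>))) \<partial>weight_law)))"
    using one_site_inequality[OF prob_space_weight_law _ s(1) int] by auto
  have "mom t u \<le> ennreal (exp (t * expectation (\<lambda>x. ln (Z (\<lambda>v. \<omega> v x + t * C * exp (s * \<bar>\<omega> v x\<bar>)) u))))"
    if t: "0 < t" "t \<le> s / 2" for t and u :: "'b site"
  proof -
    let ?S = "below u"
    define g where "g x = x + t * C * exp (s * \<bar>x\<bar>)" for x :: real
    have gm [measurable]: "g \<in> borel_measurable borel" unfolding g_def by measurable
    let ?F = "\<lambda>w. ln (Z w u)"
    let ?o = "override_field ?S (\<lambda>_. 0)"
    let ?R = "\<lambda>x. restrict (\<lambda>v. \<omega> v x) ?S"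
    let ?P = "PiM ?S (\<lambda>_. borel) :: ('b site \<Rightarrow> real) measure"
    have Rm [measurable]: "?R \<in> measurable M ?P" by (rule measurable_restrict) auto
    have iabs: "integrable weight_law (\<lambda>x. \<bar>x\<bar>)"
      using abs_weight_integrable[of 0] by (subst integrable_distr_eq) auto
    have ix: "integrable weight_law (\<lambda>x. x)"
      by (rule Bochner_Integration.integrable_bound[OF iabs]) auto
    have ig: "integrable weight_law g" unfolding g_def using ix int by simp
    have "(\<integral>\<^sup>+x. ennreal (exp (t * ?F (?o x))) \<partial>PiM ?S (\<lambda>_. weight_law))
        \<le> ennreal (exp (t * (\<integral>x. ?F (?o (\<lambda>v. g (x v))) \<partial>PiM ?S (\<lambda>_. weight_law))))"
    proof (rule tensorise_exponential_bound[where B = ?S, OF _ _ _ _ abs_ln_Z_le])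
      fix w :: "'b site \<Rightarrow> real" and v :: "'b site"
      obtain a b where ab: "a \<ge> 0" "b \<ge> 0" and Zab: "\<And>y. Z (w(v := y)) u = a + b * exp y"
        using Z_affine_in_weight[of w v u] by blast
      have "a + b > 0" using Z_pos[of "w(v := 0)" u] unfolding Zab by simp
      then show "(\<integral>\<^sup>+y. ennreal (exp (t * ln (Z (w(v := y)) u))) \<partial>weight_law)
          \<le> ennreal (exp (t * (\<integral>y. ln (Z (w(v := g y)) u) \<partial>weight_law)))"
        unfolding Zab g_def by (intro site t ab)
    qed (use prob_space_weight_law abs_ln_Z_le iabs ig t in auto)
    also have "(\<integral>\<^sup>+x. ennreal (exp (t * ?F (?o x))) \<partial>PiM ?S (\<lambda>_. weight_law)) = mom t u"
    proof -
      have "?F (?o (?R x)) = logZ u x" for x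
        by (rule arg_cong[where f = ln], rule Z_cong) (simp add: override_field_def)
      then show ?thesis
        unfolding restricted_field_law[symmetric] mom_def by (subst nn_integral_distr[OF Rm]) simp_all
    qed
    also have "(\<integral>x. ?F (?o (\<lambda>v. g (x v))) \<partial>PiM ?S (\<lambda>_. weight_law)) = expectation (\<lambda>x. ?F (\<lambda>v. g (\<omega> v x)))"
    proof -
      have eq: "?F (?o (\<lambda>v. g (?R x v))) = ?F (\<lambda>v. g (\<omega> v x))" for x
        by (rule arg_cong[where f = ln], rule Z_cong) (simp add: override_field_def)
      have "(\<lambda>x. ?o (\<lambda>v. g (x v))) \<in> measurable ?P field_space"
      proof (rule measurable_PiM_single')
        fix v
        show "(\<lambda>x. ?o (\<lambda>v. g (x v)) v) \<in> borel_measurable ?P"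
        proof (cases "v \<in> ?S")
          case True
          then have "(\<lambda>x. x v) \<in> borel_measurable ?P" by (rule measurable_component_singleton)
          from measurable_compose[OF this gm] have "(\<lambda>x. g (x v)) \<in> borel_measurable ?P" .
          then show ?thesis using True by (simp only: override_field_def if_True)
        next
          case False
          then show ?thesis by (simp only: override_field_def if_False measurable_const space_borel UNIV_I)
        qed
      qed auto
      then have "(\<lambda>x. ?F (?o (\<lambda>v. g (x v)))) \<in> borel_measurable ?P"
        by (intro borel_measurable_ln measurable_compose[OF _ measurable_Z])
      from integral_distr[OF Rm this] show ?thesis unfolding restricted_field_law eq .
    qed
    finally show ?thesis unfolding g_def .
  qed
  then show ?thesis using C by blast
qed

text \<open>In a box of side \<open>L ^ 4\<close> the largest perturbation is of order \<open>t * L\<close> in the mean.\<close>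

lemma mom_block:
  "\<exists>C>0. \<exists>t0>0. \<forall>L t u. 1 \<le> L \<longrightarrow> 0 < t \<longrightarrow> t \<le> t0 \<longrightarrow> l1 u \<le> L ^ 4 \<longrightarrow>
    mom t u \<le> ennreal (exp (t * (mean u + real (l1 u) * (t * C * real L))))"
proof -
  \<comment> \<open>For \<open>l1 u \<le> L ^ 4\<close> the box has at most
    \<open>2 ^ CARD('b) * L ^ n\<close> sites, and \<open>exp_le_truncated_power\<close> provides
    the compensating \<open>1 / L ^ n\<close>. It needs a power of order \<open>Suc n\<close>, so
    \<open>s\<close> is chosen with \<open>Suc n * s = \<xi>\<close>.\<close>
  define n where "n = 4 * CARD('b)"
  define s where "s = \<xi> / real (Suc n)"
  have s: "0 < s" "s \<le> \<xi>" "real (Suc n) * s = \<xi>" using \<xi> by (auto simp: s_def divide_le_eq)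
  obtain C where C: "C \<ge> 0" and bound: "\<And>t u. 0 < t \<Longrightarrow> t \<le> s / 2 \<Longrightarrow>
    mom t u \<le> ennreal (exp (t * expectation (\<lambda>x. ln (Z (\<lambda>v. \<omega> v x + t * C * exp (s * \<bar>\<omega> v x\<bar>)) u))))"
    using mom_le_perturbed[OF s(1,2)] by blast
  define C' where "C' = (C + 1) * (1 + 2 ^ CARD('b) * H)"
  have C': "C' > 0" unfolding C'_def using C H_ge_1 by (intro mult_pos_pos) (auto intro: add_pos_nonneg add_nonneg_pos)
  have "mom t u \<le> ennreal (exp (t * (mean u + real (l1 u) * (t * C' * real L))))"
    if L: "1 \<le> L" and t: "0 < t" "t \<le> s / 2" and u: "l1 u \<le> L ^ 4" for L :: nat and t and u :: "'b site"
  proof -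
    let ?w = "\<lambda>x v. \<omega> v x + t * C * exp (s * \<bar>\<omega> v x\<bar>)"
    \<comment> \<open>A common bound for all increases in the box: truncation at \<open>L\<close>
      plus a sum of excesses, whose mean is bounded uniformly in \<open>L\<close>.\<close>
    define b where "b x = t * C * (real L + (\<Sum>v\<in>below u. exp (\<xi> * \<bar>\<omega> v x\<bar>)) / real L ^ n)" for x
    have b0: "b x \<ge> 0" for x unfolding b_def using t C L
      by (intro mult_nonneg_nonneg add_nonneg_nonneg divide_nonneg_nonneg sum_nonneg) auto
    have pw: "ln (Z (?w x) u) \<le> real (l1 u) * b x + logZ u x" for x
    proof -
      have "Z (?w x) u \<le> exp (real (l1 u) * b x) * Z (\<lambda>v. \<omega> v x) u"
      proof (rule Z_shift_le[OF _ b0])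
        fix v assume v: "v \<in> below u"
        let ?y = "exp (s * \<bar>\<omega> v x\<bar>)"
        have "?y ^ Suc n = exp (\<xi> * \<bar>\<omega> v x\<bar>)"
          unfolding exp_of_nat_mult[symmetric] s(3)[symmetric] by (simp add: mult.assoc)
        then have "?y \<le> real L + exp (\<xi> * \<bar>\<omega> v x\<bar>) / real L ^ n"
          using exp_le_truncated_power[of ?y "real L" n] L by simp
        also have "\<dots> \<le> real L + (\<Sum>v\<in>below u. exp (\<xi> * \<bar>\<omega> v x\<bar>)) / real L ^ n"
          using v by (intro add_left_mono divide_right_mono member_le_sum) auto
        finally have "t * C * ?y \<le> b x" unfolding b_def using t C by (intro mult_left_mono) auto
        then show "?w x v \<le> \<omega> v x + b x" by simp
      qed
      then have "ln (Z (?w x) u) \<le> ln (exp (real (l1 u) * b x) * Z (\<lambda>v. \<omega> v x) u)"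
        by (subst ln_le_cancel_iff) (auto simp: Z_pos)
      then show ?thesis by (simp add: ln_mult)
    qed
    have ie: "integrable M (\<lambda>x. exp (\<xi> * \<bar>\<omega> v x\<bar>))" "integrable M (\<lambda>x. exp (s * \<bar>\<omega> v x\<bar>))" for v
      using exp_moment_le[of \<xi> v] exp_moment_le[OF s(2), of v] by auto
    have ib: "integrable M b" unfolding b_def using ie by simp
    have iw: "integrable M (\<lambda>x. ln (Z (?w x) u))"
    proof (rule Bochner_Integration.integrable_bound)
      show "integrable M (\<lambda>x. real (l1 u) * ln (real CARD('b)) + (\<Sum>v\<in>below u. \<bar>?w x v\<bar>))"
      proof (intro Bochner_Integration.integrable_add Bochner_Integration.integrable_sum)
        fix v
        have "integrable M (\<omega> v)" by (rule Bochner_Integration.integrable_bound[OF abs_weight_integrable[of v]]) auto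
        then show "integrable M (\<lambda>x. \<bar>?w x v\<bar>)" using ie(2)[of v] by simp
      qed simp
      have "(\<lambda>x. ?w x) \<in> measurable M field_space" by (rule measurable_PiM_single') auto
      then show "(\<lambda>x. ln (Z (?w x) u)) \<in> borel_measurable M"
        by (intro borel_measurable_ln measurable_compose[OF _ measurable_Z])
    qed (auto intro!: AE_I2 abs_ln_Z_le)
    have "expectation (\<lambda>x. ln (Z (?w x) u)) \<le> expectation (\<lambda>x. real (l1 u) * b x + logZ u x)"
      using iw ib logZ_integrable pw by (intro integral_mono) auto
    also have "\<dots> = real (l1 u) * expectation b + mean u"
      using ib logZ_integrable by (simp add: mean_def)
    also have "expectation b \<le> t * C' * real L"
    proof -
      have "expectation (\<lambda>x. exp (\<xi> * \<bar>\<omega> v x\<bar>)) = H" for v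
        unfolding H_def by (rule weight_integral(2)[where f = "\<lambda>x. exp (\<xi> * \<bar>x\<bar>)"]) (use exp_moment in auto)
      then have "expectation b = t * C * (real L + real (card (below u)) * H / real L ^ n)"
        unfolding b_def using ie by (simp add: prob_space)
      also have "real (card (below u)) * H / real L ^ n \<le> 2 ^ CARD('b) * H"
      proof -
        have "1 \<le> L ^ 4" using L by (rule one_le_power)
        then have "l1 u + 1 \<le> 2 * L ^ 4" using u by linarith
        then have "(l1 u + 1) ^ CARD('b) \<le> (2 * L ^ 4) ^ CARD('b)" by (rule power_mono) simp
        with card_below[of u] have "card (below u) \<le> (2 * L ^ 4) ^ CARD('b)" by (rule order_trans)
        also have "\<dots> = 2 ^ CARD('b) * L ^ n" by (simp add: n_def power_mult_distrib power_mult)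
        finally have "real (card (below u)) \<le> real (2 ^ CARD('b) * L ^ n)" by (rule of_nat_mono)
        then have "real (card (below u)) * H \<le> (2 ^ CARD('b) * real L ^ n) * H"
          using H_ge_1 by (intro mult_right_mono) auto
        then have "real (card (below u)) * H / real L ^ n \<le> (2 ^ CARD('b) * real L ^ n) * H / real L ^ n"
          by (rule divide_right_mono) simp
        then show ?thesis using L by simp
      qed
      also have "t * C * (real L + 2 ^ CARD('b) * H) \<le> t * C' * real L"
      proof -
        have "C * (real L + 2 ^ CARD('b) * H) \<le> (C + 1) * (1 * real L + 2 ^ CARD('b) * H * real L)"
        proof (rule mult_mono)
          have "(2 ^ CARD('b) * H) * 1 \<le> (2 ^ CARD('b) * H) * real L"
            using L H_ge_1 by (intro mult_left_mono) auto
          then show "real L + 2 ^ CARD('b) * H \<le> 1 * real L + 2 ^ CARD('b) * H * real L" by simp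
        qed (use C H_ge_1 in auto)
        also have "\<dots> = C' * real L" by (simp add: C'_def algebra_simps)
        finally show ?thesis using t by (simp add: mult.assoc mult_left_mono)
      qed
      finally show ?thesis using t C by (simp add: mult_left_mono)
    qed
    finally have "expectation (\<lambda>x. ln (Z (?w x) u)) \<le> mean u + real (l1 u) * (t * C' * real L)"
      by (simp add: mult_left_mono add.commute)
    then have "ennreal (exp (t * expectation (\<lambda>x. ln (Z (?w x) u))))
        \<le> ennreal (exp (t * (mean u + real (l1 u) * (t * C' * real L))))"
      using t by (intro ennreal_leI) (simp add: mult_left_mono)
    then show ?thesis using bound[OF t, of u] by (rule order_trans[rotated])
  qed
  then show ?thesis using C' s by (intro exI[of _ C'] conjI exI[of _ "s / 2"]) auto
qed

text \<open>With \<open>t = 1 / L\<^sup>2\<close> and blocks of \<open>L ^ 4\<close> steps, both the entropy \<open>ln L\<close> and the error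
  \<open>L\<close> per block are small against \<open>t * L ^ 4\<close>.\<close>

lemma mom_linear:
  assumes e: "e > 0"
  shows "\<exists>t>0. \<exists>K. \<forall>v. mom t v \<le> ennreal (exp (t * (mean v + e * real (l1 v)) + K))"
proof -
  obtain C t0 where C: "C > 0" and t0: "t0 > 0" and block: "\<And>L t u. 1 \<le> L \<Longrightarrow> 0 < t \<Longrightarrow> t \<le> t0 \<Longrightarrow> l1 u \<le> L ^ 4 \<Longrightarrow>
    mom t u \<le> ennreal (exp (t * (mean u + real (l1 u) * (t * C * real L))))"
    using mom_block by blast
  define D where "D = real CARD('b)"
  have D: "D > 0" by (simp add: D_def)
  have "(\<lambda>L. (C * real L + D * ln (real L ^ 4 + 1)) / real L ^ 2) \<longlonglongrightarrow> 0" using C D by real_asymp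
  then have 1: "\<forall>\<^sub>F L in sequentially. (C * real L + D * ln (real L ^ 4 + 1)) / real L ^ 2 < e"
    by (rule order_tendstoD) (rule e)
  have "(\<lambda>L. 1 / real L ^ 2) \<longlonglongrightarrow> 0" by real_asymp
  then have 2: "\<forall>\<^sub>F L in sequentially. 1 / real L ^ 2 < min t0 1"
    by (rule order_tendstoD) (use t0 in simp)
  obtain L where L: "(C * real L + D * ln (real L ^ 4 + 1)) / real L ^ 2 < e" "1 / real L ^ 2 < min t0 1" "L \<ge> 1"
    using eventually_happens[OF eventually_conj[OF 1 eventually_conj[OF 2 eventually_ge_at_top[of 1]]]] by auto
  define t where "t = 1 / real L ^ 2"
  define \<gamma> where "\<gamma> = C * real L + D * ln (real L ^ 4 + 1)"
  have Lp: "real L > 0" using L by simp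
  have t: "0 < t" "t \<le> 1" "t \<le> t0" using L Lp by (auto simp: t_def)
  have "mom t v \<le> ennreal (exp (t * (mean v + e * real (l1 v)) + \<gamma>))" for v
  proof -
    have "mom t v \<le> ennreal (exp (t * mean v + (real (l1 v) / real (L ^ 4) + 1) * (C * real L + real CARD('b) * ln (real (L ^ 4) + 1))))"
    proof (rule mom_iterate[OF t(1,2)])
      show "1 \<le> L ^ 4" using L by simp
      show "0 \<le> C * real L" using C by simp
      show "mean (u + v) \<ge> mean u + mean v" for u v by (rule mean_superadditive)
      fix y :: "'b site" assume y: "l1 y \<le> L ^ 4"
      \<comment> \<open>As \<open>t * t * L ^ 4 = 1\<close>, the error of a full block is of order
        \<open>L\<close>.\<close>
      have "t * (real (l1 y) * (t * C * real L)) \<le> C * real L"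
      proof -
        have "real (l1 y) \<le> real L ^ 4" using y by (metis of_nat_le_iff of_nat_power)
        then have "real (l1 y) * (t * t) \<le> real L ^ 4 * (t * t)" by (intro mult_right_mono) auto
        also have "\<dots> = 1" using Lp by (simp add: t_def power4_eq_xxxx power2_eq_square)
        finally have "real (l1 y) * (t * t) * (C * real L) \<le> 1 * (C * real L)"
          using C by (intro mult_right_mono) auto
        then show ?thesis by (simp add: mult_ac)
      qed
      then have "ennreal (exp (t * (mean y + real (l1 y) * (t * C * real L)))) \<le> ennreal (exp (t * mean y + C * real L))"
        by (intro ennreal_leI) (simp add: distrib_left)
      with block[OF L(3) t(1,3) y] show "mom t y \<le> ennreal (exp (t * mean y + C * real L))" by (rule order_trans)
    qed
    also have "\<dots> \<le> ennreal (exp (t * (mean v + e * real (l1 v)) + \<gamma>))"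
    proof (intro ennreal_leI)
      \<comment> \<open>A loss of \<open>\<gamma>\<close> per block of \<open>L ^ 4\<close> steps,
        measured in units of \<open>t = 1 / L ^ 2\<close>, is \<open>\<gamma> / L ^ 2\<close> per
        step, and \<open>L\<close> was chosen to make this less than \<open>e\<close>.\<close>
      have "\<gamma> / real L ^ 4 \<le> t * e"
      proof -
        have "\<gamma> / real L ^ 4 = t * (\<gamma> / real L ^ 2)"
          by (simp add: t_def power4_eq_xxxx power2_eq_square)
        also have "\<gamma> / real L ^ 2 \<le> e" using L(1) by (simp add: \<gamma>_def)
        finally show ?thesis using t by (simp only: mult_left_mono less_imp_le)
      qed
      then have "real (l1 v) * (\<gamma> / real L ^ 4) \<le> real (l1 v) * (t * e)" by (intro mult_left_mono) auto
      then have "t * mean v + (real (l1 v) / real (L ^ 4) + 1) * \<gamma> \<le> t * (mean v + e * real (l1 v)) + \<gamma>"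
        by (simp add: algebra_simps)
      then show "exp (t * mean v + (real (l1 v) / real (L ^ 4) + 1) * (C * real L + real CARD('b) * ln (real (L ^ 4) + 1)))
          \<le> exp (t * (mean v + e * real (l1 v)) + \<gamma>)"
        by (simp add: \<gamma>_def D_def)
    qed
    finally show ?thesis .
  qed
  then show ?thesis using t by blast
qed

end

section \<open>Tails and the zero set\<close>

lemma (in prob_space) exp_markov:
  fixes X :: "'a \<Rightarrow> real"
  assumes [measurable]: "X \<in> borel_measurable M"
  shows "ennreal (prob {s \<in> space M. X s \<ge> r}) \<le> ennreal (exp (- r)) * (\<integral>\<^sup>+s. ennreal (exp (X s)) \<partial>M)"
proof -
  have ev: "{s \<in> space M. X s \<ge> r} \<in> events" using assms unfolding borel_measurable_iff_ge by blast
  have "ennreal (prob {s \<in> space M. X s \<ge> r}) = (\<integral>\<^sup>+s. indicator {s \<in> space M. X s \<ge> r} s \<partial>M)"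
    by (simp only: nn_integral_indicator[OF ev] emeasure_eq_measure)
  also have "\<dots> \<le> (\<integral>\<^sup>+s. ennreal (exp (- r)) * ennreal (exp (X s)) \<partial>M)"
    by (rule nn_integral_mono) (auto simp: indicator_def ennreal_mult[symmetric] exp_add[symmetric])
  also have "\<dots> = ennreal (exp (- r)) * (\<integral>\<^sup>+s. ennreal (exp (X s)) \<partial>M)"
    by (rule nn_integral_cmult) (rule measurable_compose[OF measurable_compose[OF assms borel_measurable_exp] measurable_ennreal])
  finally show ?thesis .
qed

lemma summable_exp_decay: "c > 0 \<Longrightarrow> summable (\<lambda>n. exp (K - c * real n))"
proof -
  assume c: "c > 0"
  have "summable (\<lambda>n. exp K * exp (- c) ^ n)" using c by (intro summable_mult summable_geometric) auto
  moreover have "exp K * exp (- c) ^ n = exp (K - c * real n)" for n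
    by (simp add: exp_of_nat_mult[symmetric] exp_add[symmetric] mult.commute)
  ultimately show ?thesis by simp
qed

section \<open>Exponential decay of both tails\<close>

context moment_field
begin

lemma upper_tail_decay:
  assumes u: "u \<in> orthant - {0}" and r: "r > mean_rate u"
  shows "\<exists>c>0. \<exists>N. \<forall>n\<ge>N. tail (floor_site (real n *\<^sub>R u)) (real n * r) \<le> exp (- c * real n)"
proof -
  define \<delta> where "\<delta> = r - mean_rate u"
  have \<delta>: "\<delta> > 0" using r by (simp add: \<delta>_def)
  have mu: "mass u > 0" by (rule mass_pos[OF u])
  \<comment> \<open>Of the gap \<open>\<delta>\<close>, one quarter is spent on the convergence of
    the mean and one on the error \<open>e\<close> per step. Half of the remaining decay absorbs
    \<open>K\<close>, the other half is \<open>c\<close>.\<close>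
  define e where "e = \<delta> / (4 * mass u)"
  have e: "e > 0" "e * mass u = \<delta> / 4" using \<delta> mu by (auto simp: e_def)
  obtain t K where t: "t > 0" and mom: "\<And>v. mom t v \<le> ennreal (exp (t * (mean v + e * real (l1 v)) + K))"
    using mom_linear[OF e(1)] by blast
  define c where "c = t * \<delta> / 4"
  have c: "c > 0" using t \<delta> by (simp add: c_def)
  have "mean_rate u < mean_rate u + \<delta> / 4" using \<delta> by simp
  from order_tendstoD(2)[OF mean_rate_limit[OF u] this]
  obtain N1 where N1: "\<And>n. n \<ge> N1 \<Longrightarrow> mean (floor_site (real n *\<^sub>R u)) / real n < mean_rate u + \<delta> / 4"
    unfolding eventually_sequentially by blast
  obtain N2 where N2: "real N2 \<ge> K / c" using real_arch_simple by blast
  have "tail (floor_site (real n *\<^sub>R u)) (real n * r) \<le> exp (- c * real n)" if n: "n \<ge> max (max N1 N2) 1" for n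
  proof -
    let ?v = "floor_site (real n *\<^sub>R u)"
    have n0: "real n > 0" using n by simp
    have "{s \<in> space M. t * logZ ?v s \<ge> t * (real n * r)} = {s \<in> space M. logZ ?v s \<ge> real n * r}"
      using t by (simp add: mult_le_cancel_left_pos)
    then have "ennreal (tail ?v (real n * r)) \<le> ennreal (exp (- (t * (real n * r)))) * mom t ?v"
      using exp_markov[of "\<lambda>s. t * logZ ?v s" "t * (real n * r)"] by (simp add: tail_def mom_def)
    also have "\<dots> \<le> ennreal (exp (- (t * (real n * r)))) * ennreal (exp (t * (mean ?v + e * real (l1 ?v)) + K))"
      by (intro mult_left_mono mom) auto
    also have "\<dots> = ennreal (exp (- (t * (real n * r)) + (t * (mean ?v + e * real (l1 ?v)) + K)))"
      by (simp add: ennreal_mult[symmetric] exp_add[symmetric])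
    also have "\<dots> \<le> ennreal (exp (- c * real n))"
    proof (intro ennreal_leI, subst exp_le_cancel_iff)
      have "mean ?v \<le> real n * (mean_rate u + \<delta> / 4)"
        using N1[of n] n n0 by (simp add: divide_less_eq mult.commute)
      moreover have "e * real (l1 ?v) \<le> e * (real n * mass u)"
        using l1_floor_site_le[OF scaled_orthant[OF u], of n] e by (intro mult_left_mono) (auto simp: mass_scaleR)
      moreover have "e * (real n * mass u) = real n * (\<delta> / 4)" using e(2) by (metis mult.left_commute)
      moreover have "real n * (mean_rate u + \<delta> / 4) = real n * mean_rate u + real n * (\<delta> / 4)"
        by (rule distrib_left)
      moreover have "real n * (\<delta> / 2) = 2 * (real n * (\<delta> / 4))" by simp
      moreover have "r = mean_rate u + \<delta>" by (simp add: \<delta>_def)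
      then have "real n * r = real n * mean_rate u + 4 * (real n * (\<delta> / 4))" by (simp add: distrib_left)
      ultimately have "mean ?v + e * real (l1 ?v) \<le> real n * r - real n * (\<delta> / 2)"
        by linarith
      then have "t * (mean ?v + e * real (l1 ?v)) \<le> t * (real n * r - real n * (\<delta> / 2))"
        using t by (intro mult_left_mono) auto
      also have "\<dots> = t * (real n * r) - 2 * c * real n" by (simp add: c_def algebra_simps)
      finally have 1: "t * (mean ?v + e * real (l1 ?v)) \<le> t * (real n * r) - 2 * c * real n" .
      have "K / c \<le> real n" using N2 n by linarith
      then have "K \<le> c * real n" using c by (simp add: divide_le_eq mult.commute)
      then show "- (t * (real n * r)) + (t * (mean ?v + e * real (l1 ?v)) + K) \<le> - c * real n"
        using 1 by simp
    qed
    finally show ?thesis by (simp add: ennreal_le_iff)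
  qed
  then show ?thesis using c by blast
qed

lemma mom_neg_power:
  assumes "t \<ge> 0"
  shows "mom (- t) ((\<chi> i. j * y $ i) + d) \<le> mom (- t) y ^ j * mom (- t) d"
proof (induction j)
  case 0
  have "(\<chi> i. 0 * y $ i) + d = d" by (simp add: vec_eq_iff)
  then show ?case by simp
next
  case (Suc j)
  have "(\<chi> i. Suc j * y $ i) + d = y + ((\<chi> i. j * y $ i) + d)" by (simp add: vec_eq_iff)
  then have "mom (- t) ((\<chi> i. Suc j * y $ i) + d) \<le> mom (- t) y * mom (- t) ((\<chi> i. j * y $ i) + d)"
    using mom_neg_submultiplicative[OF assms, of y "(\<chi> i. j * y $ i) + d"] by simp
  also have "\<dots> \<le> mom (- t) y * (mom (- t) y ^ j * mom (- t) d)" by (intro mult_left_mono Suc) simp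
  finally show ?case by (simp add: mult.assoc)
qed

text \<open>To first order in \<open>s\<close> the logarithm of the moment is
  \<open>- s * mean y\<close>; the second-order term is at most \<open>s\<close> once
  \<open>s\<close> is small depending on \<open>y\<close>. The resulting loss of \<open>1\<close> is
  negligible against a long block.\<close>

lemma mom_neg_small:
  "\<exists>s0>0. \<forall>s. 0 < s \<longrightarrow> s \<le> s0 \<longrightarrow> mom (- s) y \<le> ennreal (exp (- s * (mean y - 1)))"
proof -
  define \<tau> where "\<tau> = min 1 \<xi>"
  have \<tau>: "0 < \<tau>" "\<tau> \<le> 1" "\<tau> \<le> \<xi>" using \<xi> by (auto simp: \<tau>_def)
  have fin: "integrable M (\<lambda>s. exp (t * logZ y s))" if "mom t y \<le> ennreal q" for t q
  proof (rule integrableI_nonneg)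
    have "mom t y < \<infinity>" using that by (rule order_le_less_trans) simp
    then show "(\<integral>\<^sup>+s. ennreal (exp (t * logZ y s)) \<partial>M) < \<infinity>" by (simp add: mom_def)
  qed auto
  have i1: "integrable M (\<lambda>s. exp (\<tau> * logZ y s))" by (rule fin[OF mom_crude[OF \<tau>]])
  have i2: "integrable M (\<lambda>s. exp (- \<tau> * logZ y s))" by (rule fin[OF mom_neg_le]) (use \<tau> in auto)
  \<comment> \<open>An integrable majorant of the second-order remainder for all orders up to
    \<open>\<tau> / 2\<close>: one half of \<open>\<tau>\<close> absorbs the square, the other the
    exponential.\<close>
  define W where "W s = (4 / \<tau>)\<^sup>2 * (exp (\<tau> * logZ y s) + exp (- \<tau> * logZ y s))" for s
  have iW: "integrable M W" unfolding W_def using i1 i2 by simp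
  define Q where "Q = expectation W"
  have Q: "Q \<ge> 0" unfolding Q_def W_def by (intro integral_nonneg_AE) auto
  define s0 where "s0 = min (\<tau> / 2) (1 / (Q + 1))"
  have s0: "s0 > 0" unfolding s0_def using \<tau> Q by auto
  have "mom (- s) y \<le> ennreal (exp (- s * (mean y - 1)))" if s: "0 < s" "s \<le> s0" for s
  proof -
    have s': "s \<le> \<tau> / 2" "s * Q \<le> 1"
    proof -
      show "s \<le> \<tau> / 2" using s by (simp add: s0_def)
      have "s * Q \<le> 1 / (Q + 1) * Q" using s Q by (intro mult_right_mono) (auto simp: s0_def)
      also have "\<dots> \<le> 1" using Q by (simp add: divide_le_eq)
      finally show "s * Q \<le> 1" .
    qed
    have pw: "exp (- s * logZ y x) \<le> 1 - s * logZ y x + s\<^sup>2 * W x" for x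
    proof -
      define l where "l = logZ y x"
      have "\<tau> / 4 * \<bar>l\<bar> \<le> exp (\<tau> / 4 * \<bar>l\<bar>)" using exp_ge_add_one_self[of "\<tau> / 4 * \<bar>l\<bar>"] by linarith
      then have "\<bar>l\<bar> \<le> (4 / \<tau>) * exp (\<tau> / 4 * \<bar>l\<bar>)" using \<tau> by (simp add: field_simps)
      then have "\<bar>l\<bar>\<^sup>2 \<le> ((4 / \<tau>) * exp (\<tau> / 4 * \<bar>l\<bar>))\<^sup>2" by (rule power_mono) simp
      then have sq: "l\<^sup>2 \<le> (4 / \<tau>)\<^sup>2 * exp (\<tau> / 2 * \<bar>l\<bar>)"
        unfolding power_mult_distrib exp_double[symmetric] by simp
      have "s * \<bar>l\<bar> \<le> \<tau> / 2 * \<bar>l\<bar>" using s' by (intro mult_right_mono) auto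
      then have "l\<^sup>2 * exp (s * \<bar>l\<bar>) \<le> ((4 / \<tau>)\<^sup>2 * exp (\<tau> / 2 * \<bar>l\<bar>)) * exp (\<tau> / 2 * \<bar>l\<bar>)"
        using sq by (intro mult_mono) auto
      also have "\<dots> = (4 / \<tau>)\<^sup>2 * exp (\<tau> * \<bar>l\<bar>)" by (simp add: mult.assoc exp_add[symmetric])
      also have "\<dots> \<le> W x"
        unfolding W_def l_def[symmetric] by (intro mult_left_mono) (auto simp: abs_if)
      finally have "s\<^sup>2 * (l\<^sup>2 * exp (s * \<bar>l\<bar>)) \<le> s\<^sup>2 * W x" by (intro mult_left_mono) auto
      moreover have "exp (- s * l) \<le> 1 + - s * l + (- s * l)\<^sup>2 * exp \<bar>- s * l\<bar>" by (rule exp_le_quadratic)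
      moreover have "\<bar>- s * l\<bar> = s * \<bar>l\<bar>" using s by (simp add: abs_mult)
      ultimately show ?thesis unfolding l_def by (simp add: power_mult_distrib mult.assoc)
    qed
    have "mom (- s) y \<le> (\<integral>\<^sup>+x. ennreal (1 - s * logZ y x + s\<^sup>2 * W x) \<partial>M)"
      unfolding mom_def using pw by (intro nn_integral_mono ennreal_leI) simp
    also have "\<dots> = ennreal (expectation (\<lambda>x. 1 - s * logZ y x + s\<^sup>2 * W x))"
      using logZ_integrable iW pw
      by (intro nn_integral_eq_integral) (auto intro!: AE_I2 intro: order_trans[OF less_imp_le[OF exp_gt_zero]])
    also have "expectation (\<lambda>x. 1 - s * logZ y x + s\<^sup>2 * W x) = 1 + (- s * mean y + s * (s * Q))"
      using logZ_integrable iW by (simp add: mean_def Q_def prob_space power2_eq_square)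
    also have "ennreal \<dots> \<le> ennreal (exp (- s * (mean y - 1)))"
    proof (rule ennreal_leI)
      have "s * (s * Q) \<le> s * 1" using s s' by (intro mult_left_mono) auto
      then have "1 + (- s * mean y + s * (s * Q)) \<le> 1 + - s * (mean y - 1)" by (simp add: algebra_simps)
      also have "\<dots> \<le> exp (- s * (mean y - 1))" by (rule exp_ge_add_one_self)
      finally show "1 + (- s * mean y + s * (s * Q)) \<le> exp (- s * (mean y - 1))" .
    qed
    finally show ?thesis .
  qed
  then show ?thesis using s0 by blast
qed

text \<open>A site on the ray is decomposed into many copies of one large block; the negative moments
  are submultiplicative over such decompositions.\<close>

lemma lower_tail_decay:
  assumes u: "u \<in> orthant - {0}" and e: "e > 0"
  shows "\<exists>c>0. \<exists>K. \<forall>n. prob {s \<in> space M. logZ (floor_site (real n *\<^sub>R u)) s \<le> real n * (mean_rate u - e)}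
    \<le> exp (K - c * real n)"
proof -
  define g where "g = mean_rate u"
  define C where "C = H / \<xi>"
  define D where "D = real CARD('b)"
  have C: "C \<ge> 0" unfolding C_def using H_ge_1 \<xi> by simp
  have mu: "mass u > 0" by (rule mass_pos[OF u])
  have "g - e / 4 < mean_rate u" using e by (simp add: g_def)
  from order_tendstoD(1)[OF mean_rate_limit[OF u] this]
  obtain N1 where N1: "\<And>n. n \<ge> N1 \<Longrightarrow> g - e / 4 < mean (floor_site (real n *\<^sub>R u)) / real n"
    unfolding eventually_sequentially by blast
  \<comment> \<open>The block is so long that the loss \<open>1\<close> of
    \<open>mom_neg_small\<close> and the rounding, up to \<open>D\<close> steps at price
    \<open>C\<close> each, together stay below \<open>k * e / 4\<close>.\<close>
  obtain N2 where N2: "real N2 \<ge> (1 + C * D) / (e / 4)" using real_arch_simple by blast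
  define k where "k = max (max N1 N2) 1"
  have k: "real k > 0" by (simp add: k_def)
  have kC: "1 + C * D \<le> real k * (e / 4)"
  proof -
    have "(1 + C * D) / (e / 4) \<le> real k" using N2 by (simp add: k_def)
    then show ?thesis using e by (simp add: divide_le_eq mult.commute)
  qed
  define y where "y = floor_site (real k *\<^sub>R u)"
  have my: "real k * (g - e / 4) \<le> mean y"
  proof -
    have "N1 \<le> k" by (simp add: k_def)
    from N1[OF this, folded y_def] show ?thesis using k by (simp add: less_divide_eq mult.commute)
  qed
  obtain s0 where s0: "s0 > 0" and small: "\<And>s. 0 < s \<Longrightarrow> s \<le> s0 \<Longrightarrow> mom (- s) y \<le> ennreal (exp (- s * (mean y - 1)))"
    using mom_neg_small[of y] by blast
  define s where "s = min s0 \<xi>"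
  have s: "0 < s" "s \<le> s0" "s \<le> \<xi>" using s0 \<xi> by (auto simp: s_def)
  define K where "K = s * (real k * \<bar>g - e / 2\<bar> + C * (real k * mass u))"
  define c where "c = s * (e / 2)"
  have c: "c > 0" using s e by (simp add: c_def)
  have "prob {x \<in> space M. logZ (floor_site (real n *\<^sub>R u)) x \<le> real n * (g - e)} \<le> exp (K - c * real n)" for n
  proof -
    let ?v = "floor_site (real n *\<^sub>R u)"
    define j where "j = n div k"
    define w :: "'b site" where "w = (\<chi> i. j * y $ i)"
    have jk: "j * k \<le> n" "n < j * k + k"
    proof -
      have "n = j * k + n mod k" "n mod k < k" using k by (simp_all add: j_def)
      then show "j * k \<le> n" "n < j * k + k" by linarith+
    qed
    have o: "real n *\<^sub>R u \<in> orthant" "real k *\<^sub>R u \<in> orthant" using u by (auto intro: scaled_orthant)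
    have un: "u $ i \<ge> 0" for i using u by (auto simp: orthant_def)
    have wb: "w \<in> below ?v"
      unfolding below_def
    proof safe
      fix i
      have "real (w $ i) = real j * real (y $ i)" by (simp add: w_def)
      also have "\<dots> \<le> real j * (real k * u $ i)"
        using floor_site_le[OF o(2), of i] by (intro mult_left_mono) (auto simp: y_def)
      also have "\<dots> = real (j * k) * u $ i" by simp
      also have "\<dots> \<le> real n * u $ i" using jk un by (intro mult_right_mono of_nat_mono) auto
      finally have "real (w $ i) \<le> (real n *\<^sub>R u) $ i" by simp
      then show "w $ i \<le> ?v $ i" by (rule le_floor_site)
    qed
    define d where "d = ?v - w"
    have v: "?v = w + d" unfolding d_def using add_diff_below[OF wb] by simp
    \<comment> \<open>The part of \<open>n\<close> beyond \<open>j * k\<close> is shorter than one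
      block, and each of the \<open>j\<close> copies of the rounded block falls short of the exact
      one by at most \<open>D\<close> steps.\<close>
    have dl: "real (l1 d) \<le> real k * mass u + real j * D"
    proof -
      have "real (l1 ?v) \<le> real n * mass u" using l1_floor_site_le[OF o(1)] by (simp add: mass_scaleR)
      moreover have "real (l1 ?v) = real (l1 w) + real (l1 d)" unfolding v by simp
      moreover have "real (l1 w) = real j * real (l1 y)" by (simp add: w_def l1_def sum_distrib_left)
      moreover have "real j * real (l1 y) \<ge> real j * (real k * mass u - D)"
        using l1_floor_site_ge[OF o(2)] by (intro mult_left_mono) (auto simp: y_def D_def mass_scaleR)
      moreover have "real n * mass u \<le> (real j * real k + real k) * mass u"
        using jk mu by (intro mult_right_mono) (auto simp flip: of_nat_mult of_nat_add)
      ultimately show ?thesis by (simp add: algebra_simps)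
    qed
    have "{x \<in> space M. - s * logZ ?v x \<ge> - s * (real n * (g - e))} = {x \<in> space M. logZ ?v x \<le> real n * (g - e)}"
      using s by (simp add: mult_le_cancel_left_pos)
    then have "ennreal (prob {x \<in> space M. logZ ?v x \<le> real n * (g - e)})
        \<le> ennreal (exp (s * (real n * (g - e)))) * mom (- s) ?v"
      using exp_markov[of "\<lambda>x. - s * logZ ?v x" "- s * (real n * (g - e))"] by (simp add: mom_def)
    also have "\<dots> \<le> ennreal (exp (s * (real n * (g - e)))) * (mom (- s) y ^ j * mom (- s) d)"
      unfolding v w_def using s by (intro mult_left_mono mom_neg_power) auto
    also have "\<dots> \<le> ennreal (exp (s * (real n * (g - e))))
        * (ennreal (exp (- s * (mean y - 1))) ^ j * ennreal (exp (s * C * real (l1 d))))"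
      using s small mom_neg_le[of s d] by (intro mult_left_mono mult_mono power_mono) (auto simp: C_def)
    also have "\<dots> = ennreal (exp (s * (real n * (g - e)) + (real j * (- s * (mean y - 1)) + s * C * real (l1 d))))"
      by (simp add: ennreal_mult[symmetric] ennreal_power exp_add[symmetric] exp_of_nat_mult[symmetric])
    also have "\<dots> \<le> ennreal (exp (K - c * real n))"
    proof (intro ennreal_leI, subst exp_le_cancel_iff)
      have "real k * (g - e / 2) \<le> mean y - 1 - C * D" using my kC by (simp add: algebra_simps)
      then have "real j * (real k * (g - e / 2)) \<le> real j * (mean y - 1 - C * D)" by (rule mult_left_mono) simp
      moreover have "C * real (l1 d) \<le> C * (real k * mass u + real j * D)" using dl C by (rule mult_left_mono)
      ultimately have 1: "real n * (g - e) - real j * (mean y - 1) + C * real (l1 d)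
          \<le> real n * (g - e) - real j * (real k * (g - e / 2)) + C * (real k * mass u)"
        by (simp add: algebra_simps)
      have "real n * (g - e / 2) - real (j * k) * (g - e / 2) \<le> real k * \<bar>g - e / 2\<bar>"
      proof -
        have "(real n - real (j * k)) * (g - e / 2) \<le> (real n - real (j * k)) * \<bar>g - e / 2\<bar>"
          using jk by (intro mult_left_mono) (auto simp flip: of_nat_mult)
        also have "\<dots> \<le> real k * \<bar>g - e / 2\<bar>"
          using jk by (intro mult_right_mono) (auto simp flip: of_nat_mult of_nat_add simp: diff_le_eq)
        finally show ?thesis by (simp add: algebra_simps)
      qed
      then have "real n * (g - e) - real j * (real k * (g - e / 2)) + C * (real k * mass u)
          \<le> real k * \<bar>g - e / 2\<bar> + C * (real k * mass u) - e / 2 * real n"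
        by (simp add: algebra_simps)
      with 1 have "s * (real n * (g - e) - real j * (mean y - 1) + C * real (l1 d))
          \<le> s * (real k * \<bar>g - e / 2\<bar> + C * (real k * mass u) - e / 2 * real n)"
        using s by (intro mult_left_mono) auto
      then show "s * (real n * (g - e)) + (real j * (- s * (mean y - 1)) + s * C * real (l1 d)) \<le> K - c * real n"
        by (simp add: K_def c_def algebra_simps)
    qed
    finally show ?thesis by (simp add: ennreal_le_iff)
  qed
  then show ?thesis using c unfolding g_def by blast
qed

text \<open>Both tails are summable in \<open>n\<close>, so by Borel-Cantelli deviations of size
  \<open>1 / Suc m\<close> occur only finitely often, almost surely for all \<open>m\<close> at
  once.\<close>

lemma logZ_limit:
  assumes u: "u \<in> orthant - {0}"
  shows "AE s in M. (\<lambda>n. logZ (floor_site (real n *\<^sub>R u)) s / real n) \<longlonglongrightarrow> mean_rate u"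
proof -
  define g where "g = mean_rate u"
  let ?v = "\<lambda>n. floor_site (real n *\<^sub>R u)"
  have up: "AE s in M. \<forall>\<^sub>F n in sequentially. s \<in> space M - {s \<in> space M. logZ (?v n) s \<ge> real n * (g + e)}"
    if e: "e > 0" for e
  proof (rule borel_cantelli_AE1)
    have "g + e > mean_rate u" using e by (simp add: g_def)
    from upper_tail_decay[OF u this] obtain c N where c: "c > 0"
      and N: "\<And>n. n \<ge> N \<Longrightarrow> tail (?v n) (real n * (g + e)) \<le> exp (- c * real n)" by blast
    have "norm (tail (?v n) (real n * (g + e))) \<le> exp (0 - c * real n)" if "n \<ge> N" for n
      using N[OF that] tail_nonneg[of "?v n" "real n * (g + e)"] by simp
    then have "summable (\<lambda>n. tail (?v n) (real n * (g + e)))"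
      by (intro summable_comparison_test[OF _ summable_exp_decay[OF c, of 0]]) blast
    then show "summable (\<lambda>n. prob {s \<in> space M. logZ (?v n) s \<ge> real n * (g + e)})" by (simp add: tail_def)
  qed (auto simp: emeasure_eq_measure)
  have lo: "AE s in M. \<forall>\<^sub>F n in sequentially. s \<in> space M - {s \<in> space M. logZ (?v n) s \<le> real n * (g - e)}"
    if e: "e > 0" for e
  proof (rule borel_cantelli_AE1)
    from lower_tail_decay[OF u e, folded g_def] obtain c K where c: "c > 0"
      and K: "\<And>n. prob {s \<in> space M. logZ (?v n) s \<le> real n * (g - e)} \<le> exp (K - c * real n)"
      by blast
    have "norm (prob {s \<in> space M. logZ (?v n) s \<le> real n * (g - e)}) \<le> exp (K - c * real n)" for n
      using K[of n] by simp
    then show "summable (\<lambda>n. prob {s \<in> space M. logZ (?v n) s \<le> real n * (g - e)})"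
      by (intro summable_comparison_test[OF _ summable_exp_decay[OF c, of K]]) blast
  qed (auto simp: emeasure_eq_measure)
  have "AE s in M. \<forall>m. (\<forall>\<^sub>F n in sequentially. s \<in> space M - {s \<in> space M. logZ (?v n) s \<ge> real n * (g + 1 / real (Suc m))})
      \<and> (\<forall>\<^sub>F n in sequentially. s \<in> space M - {s \<in> space M. logZ (?v n) s \<le> real n * (g - 1 / real (Suc m))})"
    unfolding AE_all_countable by (intro allI AE_conjI up lo) auto
  then show ?thesis
  proof eventually_elim
    case (elim s)
    show "(\<lambda>n. logZ (?v n) s / real n) \<longlonglongrightarrow> mean_rate u"
      unfolding g_def[symmetric]
    proof (rule tendstoI)
      fix e :: real assume "e > 0"
      then obtain m where m: "1 / real (Suc m) < e" using nat_approx_posE by metis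
      from elim[rule_format, of m] obtain
        1: "\<forall>\<^sub>F n in sequentially. s \<in> space M - {s \<in> space M. logZ (?v n) s \<ge> real n * (g + 1 / real (Suc m))}" and
        2: "\<forall>\<^sub>F n in sequentially. s \<in> space M - {s \<in> space M. logZ (?v n) s \<le> real n * (g - 1 / real (Suc m))}"
        by blast
      show "\<forall>\<^sub>F n in sequentially. dist (logZ (?v n) s / real n) g < e"
        using 1 2 eventually_ge_at_top[of 1]
      proof eventually_elim
        case (elim n)
        then have n: "real n > 0" by simp
        have "logZ (?v n) s < real n * (g + 1 / real (Suc m))" "logZ (?v n) s > real n * (g - 1 / real (Suc m))"
          using elim by auto
        then have "logZ (?v n) s / real n < g + 1 / real (Suc m)" "logZ (?v n) s / real n > g - 1 / real (Suc m)"
          using n by (simp_all only: pos_divide_less_eq pos_less_divide_eq mult.commute)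
        then show ?case using m by (simp add: dist_real_def)
      qed
    qed
  qed
qed

section \<open>The free energy, the zero set and the rate function\<close>

lemma free_energy_eq:
  assumes u: "u \<in> orthant - {0}"
  shows "free_energy M \<omega> u = mean_rate u"
  unfolding free_energy_def
proof (rule the_equality)
  show "AE s in M. (\<lambda>n. logZ (floor_site (real n *\<^sub>R u)) s / real n) \<longlonglongrightarrow> mean_rate u"
    by (rule logZ_limit[OF u])
  fix c assume "AE s in M. (\<lambda>n. logZ (floor_site (real n *\<^sub>R u)) s / real n) \<longlonglongrightarrow> c"
  then have "AE s in M. c = mean_rate u"
    using logZ_limit[OF u] by eventually_elim (rule LIMSEQ_unique)
  then show "c = mean_rate u" by simp
qed

lemma phi_eq_0_iff:
  assumes u: "u \<in> orthant - {0}"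
  shows "phi u r = 0 \<longleftrightarrow> r \<le> mean_rate u"
proof
  assume 0: "phi u r = 0"
  show "r \<le> mean_rate u"
  proof (rule ccontr)
    assume "\<not> r \<le> mean_rate u"
    then obtain c N where c: "c > 0" and N: "\<And>n. n \<ge> N \<Longrightarrow> tail (floor_site (real n *\<^sub>R u)) (real n * r) \<le> exp (- c * real n)"
      using upper_tail_decay[OF u] by (meson not_le)
    obtain N' where N': "\<And>n. n \<ge> N' \<Longrightarrow> floor_site (real n *\<^sub>R u) \<noteq> 0"
      using eventually_floor_site_nonzero[OF u] by blast
    have "ray u r n / real n \<le> - c" if n: "n \<ge> max (max N N') 1" for n
    proof -
      have "tail (floor_site (real n *\<^sub>R u)) (real n * r) > 0" using N'[of n] n tail_pos by simp
      then have "ray u r n \<le> - c * real n"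
        unfolding ray_def ltail_def using N[of n] n by (metis exp_gt_zero ln_exp ln_le_cancel_iff max.bounded_iff)
      then show ?thesis using n by (simp add: divide_le_eq)
    qed
    then have "phi u r \<le> - c" using LIMSEQ_le_const2[OF ray_convergent[OF u], of r "- c"] by blast
    then show False using 0 c by simp
  qed
next
  \<comment> \<open>Below the mean rate the event eventually has probability at least
    \<open>1 / 2\<close>, so its logarithm vanishes after division by \<open>n\<close>.\<close>
  have sub: "phi u t = 0" if t: "t < mean_rate u" for t
  proof -
    define e where "e = mean_rate u - t"
    have e: "e > 0" using t by (simp add: e_def)
    let ?v = "\<lambda>n. floor_site (real n *\<^sub>R u)"
    from lower_tail_decay[OF u e] obtain c K where c: "c > 0"
      and K: "\<And>n. prob {s \<in> space M. logZ (?v n) s \<le> real n * t} \<le> exp (K - c * real n)"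
      unfolding e_def by auto
    have "(\<lambda>n. exp (K - c * real n)) \<longlonglongrightarrow> 0" by (rule summable_LIMSEQ_zero[OF summable_exp_decay[OF c]])
    then have "\<forall>\<^sub>F n in sequentially. exp (K - c * real n) < 1 / 2" by (rule order_tendstoD) simp
    then obtain N where N: "\<And>n. n \<ge> N \<Longrightarrow> exp (K - c * real n) < 1 / 2"
      unfolding eventually_sequentially by blast
    have ge: "ray u t n / real n \<ge> ln (1 / 2) / real n" if n: "n \<ge> N" for n
    proof -
      have "prob (space M) \<le> prob ({s \<in> space M. logZ (?v n) s \<le> real n * t} \<union> {s \<in> space M. logZ (?v n) s \<ge> real n * t})"
        by (intro finite_measure_mono) auto
      also have "\<dots> \<le> prob {s \<in> space M. logZ (?v n) s \<le> real n * t} + tail (?v n) (real n * t)"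
        unfolding tail_def by (intro measure_Un_le) auto
      finally have "tail (?v n) (real n * t) \<ge> 1 / 2" using K[of n] N[OF n] by (simp add: prob_space)
      then have "ray u t n \<ge> ln (1 / 2)" unfolding ray_def ltail_def by (intro ln_mono) auto
      then show ?thesis by (intro divide_right_mono) auto
    qed
    have "(\<lambda>n. ln (1 / 2) / real n) \<longlonglongrightarrow> 0" by (rule lim_const_over_n)
    then have "0 \<le> phi u t" by (rule LIMSEQ_le[OF _ ray_convergent[OF u]]) (use ge in blast)
    then show ?thesis using phi_nonpos[OF u, of t] by simp
  qed
  assume "r \<le> mean_rate u"
  then have 0: "phi u (r - 1 / real (Suc n)) = 0" for n by (intro sub) (smt (verit) divide_pos_pos of_nat_0_less_iff zero_less_Suc)
  \<comment> \<open>The endpoint \<open>r = mean_rate u\<close> is out of reach of the tail bounds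
    and is obtained from below by continuity.\<close>
  have "(\<lambda>n. r - 1 / real (Suc n)) \<longlonglongrightarrow> r - 0" by (intro tendsto_diff tendsto_const LIMSEQ_Suc[OF lim_const_over_n])
  then have "(\<lambda>n. phi u (r - 1 / real (Suc n))) \<longlonglongrightarrow> phi u r" by (intro phi_tendsto u) auto
  then show "phi u r = 0" unfolding 0 by (simp add: LIMSEQ_const_iff)
qed

lemma upper_tail_eq: "upper_tail M \<omega> u r n = tail (floor_site (real n *\<^sub>R u)) (real n * r)"
  by (simp add: upper_tail_def tail_def)

lemma rate_limit:
  assumes u: "u \<in> orthant - {0}"
  shows "(\<lambda>n. ln (upper_tail M \<omega> u r n) / real n) \<longlonglongrightarrow> phi u r"
  using ray_convergent[OF u, of r] by (simp add: ray_def[abs_def] ltail_def upper_tail_eq)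

lemma rate_J_eq: "u \<in> orthant - {0} \<Longrightarrow> rate_J M \<omega> u r = - phi u r"
  unfolding rate_J_def using limI[OF rate_limit] by simp

end

theorem theorem3p2:
  fixes M :: "'a measure"
    and \<omega> :: "('d::finite) site \<Rightarrow> 'a \<Rightarrow> real"
  assumes dim: "CARD('d) \<ge> 2"
    and prob: "prob_space M"
    and indep: "prob_space.indep_vars M (\<lambda>_. borel) \<omega> UNIV"
    and ident: "\<And>v. distr M borel (\<omega> v) = distr M borel (\<omega> 0)"
    and exp_moment: "\<exists>\<xi>>0. integrable M (\<lambda>s. exp (\<xi> * \<bar>\<omega> 0 s\<bar>))"
    and unbounded: "\<And>r. measure M {s \<in> space M. \<omega> 0 s > r} > 0"
  shows "(\<forall>u \<in> orthant - {0}. \<forall>r.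
            (\<forall>\<^sub>F n in sequentially. upper_tail M \<omega> u r n > 0) \<and>
            convergent (\<lambda>n. ln (upper_tail M \<omega> u r n) / real n) \<and>
            rate_J M \<omega> u r \<ge> 0) \<and>
         convex_on ((orthant - {0}) \<times> UNIV) (\<lambda>(u, r). rate_J M \<omega> u r) \<and>
         continuous_on ((orthant - {0}) \<times> UNIV) (\<lambda>(u, r). rate_J M \<omega> u r) \<and>
         (\<forall>u \<in> orthant - {0}. \<forall>r. rate_J M \<omega> u r = 0 \<longleftrightarrow> r \<le> free_energy M \<omega> u)"
proof -
  obtain \<xi> where \<xi>: "\<xi> > 0" "integrable M (\<lambda>s. exp (\<xi> * \<bar>\<omega> 0 s\<bar>))" using exp_moment by blast
  interpret iid_field M \<omega>
    by (intro iid_field.intro iid_field_axioms.intro prob indep ident)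
  interpret moment_field M \<omega> \<xi>
    by unfold_locales (use unbounded \<xi> in auto)
  let ?D = "(orthant - {0 :: real ^ 'd}) \<times> (UNIV :: real set)"
  \<comment> \<open>\<open>rate_J\<close> is identified with \<open>- phi\<close> on the domain
    only, so convexity and continuity are transferred pointwise there.\<close>
  have eq: "(\<lambda>(u, r). - phi u r) x = (\<lambda>(u, r). rate_J M \<omega> u r) x" if "x \<in> ?D" for x
  proof -
    obtain u r where x: "x = (u, r)" by (cases x)
    then have "u \<in> orthant - {0}" using that by simp
    then show ?thesis unfolding x by (simp only: prod.case rate_J_eq)
  qed
  have "\<forall>\<^sub>F n in sequentially. upper_tail M \<omega> u r n > 0" if u: "u \<in> orthant - {0}" for u r
    using eventually_floor_site_nonzero[OF u]
    unfolding eventually_sequentially upper_tail_eq by (meson tail_pos)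
  moreover have "convergent (\<lambda>n. ln (upper_tail M \<omega> u r n) / real n)" if u: "u \<in> orthant - {0}" for u r
    using rate_limit[OF u] by (rule convergentI)
  moreover have "rate_J M \<omega> u r \<ge> 0" if u: "u \<in> orthant - {0}" for u r
    using phi_nonpos[OF u, of r] by (simp add: rate_J_eq[OF u])
  moreover have "convex_on ?D (\<lambda>(u, r). rate_J M \<omega> u r)"
    unfolding convex_on_def
  proof (intro conjI ballI allI impI)
    show "convex ?D" using phi_concave by (rule convex_on_imp_convex)
    fix x y and a b :: real
    assume *: "x \<in> ?D" "y \<in> ?D" "0 \<le> a" "0 \<le> b" "a + b = 1"
    then have "a *\<^sub>R x + b *\<^sub>R y \<in> ?D" by (intro convexD[OF \<open>convex ?D\<close>])
    then show "(\<lambda>(u, r). rate_J M \<omega> u r) (a *\<^sub>R x + b *\<^sub>R y)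
        \<le> a * (\<lambda>(u, r). rate_J M \<omega> u r) x + b * (\<lambda>(u, r). rate_J M \<omega> u r) y"
      using phi_concave * unfolding convex_on_def by (simp only: eq[symmetric])
  qed
  moreover have "continuous_on ?D (\<lambda>(u, r). rate_J M \<omega> u r)"
  proof -
    have "continuous_on ?D (\<lambda>x. - (\<lambda>(u, r). phi u r) x)" by (intro continuous_on_minus phi_continuous)
    then show ?thesis by (rule continuous_on_eq) (use eq in \<open>auto simp: case_prod_unfold\<close>)
  qed
  moreover have "rate_J M \<omega> u r = 0 \<longleftrightarrow> r \<le> free_energy M \<omega> u" if u: "u \<in> orthant - {0}" for u r
    using phi_eq_0_iff[OF u, of r] by (simp add: rate_J_eq[OF u] free_energy_eq[OF u])
  ultimately show ?thesis by blast
qed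

end
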